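(* Let $(\mathbb I,\tau)$ be a quasi-split Satake diagram. There is an embedding of algebras $$\widetilde\xi_\tau:\widetilde{\mathbf B}^\imath_\tau\to(\widetilde{\mathbf B}\otimes\widetilde{\mathbf B})^\imath$$ which sends $$\vartheta_i\mapsto1\otimes\vartheta_i+(\vartheta_{\tau i}\otimes1)\ast(1\otimes h_i),\qquad h_i\mapsto(h_{\tau i}\otimes1)\ast(1\otimes h_i),\qquad i\in\mathbb I.$$ Moreover, $\widetilde\xi_\tau(\widehat{\mathbf B}^\imath_\tau)\subseteq(\widehat{\mathbf B}\otimes\widehat{\mathbf B})^\imath$.
   Context: Let $C=(c_{ij})_{i,j\in\mathbb I}$ be a symmetrizable generalized Cartan matrix, $\mathbb I$ finite, with symmetrizer $D=\mathrm{diag}(d_i)$, $d_i\in\mathbb Z_{>0}$; $v$ an indeterminate, $v_i=v^{d_i}$, base field $\mathbb Q(v^{1/2})$; $\left[{m\atop r}\right]_{v_i}$ symmetric quantum binomials. A quasi-split Satake diagram $(\mathbb I,\tau)$ is given by a permutation $\tau$ of $\mathbb I$ with $\tau^2=\mathrm{Id}$, $c_{\tau i,\tau j}=c_{ij}$, $d_{\tau i}=d_i$. $\widetilde{\mathbf B}$ is generated by $\vartheta_i,h_i^{\pm1}$ $(i\in\mathbb I)$ with relations $h_ih_j=h_jh_i$, $h_i\vartheta_j=v_i^{c_{ij}}\vartheta_jh_i$, and $\sum_{r=0}^{1-c_{ij}}(-1)^r\left[{1-c_{ij}\atop r}\right]_{v_i}\vartheta_i^r\vartheta_j\vartheta_i^{1-c_{ij}-r}=0$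 $(i\ne j)$; $\widehat{\mathbf B}\subset\widetilde{\mathbf B}$ is the subalgebra generated by all $\vartheta_i,h_i$. $\widetilde{\mathbf B}$ is a Hopf algebra with $\Delta(\vartheta_i)=\vartheta_i\otimes1+h_i\otimes\vartheta_i$, $\Delta(h_i)=h_i\otimes h_i$, $\varepsilon(\vartheta_i)=0$, $\varepsilon(h_i)=1$, with Hopf pairing $\varphi$ ($\varphi(a,bb')=\varphi(\Delta a,b\otimes b')$, $\varphi(aa',b)=\varphi(a\otimes a',\Delta b)$, $\varphi(a,1)=\varepsilon(a)=\varphi(1,a)$) determined by $\varphi(\vartheta_i,\vartheta_j)=\delta_{ij}(v_i-v_i^{-1})$, $\varphi(h_i,h_j)=v_i^{c_{ij}}$, $\varphi(\vartheta_i,h_j)=0$. $\tau$ acts on $\widetilde{\mathbf B}$ via $\vartheta_i\mapsto\vartheta_{\tau i}$, $h_i\mapsto h_{\tau i}$. $\widetilde{\mathbf B}^\imath_\tau$ is the vector space $\widetilde{\mathbf B}$ with the associative product $a\ast b=\sum\varphi(\tau(b_{(2)}),a_{(1)})\,a_{(2)}b_{(1)}$; $\widehat{\mathbf B}^\imath_\tau$ is its subalgebra on $\widehat{\mathbf B}$. $(\widetilde{\mathbf B}\otimes\widetilde{\mathbf B})^\imath$ is the vector space $\widetilde{\mathbf B}\otimes\widetilde{\mathbf B}$ with the associative product $(a\otimes b)\ast(c\otimes d)=\sum\varphi(a_{(1)},d_{(2)})\varphi(c_{(2)},b_{(1)})\,a_{(2)}c_{(1)}\otimes b_{(2)}d_{(1)}$;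 $(\widehat{\mathbf B}\otimes\widehat{\mathbf B})^\imath$ is its subalgebra on $\widehat{\mathbf B}\otimes\widehat{\mathbf B}$. *)

theory Defs
  imports
    "HOL-Library.Poly_Mapping"
    "HOL-Computational_Algebra.Polynomial"
    "HOL-Computational_Algebra.Fraction_Field"
    "HOL-Algebra.Module"
    "HOL-Algebra.QuotRing"
    "HOL-Algebra.Subrings"
begin

definition symmetrizable_GCM :: "('i \<Rightarrow> 'i \<Rightarrow> int) \<Rightarrow> ('i \<Rightarrow> nat) \<Rightarrow> bool" where
  "symmetrizable_GCM C d \<longleftrightarrow>
     (\<forall>i. C i i = 2) \<and>
     (\<forall>i j. i \<noteq> j \<longrightarrow> C i j \<le> 0) \<and>
     (\<forall>i j. C i j = 0 \<longleftrightarrow> C j i = 0) \<and>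
     (\<forall>i. d i > 0) \<and>
     (\<forall>i j. int (d i) * C i j = int (d j) * C j i)"

definition quasi_split_satake :: "('i \<Rightarrow> 'i \<Rightarrow> int) \<Rightarrow> ('i \<Rightarrow> nat) \<Rightarrow> ('i \<Rightarrow> 'i) \<Rightarrow> bool" where
  "quasi_split_satake C d \<tau> \<longleftrightarrow>
     bij \<tau> \<and> \<tau> \<circ> \<tau> = id \<and>
     (\<forall>i j. C (\<tau> i) (\<tau> j) = C i j) \<and> (\<forall>i. d (\<tau> i) = d i)"

text \<open>The field of rational functions over the rationals in the indeterminate \<open>v\<^sup>1\<^sup>/\<^sup>2\<close>;
  the indeterminate of the polynomial ring plays the role of \<open>v\<^sup>1\<^sup>/\<^sup>2\<close>, so that \<open>v\<close> (\<open>v_base\<close> below) is its square.\<close>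

type_synonym base = "rat poly fract"

definition v_half :: base where "v_half = Fract [:0, 1:] 1"

definition v_base :: base where "v_base = v_half ^ 2"

definition vi :: "('i \<Rightarrow> nat) \<Rightarrow> 'i \<Rightarrow> base" where "vi d i = v_base ^ d i"

definition qint :: "base \<Rightarrow> nat \<Rightarrow> base" where
  "qint q n = (q ^ n - inverse q ^ n) / (q - inverse q)"

definition qfact :: "base \<Rightarrow> nat \<Rightarrow> base" where
  "qfact q n = (\<Prod>k=1..n. qint q k)"

definition qbinom :: "base \<Rightarrow> nat \<Rightarrow> nat \<Rightarrow> base" where
  "qbinom q m r = qfact q m / (qfact q r * qfact q (m - r))"

text \<open>Vector spaces and (non-commutative) algebras over a field type \<open>'k\<close> are records of type
  \<open>('k, 'a) module\<close>; the field of scalars is the whole type \<open>'k\<close>.\<close>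

definition alg_hom :: "('k, 'a) module \<Rightarrow> ('k, 'b) module \<Rightarrow> ('a \<Rightarrow> 'b) set" where
  "alg_hom A B = {f \<in> ring_hom A B. \<forall>c. \<forall>x \<in> carrier A. f (c \<odot>\<^bsub>A\<^esub> x) = c \<odot>\<^bsub>B\<^esub> f x}"

definition field_alg :: "('k::field, 'k) module" where
  "field_alg = \<lparr>carrier = UNIV, mult = (*), one = 1, zero = 0, add = (+), smult = (*)\<rparr>"

definition bilinear_form :: "('k::field, 'a) module \<Rightarrow> ('a \<Rightarrow> 'a \<Rightarrow> 'k) \<Rightarrow> bool" where
  "bilinear_form V \<phi> \<longleftrightarrow>
     (\<forall>x \<in> carrier V. \<forall>y \<in> carrier V. \<forall>z \<in> carrier V.
        \<phi> (x \<oplus>\<^bsub>V\<^esub> y) z = \<phi> x z + \<phi> y z \<and> \<phi> z (x \<oplus>\<^bsub>V\<^esub> y) = \<phi> z x + \<phi> z y) \<and>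
     (\<forall>c. \<forall>x \<in> carrier V. \<forall>y \<in> carrier V.
        \<phi> (c \<odot>\<^bsub>V\<^esub> x) y = c * \<phi> x y \<and> \<phi> x (c \<odot>\<^bsub>V\<^esub> y) = c * \<phi> x y)"

definition gen_subalgebra :: "('k, 'a) module \<Rightarrow> 'a set \<Rightarrow> 'a set" where
  "gen_subalgebra A S =
     \<Inter>{T. subring T A \<and> (\<forall>c. \<forall>x \<in> T. c \<odot>\<^bsub>A\<^esub> x \<in> T) \<and> S \<subseteq> T}"

text \<open>\<open>V \<otimes> W\<close> is the free vector space on \<open>carrier V \<times> carrier W\<close> modulo the bilinearity
  relations; its elements are cosets of \<open>tensor_null V W\<close>.\<close>

abbreviation pm_scale :: "'k::field \<Rightarrow> ('a \<Rightarrow>\<^sub>0 'k) \<Rightarrow> ('a \<Rightarrow>\<^sub>0 'k)" where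
  "pm_scale c \<equiv> Poly_Mapping.map ((*) c)"

inductive_set tensor_null ::
  "('k::field, 'a) module \<Rightarrow> ('k, 'b) module \<Rightarrow> (('a \<times> 'b) \<Rightarrow>\<^sub>0 'k) set"
  for V :: "('k::field, 'a) module" and W :: "('k, 'b) module" where
  "0 \<in> tensor_null V W"
| "\<lbrakk>s \<in> tensor_null V W; t \<in> tensor_null V W\<rbrakk> \<Longrightarrow> s + t \<in> tensor_null V W"
| "s \<in> tensor_null V W \<Longrightarrow> pm_scale c s \<in> tensor_null V W"
| "\<lbrakk>x \<in> carrier V; x' \<in> carrier V; y \<in> carrier W\<rbrakk> \<Longrightarrow>
     Poly_Mapping.single (x \<oplus>\<^bsub>V\<^esub> x', y) 1 - Poly_Mapping.single (x, y) 1
       - Poly_Mapping.single (x', y) 1 \<in> tensor_null V W"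
| "\<lbrakk>x \<in> carrier V; y \<in> carrier W; y' \<in> carrier W\<rbrakk> \<Longrightarrow>
     Poly_Mapping.single (x, y \<oplus>\<^bsub>W\<^esub> y') 1 - Poly_Mapping.single (x, y) 1
       - Poly_Mapping.single (x, y') 1 \<in> tensor_null V W"
| "\<lbrakk>x \<in> carrier V; y \<in> carrier W\<rbrakk> \<Longrightarrow>
     Poly_Mapping.single (c \<odot>\<^bsub>V\<^esub> x, y) 1 - Poly_Mapping.single (x, y) c \<in> tensor_null V W"
| "\<lbrakk>x \<in> carrier V; y \<in> carrier W\<rbrakk> \<Longrightarrow>
     Poly_Mapping.single (x, c \<odot>\<^bsub>W\<^esub> y) 1 - Poly_Mapping.single (x, y) c \<in> tensor_null V W"

type_synonym ('k, 'a, 'b) tensor = "(('a \<times> 'b) \<Rightarrow>\<^sub>0 'k) set"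

definition tensor_class ::
  "('k::field, 'a) module \<Rightarrow> ('k, 'b) module \<Rightarrow> (('a \<times> 'b) \<Rightarrow>\<^sub>0 'k) \<Rightarrow> ('k, 'a, 'b) tensor" where
  "tensor_class V W s =
     {t. Poly_Mapping.keys t \<subseteq> carrier V \<times> carrier W \<and> t - s \<in> tensor_null V W}"

definition tensor_rep :: "('k::field, 'a, 'b) tensor \<Rightarrow> (('a \<times> 'b) \<Rightarrow>\<^sub>0 'k)" where
  "tensor_rep X = (SOME s. s \<in> X)"

definition pure_tensor ::
  "('k::field, 'a) module \<Rightarrow> ('k, 'b) module \<Rightarrow> 'a \<Rightarrow> 'b \<Rightarrow> ('k, 'a, 'b) tensor" where
  "pure_tensor V W x y = tensor_class V W (Poly_Mapping.single (x, y) 1)"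

text \<open>For \<open>f\<close> bilinear from \<open>V \<times> W\<close> to \<open>U\<close>, the induced linear map \<open>V \<otimes> W \<rightarrow> U\<close>, sending
  \<open>\<Sum>\<^sub>k c\<^sub>k x\<^sub>k \<otimes> y\<^sub>k\<close> to \<open>\<Sum>\<^sub>k c\<^sub>k f x\<^sub>k y\<^sub>k\<close>.  In particular, \<open>tensor_lift U f (\<Delta> a)\<close> is the
  Sweedler sum of \<open>f a\<^sub>(\<^sub>1\<^sub>) a\<^sub>(\<^sub>2\<^sub>)\<close>.\<close>

definition tensor_lift ::
  "('k::field, 'c) module \<Rightarrow> ('a \<Rightarrow> 'b \<Rightarrow> 'c) \<Rightarrow> ('k, 'a, 'b) tensor \<Rightarrow> 'c" where
  "tensor_lift U f X =
     (\<Oplus>\<^bsub>U\<^esub>p \<in> Poly_Mapping.keys (tensor_rep X).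
        Poly_Mapping.lookup (tensor_rep X) p \<odot>\<^bsub>U\<^esub> f (fst p) (snd p))"

text \<open>The underlying vector space; \<open>mult\<close> and \<open>one\<close> are filled in by \<open>tensor_alg\<close>.\<close>

definition tensor_space ::
  "('k::field, 'a) module \<Rightarrow> ('k, 'b) module \<Rightarrow> ('k, ('k, 'a, 'b) tensor) module" where
  "tensor_space V W =
     \<lparr>carrier = tensor_class V W ` {s. Poly_Mapping.keys s \<subseteq> carrier V \<times> carrier W},
      mult = (\<lambda>_ _. undefined), one = undefined,
      zero = tensor_class V W 0,
      add = (\<lambda>X Y. tensor_class V W (tensor_rep X + tensor_rep Y)),
      smult = (\<lambda>c X. tensor_class V W (pm_scale c (tensor_rep X)))\<rparr>"

definition tensor_alg ::
  "('k::field, 'a) module \<Rightarrow> ('k, 'b) module \<Rightarrow> ('k, ('k, 'a, 'b) tensor) module" where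
  "tensor_alg A B = (tensor_space A B)
     \<lparr>mult := (\<lambda>X Y. tensor_lift (tensor_space A B) (\<lambda>a b.
                tensor_lift (tensor_space A B) (\<lambda>a' b'.
                  pure_tensor A B (a \<otimes>\<^bsub>A\<^esub> a') (b \<otimes>\<^bsub>B\<^esub> b')) Y) X),
      one := pure_tensor A B \<one>\<^bsub>A\<^esub> \<one>\<^bsub>B\<^esub>\<rparr>"

text \<open>The image of \<open>S \<otimes> T\<close> in \<open>V \<otimes> W\<close>, for subspaces \<open>S\<close> of \<open>V\<close> and \<open>T\<close> of \<open>W\<close>.\<close>

definition tensor_subspace ::
  "('k::field, 'a) module \<Rightarrow> ('k, 'b) module \<Rightarrow> 'a set \<Rightarrow> 'b set \<Rightarrow> ('k, 'a, 'b) tensor set" where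
  "tensor_subspace V W S T = tensor_class V W ` {s. Poly_Mapping.keys s \<subseteq> S \<times> T}"

text \<open>The free algebra on a set of letters is the monoid algebra of the monoid of words.  Words are
  wrapped lists, written additively, so that the multiplication of finitely supported functions on words provided by
  the library is the concatenation product.\<close>

datatype 'a word = Word (letters: "'a list")

instantiation word :: (type) monoid_add
begin

definition zero_word :: "'a word" where "0 = Word []"

definition plus_word :: "'a word \<Rightarrow> 'a word \<Rightarrow> 'a word" where
  "u + w = Word (letters u @ letters w)"

instance by standard (auto simp: zero_word_def plus_word_def)

end

type_synonym 'a free_algebra = "'a word \<Rightarrow>\<^sub>0 base"

definition scalar :: "base \<Rightarrow> 'a free_algebra" where
  "scalar c = Poly_Mapping.single 0 c"

definition letter :: "'a \<Rightarrow> 'a free_algebra" where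
  "letter a = Poly_Mapping.single (Word [a]) 1"

definition free_ring :: "'a free_algebra ring" where
  "free_ring = \<lparr>carrier = UNIV, mult = (*), one = 1, zero = 0, add = (+)\<rparr>"

datatype 'i gen = Theta 'i | H 'i | Hinv 'i

definition serre :: "('i \<Rightarrow> 'i \<Rightarrow> int) \<Rightarrow> ('i \<Rightarrow> nat) \<Rightarrow> 'i \<Rightarrow> 'i \<Rightarrow> 'i gen free_algebra" where
  "serre C d i j = (let m = nat (1 - C i j) in
     \<Sum>r = 0..m. scalar ((- 1) ^ r * qbinom (vi d i) m r) *
       (letter (Theta i) ^ r * letter (Theta j) * letter (Theta i) ^ (m - r)))"

definition bt_relators :: "('i \<Rightarrow> 'i \<Rightarrow> int) \<Rightarrow> ('i \<Rightarrow> nat) \<Rightarrow> 'i gen free_algebra set" where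
  "bt_relators C d =
     {letter (H i) * letter (Hinv i) - 1 | i. True} \<union>
     {letter (Hinv i) * letter (H i) - 1 | i. True} \<union>
     {letter (H i) * letter (H j) - letter (H j) * letter (H i) | i j. True} \<union>
     {letter (H i) * letter (Theta j)
        - scalar (vi d i powi C i j) * (letter (Theta j) * letter (H i)) | i j. True} \<union>
     {serre C d i j | i j. i \<noteq> j}"

definition bt_ideal :: "('i \<Rightarrow> 'i \<Rightarrow> int) \<Rightarrow> ('i \<Rightarrow> nat) \<Rightarrow> 'i gen free_algebra set" where
  "bt_ideal C d = Idl\<^bsub>free_ring\<^esub> (bt_relators C d)"

type_synonym 'i bt = "'i gen free_algebra set"

definition bt_class ::
  "('i \<Rightarrow> 'i \<Rightarrow> int) \<Rightarrow> ('i \<Rightarrow> nat) \<Rightarrow> 'i gen free_algebra \<Rightarrow> 'i bt" where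
  "bt_class C d x = bt_ideal C d +>\<^bsub>free_ring\<^esub> x"

definition Bt :: "('i \<Rightarrow> 'i \<Rightarrow> int) \<Rightarrow> ('i \<Rightarrow> nat) \<Rightarrow> (base, 'i bt) module" where
  "Bt C d = (let Q = free_ring Quot bt_ideal C d in
     \<lparr>carrier = carrier Q, mult = mult Q, one = one Q, zero = zero Q, add = add Q,
      smult = (\<lambda>c X. bt_class C d (scalar c) \<otimes>\<^bsub>Q\<^esub> X)\<rparr>)"

abbreviation BtBt ::
  "('i \<Rightarrow> 'i \<Rightarrow> int) \<Rightarrow> ('i \<Rightarrow> nat) \<Rightarrow> (base, (base, 'i bt, 'i bt) tensor) module" where
  "BtBt C d \<equiv> tensor_alg (Bt C d) (Bt C d)"

abbreviation bt_tensor ::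
  "('i \<Rightarrow> 'i \<Rightarrow> int) \<Rightarrow> ('i \<Rightarrow> nat) \<Rightarrow> 'i bt \<Rightarrow> 'i bt \<Rightarrow> (base, 'i bt, 'i bt) tensor" where
  "bt_tensor C d \<equiv> pure_tensor (Bt C d) (Bt C d)"

definition theta :: "('i \<Rightarrow> 'i \<Rightarrow> int) \<Rightarrow> ('i \<Rightarrow> nat) \<Rightarrow> 'i \<Rightarrow> 'i bt" where
  "theta C d i = bt_class C d (letter (Theta i))"

definition hh :: "('i \<Rightarrow> 'i \<Rightarrow> int) \<Rightarrow> ('i \<Rightarrow> nat) \<Rightarrow> 'i \<Rightarrow> 'i bt" where
  "hh C d i = bt_class C d (letter (H i))"

definition Bhat :: "('i \<Rightarrow> 'i \<Rightarrow> int) \<Rightarrow> ('i \<Rightarrow> nat) \<Rightarrow> 'i bt set" where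
  "Bhat C d = gen_subalgebra (Bt C d) (range (theta C d) \<union> range (hh C d))"

definition BhatBhat ::
  "('i \<Rightarrow> 'i \<Rightarrow> int) \<Rightarrow> ('i \<Rightarrow> nat) \<Rightarrow> (base, 'i bt, 'i bt) tensor set" where
  "BhatBhat C d = tensor_subspace (Bt C d) (Bt C d) (Bhat C d) (Bhat C d)"

text \<open>For a symmetrizable generalized Cartan matrix and a quasi-split Satake diagram, each of the
  predicates \<open>is_comult\<close>, \<open>is_counit\<close>, \<open>is_hopf_pairing\<close>, \<open>is_diagram_action\<close> is satisfied by
  exactly one map on the carrier of \<^const>\<open>Bt\<close>: an algebra homomorphism out of it is determined by
  its values on \<open>theta\<close> and \<open>hh\<close> (the values on the inverses of the latter being forced), and so is
  the Hopf pairing.  The antipode enters none of the constructions below.\<close>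

definition is_comult ::
  "('i \<Rightarrow> 'i \<Rightarrow> int) \<Rightarrow> ('i \<Rightarrow> nat) \<Rightarrow> ('i bt \<Rightarrow> (base, 'i bt, 'i bt) tensor) \<Rightarrow> bool" where
  "is_comult C d \<Delta> \<longleftrightarrow>
     \<Delta> \<in> alg_hom (Bt C d) (BtBt C d) \<and>
     (\<forall>i. \<Delta> (theta C d i) =
        bt_tensor C d (theta C d i) \<one>\<^bsub>Bt C d\<^esub> \<oplus>\<^bsub>BtBt C d\<^esub> bt_tensor C d (hh C d i) (theta C d i)) \<and>
     (\<forall>i. \<Delta> (hh C d i) = bt_tensor C d (hh C d i) (hh C d i))"

definition is_counit ::
  "('i \<Rightarrow> 'i \<Rightarrow> int) \<Rightarrow> ('i \<Rightarrow> nat) \<Rightarrow> ('i bt \<Rightarrow> base) \<Rightarrow> bool" where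
  "is_counit C d \<epsilon> \<longleftrightarrow>
     \<epsilon> \<in> alg_hom (Bt C d) field_alg \<and>
     (\<forall>i. \<epsilon> (theta C d i) = 0) \<and> (\<forall>i. \<epsilon> (hh C d i) = 1)"

definition is_hopf_pairing ::
  "('i \<Rightarrow> 'i \<Rightarrow> int) \<Rightarrow> ('i \<Rightarrow> nat) \<Rightarrow> ('i bt \<Rightarrow> (base, 'i bt, 'i bt) tensor) \<Rightarrow> ('i bt \<Rightarrow> base)
     \<Rightarrow> ('i bt \<Rightarrow> 'i bt \<Rightarrow> base) \<Rightarrow> bool" where
  "is_hopf_pairing C d \<Delta> \<epsilon> \<phi> \<longleftrightarrow>
     bilinear_form (Bt C d) \<phi> \<and>
     (\<forall>a \<in> carrier (Bt C d). \<forall>b \<in> carrier (Bt C d). \<forall>b' \<in> carrier (Bt C d).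
        \<phi> a (b \<otimes>\<^bsub>Bt C d\<^esub> b') = tensor_lift field_alg (\<lambda>a1 a2. \<phi> a1 b * \<phi> a2 b') (\<Delta> a)) \<and>
     (\<forall>a \<in> carrier (Bt C d). \<forall>a' \<in> carrier (Bt C d). \<forall>b \<in> carrier (Bt C d).
        \<phi> (a \<otimes>\<^bsub>Bt C d\<^esub> a') b = tensor_lift field_alg (\<lambda>b1 b2. \<phi> a b1 * \<phi> a' b2) (\<Delta> b)) \<and>
     (\<forall>a \<in> carrier (Bt C d). \<phi> a \<one>\<^bsub>Bt C d\<^esub> = \<epsilon> a \<and> \<phi> \<one>\<^bsub>Bt C d\<^esub> a = \<epsilon> a) \<and>
     (\<forall>i j. \<phi> (theta C d i) (theta C d j) =
        (if i = j then vi d i - inverse (vi d i) else 0)) \<and>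
     (\<forall>i j. \<phi> (hh C d i) (hh C d j) = vi d i powi C i j) \<and>
     (\<forall>i j. \<phi> (theta C d i) (hh C d j) = 0)"

definition is_diagram_action ::
  "('i \<Rightarrow> 'i \<Rightarrow> int) \<Rightarrow> ('i \<Rightarrow> nat) \<Rightarrow> ('i \<Rightarrow> 'i) \<Rightarrow> ('i bt \<Rightarrow> 'i bt) \<Rightarrow> bool" where
  "is_diagram_action C d \<tau> T \<longleftrightarrow>
     T \<in> alg_hom (Bt C d) (Bt C d) \<and>
     (\<forall>i. T (theta C d i) = theta C d (\<tau> i)) \<and> (\<forall>i. T (hh C d i) = hh C d (\<tau> i))"

definition Bt_iota ::
  "('i \<Rightarrow> 'i \<Rightarrow> int) \<Rightarrow> ('i \<Rightarrow> nat) \<Rightarrow> ('i bt \<Rightarrow> (base, 'i bt, 'i bt) tensor)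
     \<Rightarrow> ('i bt \<Rightarrow> 'i bt \<Rightarrow> base) \<Rightarrow> ('i bt \<Rightarrow> 'i bt) \<Rightarrow> (base, 'i bt) module" where
  "Bt_iota C d \<Delta> \<phi> T = (Bt C d)\<lparr>mult := (\<lambda>a b.
     tensor_lift (Bt C d) (\<lambda>a1 a2.
       tensor_lift (Bt C d) (\<lambda>b1 b2.
         \<phi> (T b2) a1 \<odot>\<^bsub>Bt C d\<^esub> (a2 \<otimes>\<^bsub>Bt C d\<^esub> b1)) (\<Delta> b)) (\<Delta> a))\<rparr>"

definition BtBt_iota ::
  "('i \<Rightarrow> 'i \<Rightarrow> int) \<Rightarrow> ('i \<Rightarrow> nat) \<Rightarrow> ('i bt \<Rightarrow> (base, 'i bt, 'i bt) tensor)
     \<Rightarrow> ('i bt \<Rightarrow> 'i bt \<Rightarrow> base) \<Rightarrow> (base, (base, 'i bt, 'i bt) tensor) module" where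
  "BtBt_iota C d \<Delta> \<phi> = (BtBt C d)\<lparr>mult := (\<lambda>X Y.
     tensor_lift (BtBt C d) (\<lambda>a b. tensor_lift (BtBt C d) (\<lambda>c e.
       tensor_lift (BtBt C d) (\<lambda>a1 a2. tensor_lift (BtBt C d) (\<lambda>b1 b2.
       tensor_lift (BtBt C d) (\<lambda>c1 c2. tensor_lift (BtBt C d) (\<lambda>e1 e2.
         (\<phi> a1 e2 * \<phi> c2 b1) \<odot>\<^bsub>BtBt C d\<^esub>
           bt_tensor C d (a2 \<otimes>\<^bsub>Bt C d\<^esub> c1) (b2 \<otimes>\<^bsub>Bt C d\<^esub> e1))
       (\<Delta> e)) (\<Delta> c)) (\<Delta> b)) (\<Delta> a)) Y) X)\<rparr>"

end

theory Submission
  imports Defs "HOL-Library.Product_Plus"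
begin

text \<open>
  The embedding is \<open>\<xi> a = \<Sum> \<chi> a\<^sub>(\<^sub>2\<^sub>) \<cdot> \<tau> a\<^sub>(\<^sub>3\<^sub>) \<otimes> a\<^sub>(\<^sub>1\<^sub>)\<close> for a linear functional \<open>\<chi>\<close> satisfying
  \<open>\<chi> (a b) = \<Sum> \<chi> a\<^sub>(\<^sub>1\<^sub>) \<phi> (\<tau> a\<^sub>(\<^sub>2\<^sub>)) b\<^sub>(\<^sub>1\<^sub>) \<chi> b\<^sub>(\<^sub>2\<^sub>)\<close>. This identity makes \<open>\<xi>\<close> multiplicative by a computation with
  Sweedler sums, which takes place on words of the free algebra. There \<open>\<chi>\<close> is defined by recursion, and the point is
  that it vanishes on the defining ideal. Since \<open>\<Delta>\<close> and \<open>\<phi>\<close> live on the quotient, the skew derivations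
  \<open>x \<mapsto> \<Sum> \<phi> a x\<^sub>(\<^sub>1\<^sub>) x\<^sub>(\<^sub>2\<^sub>)\<close> preserve the ideal, so an induction on the number of letters \<open>\<theta>\<close> reduces this to
  \<open>\<chi> r = 0\<close> for the relators \<open>r\<close>. For a quantum Serre relator it follows from weights: \<open>\<chi>\<close> only sees words whose letters
  \<open>\<theta>\<close> pair up along \<open>\<tau>\<close>, which leaves the commutator of \<open>\<theta>\<^sub>i\<close> and \<open>\<theta>\<^bsub>\<tau> i\<^esub>\<close> when \<open>C i (\<tau> i) = 0\<close>.
  For injectivity, \<open>(\<epsilon> \<otimes> id) \<circ> \<xi>\<close> sends a word \<open>w\<close> to a nonzero multiple of \<open>w\<close> plus words with fewer \<open>\<theta>\<close>.
\<close>

section \<open>Vector spaces and tensor products\<close>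

text \<open>Without \<chi>, the map a \<mapsto> \<Sum> \<tau> a2 \<otimes> a1 fails to be
  multiplicative: the product on the target evaluates two pairings, that on the source only one, and
  the surplus factor is \<phi>(\<tau> a, b) on inner coproduct factors. The identity required of
  \<chi> reproduces exactly this factor on the source side. The prescribed images of the generators
  dictate \<chi> \<theta>_i = 0 and \<chi> h_i = \<phi>(h_{\<tau> i}, h_i). Since \<chi> is not an
  algebra homomorphism, its vanishing on relators r does not by itself give vanishing on products u
  r v; the degree in the letters \<theta> is what controls these.\<close>

locale vect = abelian_group U for U :: "('k::field, 'a) module" (structure) +
  assumes smult_closed [simp, intro]: "x \<in> carrier U \<Longrightarrow> c \<odot> x \<in> carrier U"
    and smult_l_distr: "x \<in> carrier U \<Longrightarrow> (c + c') \<odot> x = c \<odot> x \<oplus> c' \<odot> x"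
    and smult_r_distr: "x \<in> carrier U \<Longrightarrow> y \<in> carrier U \<Longrightarrow> c \<odot> (x \<oplus> y) = c \<odot> x \<oplus> c \<odot> y"
    and smult_assoc: "x \<in> carrier U \<Longrightarrow> (c * c') \<odot> x = c \<odot> (c' \<odot> x)"
    and smult_one: "x \<in> carrier U \<Longrightarrow> 1 \<odot> x = x"
begin

lemma smult_zero_left: "x \<in> carrier U \<Longrightarrow> 0 \<odot> x = \<zero>"
  using smult_l_distr[of x 0 0] add.r_cancel_one'[of "0 \<odot> x" "0 \<odot> x"] by simp

lemma smult_zero_right: "c \<odot> \<zero> = \<zero>"
  using smult_assoc[of \<zero> c 0] smult_zero_left[of \<zero>] by simp

end

text \<open>\<open>tensor_lift\<close> evaluates a representative picked by \<open>SOME\<close>.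
  This is the same evaluation on an arbitrary formal sum, so that linearity can be stated
  independently of the choice.\<close>

definition rec_lin :: "('k::field, 'c) module \<Rightarrow> ('a \<Rightarrow> 'c) \<Rightarrow> ('a \<Rightarrow>\<^sub>0 'k) \<Rightarrow> 'c" where
  "rec_lin U g s = (\<Oplus>\<^bsub>U\<^esub>p \<in> Poly_Mapping.keys s. Poly_Mapping.lookup s p \<odot>\<^bsub>U\<^esub> g p)"

lemma lookup_pm_scale [simp]:
  "Poly_Mapping.lookup (pm_scale c s) k = c * Poly_Mapping.lookup s k"
  by (simp add: Poly_Mapping.map.rep_eq when_def)

lemma keys_pm_scale: "Poly_Mapping.keys (pm_scale c s) \<subseteq> Poly_Mapping.keys s"
  by (auto simp: in_keys_iff)

lemma pm_scale_simps [simp]: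
  "pm_scale 0 s = 0" "pm_scale 1 s = s" "pm_scale c (pm_scale c' s) = pm_scale (c * c') s"
  "pm_scale c 0 = 0"
  "pm_scale c (Poly_Mapping.single k b) = Poly_Mapping.single k (c * b)"
  by (auto intro!: poly_mapping_eqI simp: lookup_single when_def)

lemma pm_scale_add: "pm_scale c (s + t) = pm_scale c s + pm_scale c t"
  and pm_scale_add_left: "pm_scale (c + c') s = pm_scale c s + pm_scale c' s"
  and pm_scale_minus_one: "pm_scale (- 1) s = - s"
  by (auto intro!: poly_mapping_eqI simp: lookup_add algebra_simps)

context vect
begin

lemma rec_lin_closed: "g \<in> Poly_Mapping.keys s \<rightarrow> carrier U \<Longrightarrow> rec_lin U g s \<in> carrier U"
  unfolding rec_lin_def by (rule finsum_closed) auto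

lemma rec_lin_superset:
  assumes "finite A" "Poly_Mapping.keys s \<subseteq> A" "g \<in> A \<rightarrow> carrier U"
  shows "rec_lin U g s = (\<Oplus>p \<in> A. Poly_Mapping.lookup s p \<odot> g p)"
  unfolding rec_lin_def
  by (rule add.finprod_mono_neutral_cong_left)
    (use assms in \<open>auto simp: in_keys_iff smult_zero_left Pi_iff\<close>)

lemma rec_lin_add:
  assumes "g \<in> Poly_Mapping.keys s \<union> Poly_Mapping.keys t \<rightarrow> carrier U"
  shows "rec_lin U g (s + t) = rec_lin U g s \<oplus> rec_lin U g t"
proof -
  let ?A = "Poly_Mapping.keys s \<union> Poly_Mapping.keys t"
  have g: "g p \<in> carrier U" if "p \<in> ?A" for p using assms that by blast
  have "rec_lin U g (s + t) = (\<Oplus>p \<in> ?A. Poly_Mapping.lookup (s + t) p \<odot> g p)"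
    by (rule rec_lin_superset) (use assms keys_add[of s t] in auto)
  also have "\<dots> = (\<Oplus>p \<in> ?A. Poly_Mapping.lookup s p \<odot> g p \<oplus> Poly_Mapping.lookup t p \<odot> g p)"
    by (rule finsum_cong') (use g in \<open>auto simp: lookup_add smult_l_distr\<close>)
  also have "\<dots> = (\<Oplus>p \<in> ?A. Poly_Mapping.lookup s p \<odot> g p) \<oplus> (\<Oplus>p \<in> ?A. Poly_Mapping.lookup t p \<odot> g p)"
    by (rule finsum_addf) (use g in auto)
  also have "(\<Oplus>p \<in> ?A. Poly_Mapping.lookup s p \<odot> g p) = rec_lin U g s"
    by (rule rec_lin_superset [symmetric]) (use assms in auto)
  also have "(\<Oplus>p \<in> ?A. Poly_Mapping.lookup t p \<odot> g p) = rec_lin U g t"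
    by (rule rec_lin_superset [symmetric]) (use assms in auto)
  finally show ?thesis .
qed

lemma rec_lin_0 [simp]: "rec_lin U g 0 = \<zero>"
  by (simp add: rec_lin_def)

lemma rec_lin_single:
  assumes "g p \<in> carrier U" shows "rec_lin U g (Poly_Mapping.single p c) = c \<odot> g p"
proof -
  have "rec_lin U g (Poly_Mapping.single p c) = (\<Oplus>q \<in> {p}. Poly_Mapping.lookup (Poly_Mapping.single p c) q \<odot> g q)"
    by (rule rec_lin_superset) (use assms in auto)
  also have "\<dots> = c \<odot> g p"
    using assms by simp
  finally show ?thesis .
qed

lemma finsum_smult:
  "finite A \<Longrightarrow> h \<in> A \<rightarrow> carrier U \<Longrightarrow> c \<odot> (\<Oplus>p \<in> A. h p) = (\<Oplus>p \<in> A. c \<odot> h p)"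
  by (induction A rule: finite_induct) (auto simp: smult_zero_right smult_r_distr Pi_iff)

lemma rec_lin_scale:
  assumes "g \<in> Poly_Mapping.keys s \<rightarrow> carrier U"
  shows "rec_lin U g (pm_scale c s) = c \<odot> rec_lin U g s"
proof -
  have "rec_lin U g (pm_scale c s) = (\<Oplus>p \<in> Poly_Mapping.keys s. Poly_Mapping.lookup (pm_scale c s) p \<odot> g p)"
    by (rule rec_lin_superset) (use assms keys_pm_scale[of c s] in auto)
  also have "\<dots> = (\<Oplus>p \<in> Poly_Mapping.keys s. c \<odot> (Poly_Mapping.lookup s p \<odot> g p))"
    by (rule finsum_cong') (use assms in \<open>auto simp: Pi_iff smult_assoc\<close>)
  also have "\<dots> = c \<odot> rec_lin U g s"
    unfolding rec_lin_def by (rule finsum_smult [symmetric]) (use assms in auto)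
  finally show ?thesis .
qed

lemma rec_lin_minus:
  assumes "g \<in> Poly_Mapping.keys s \<union> Poly_Mapping.keys t \<rightarrow> carrier U"
  shows "rec_lin U g (s - t) = rec_lin U g s \<oplus> - 1 \<odot> rec_lin U g t"
proof -
  have st: "s - t = s + pm_scale (- 1) t" by (simp add: pm_scale_minus_one)
  show ?thesis
    unfolding st using assms keys_pm_scale[of "- 1" t]
    by (subst rec_lin_add) (auto simp: rec_lin_scale Pi_iff)
qed

lemma smult_neg: "x \<in> carrier U \<Longrightarrow> x \<oplus> - 1 \<odot> x = \<zero>"
  using smult_l_distr[of x 1 "- 1"] by (simp add: smult_one smult_zero_left)

end

definition bilin :: "('k::field, 'a) module \<Rightarrow> ('k, 'b) module \<Rightarrow> ('k, 'c) module \<Rightarrow> ('a \<Rightarrow> 'b \<Rightarrow> 'c) \<Rightarrow> bool" where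
  "bilin V W U f \<longleftrightarrow>
     (\<forall>x\<in>carrier V. \<forall>y\<in>carrier W. f x y \<in> carrier U) \<and>
     (\<forall>x\<in>carrier V. \<forall>x'\<in>carrier V. \<forall>y\<in>carrier W. f (x \<oplus>\<^bsub>V\<^esub> x') y = f x y \<oplus>\<^bsub>U\<^esub> f x' y) \<and>
     (\<forall>x\<in>carrier V. \<forall>y\<in>carrier W. \<forall>y'\<in>carrier W. f x (y \<oplus>\<^bsub>W\<^esub> y') = f x y \<oplus>\<^bsub>U\<^esub> f x y') \<and>
     (\<forall>c. \<forall>x\<in>carrier V. \<forall>y\<in>carrier W. f (c \<odot>\<^bsub>V\<^esub> x) y = c \<odot>\<^bsub>U\<^esub> f x y \<and> f x (c \<odot>\<^bsub>W\<^esub> y) = c \<odot>\<^bsub>U\<^esub> f x y)"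

locale vect2 = V: vect V + W: vect W for V :: "('k::field, 'a) module" and W :: "('k, 'b) module"
begin

lemma keys_tensor_null: "s \<in> tensor_null V W \<Longrightarrow> Poly_Mapping.keys s \<subseteq> carrier V \<times> carrier W"
proof (induction rule: tensor_null.induct)
  case (2 s t) then show ?case using keys_add[of s t] by blast
next
  case (3 s c) then show ?case using keys_pm_scale[of c s] by blast
qed (auto simp: in_keys_iff lookup_minus lookup_single when_def split: if_splits)

lemma tensor_null_uminus: "s \<in> tensor_null V W \<Longrightarrow> - s \<in> tensor_null V W"
  using tensor_null.intros(3)[of s V W "- 1"] by (simp add: pm_scale_minus_one)

lemma tensor_null_diff:
  "s \<in> tensor_null V W \<Longrightarrow> t \<in> tensor_null V W \<Longrightarrow> s - t \<in> tensor_null V W"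
  using tensor_null.intros(2)[OF _ tensor_null_uminus, of s t] by simp

text \<open>Every generator of \<open>tensor_null\<close> is one clause of bilinearity, and
  evaluation turns it into the difference of the two sides. This is the universal property behind
  \<open>tensor_lift\<close>: its value does not depend on the representative.\<close>

lemma rec_lin_tensor_null:
  assumes U: "vect U" and f: "bilin V W U f" and s: "s \<in> tensor_null V W"
  shows "rec_lin U (\<lambda>p. f (fst p) (snd p)) s = \<zero>\<^bsub>U\<^esub>"
proof -
  interpret U: vect U by fact
  note B = f[unfolded bilin_def]
  let ?g = "\<lambda>p. f (fst p) (snd p)"
  have g: "?g \<in> carrier V \<times> carrier W \<rightarrow> carrier U" using B by auto
  have keys: "?g \<in> Poly_Mapping.keys s \<rightarrow> carrier U" if "s \<in> tensor_null V W" for s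
    using g keys_tensor_null[OF that] by auto
  have one: "1 \<odot>\<^bsub>U\<^esub> f x y = f x y" "f x y \<in> carrier U" if "x \<in> carrier V" "y \<in> carrier W" for x y
    using B that by (auto intro!: U.smult_one)
  have canc: "(a \<oplus>\<^bsub>U\<^esub> b) \<oplus>\<^bsub>U\<^esub> - 1 \<odot>\<^bsub>U\<^esub> a \<oplus>\<^bsub>U\<^esub> - 1 \<odot>\<^bsub>U\<^esub> b = \<zero>\<^bsub>U\<^esub>"
    if "a \<in> carrier U" "b \<in> carrier U" for a b
  proof -
    have "(a \<oplus>\<^bsub>U\<^esub> b) \<oplus>\<^bsub>U\<^esub> - 1 \<odot>\<^bsub>U\<^esub> a \<oplus>\<^bsub>U\<^esub> - 1 \<odot>\<^bsub>U\<^esub> b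
      = (a \<oplus>\<^bsub>U\<^esub> - 1 \<odot>\<^bsub>U\<^esub> a) \<oplus>\<^bsub>U\<^esub> (b \<oplus>\<^bsub>U\<^esub> - 1 \<odot>\<^bsub>U\<^esub> b)"
      using that by (simp add: U.a_ac)
    then show ?thesis using that by (simp add: U.smult_neg)
  qed
  from s show ?thesis
  proof (induction rule: tensor_null.induct)
    case 1 then show ?case by simp
  next
    case (2 s t)
    have "?g \<in> Poly_Mapping.keys s \<union> Poly_Mapping.keys t \<rightarrow> carrier U"
      using keys[OF 2(1)] keys[OF 2(2)] by blast
    with 2 show ?case by (simp add: U.rec_lin_add)
  next
    case (3 s c) then show ?case by (simp add: U.rec_lin_scale keys U.smult_zero_right)
  next
    case (4 x x' y)
    then have "rec_lin U ?g (Poly_Mapping.single (x \<oplus>\<^bsub>V\<^esub> x', y) 1 - Poly_Mapping.single (x, y) 1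
       - Poly_Mapping.single (x', y) 1) = f (x \<oplus>\<^bsub>V\<^esub> x') y \<oplus>\<^bsub>U\<^esub> - 1 \<odot>\<^bsub>U\<^esub> f x y \<oplus>\<^bsub>U\<^esub> - 1 \<odot>\<^bsub>U\<^esub> f x' y"
      apply (subst U.rec_lin_minus)
       apply (use one in \<open>auto simp: in_keys_iff lookup_minus lookup_single when_def split: if_splits\<close>)[1]
      apply (subst U.rec_lin_minus)
       apply (use one in \<open>auto simp: in_keys_iff lookup_minus lookup_single when_def split: if_splits\<close>)[1]
      using 4 one by (simp add: U.rec_lin_single)
    also have "\<dots> = \<zero>\<^bsub>U\<^esub>" using 4 B canc[of "f x y" "f x' y"] by simp
    finally show ?case .
  next
    case (5 x y y')
    then have "rec_lin U ?g (Poly_Mapping.single (x, y \<oplus>\<^bsub>W\<^esub> y') 1 - Poly_Mapping.single (x, y) 1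
       - Poly_Mapping.single (x, y') 1) = f x (y \<oplus>\<^bsub>W\<^esub> y') \<oplus>\<^bsub>U\<^esub> - 1 \<odot>\<^bsub>U\<^esub> f x y \<oplus>\<^bsub>U\<^esub> - 1 \<odot>\<^bsub>U\<^esub> f x y'"
      apply (subst U.rec_lin_minus)
       apply (use one in \<open>auto simp: in_keys_iff lookup_minus lookup_single when_def split: if_splits\<close>)[1]
      apply (subst U.rec_lin_minus)
       apply (use one in \<open>auto simp: in_keys_iff lookup_minus lookup_single when_def split: if_splits\<close>)[1]
      using 5 one by (simp add: U.rec_lin_single)
    also have "\<dots> = \<zero>\<^bsub>U\<^esub>" using 5 B canc[of "f x y" "f x y'"] by simp
    finally show ?case .
  next
    case (6 x y c)
    then show ?case using one[of x y] one[of "c \<odot>\<^bsub>V\<^esub> x" y] B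
      apply (subst U.rec_lin_minus)
       apply (use one in \<open>auto simp: in_keys_iff lookup_minus lookup_single when_def split: if_splits\<close>)[1]
      by (simp add: U.rec_lin_single U.smult_neg)
  next
    case (7 x y c)
    then show ?case using one[of x y] one[of x "c \<odot>\<^bsub>W\<^esub> y"] B
      apply (subst U.rec_lin_minus)
       apply (use one in \<open>auto simp: in_keys_iff lookup_minus lookup_single when_def split: if_splits\<close>)[1]
      by (simp add: U.rec_lin_single U.smult_neg)
  qed
qed

abbreviation tkeys :: "(('a \<times> 'b) \<Rightarrow>\<^sub>0 'k) \<Rightarrow> bool" where
  "tkeys s \<equiv> Poly_Mapping.keys s \<subseteq> carrier V \<times> carrier W"

lemma tensor_class_eq_iff:
  assumes "tkeys s" "tkeys t"
  shows "tensor_class V W s = tensor_class V W t \<longleftrightarrow> s - t \<in> tensor_null V W"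
proof
  assume "tensor_class V W s = tensor_class V W t"
  moreover have "s \<in> tensor_class V W s" using assms by (simp add: tensor_class_def tensor_null.intros)
  ultimately show "s - t \<in> tensor_null V W" by (auto simp: tensor_class_def)
next
  assume st: "s - t \<in> tensor_null V W"
  have "u - s \<in> tensor_null V W \<longleftrightarrow> u - t \<in> tensor_null V W" for u
    using tensor_null.intros(2)[OF st, of "u - s"] tensor_null_diff[OF _ st, of "u - t"] by auto
  then show "tensor_class V W s = tensor_class V W t" by (simp add: tensor_class_def)
qed

lemma tensor_rep_class:
  assumes "tkeys s"
  shows "tkeys (tensor_rep (tensor_class V W s))" "tensor_rep (tensor_class V W s) - s \<in> tensor_null V W"
proof -
  have "s \<in> tensor_class V W s" using assms by (simp add: tensor_class_def tensor_null.intros)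
  then have "tensor_rep (tensor_class V W s) \<in> tensor_class V W s"
    unfolding tensor_rep_def by (rule someI)
  then show "tkeys (tensor_rep (tensor_class V W s))" "tensor_rep (tensor_class V W s) - s \<in> tensor_null V W"
    by (auto simp: tensor_class_def)
qed

lemma tensor_class_add:
  assumes "tkeys s" "tkeys t"
  shows "tensor_class V W s \<oplus>\<^bsub>tensor_space V W\<^esub> tensor_class V W t = tensor_class V W (s + t)"
proof -
  note r = tensor_rep_class[OF assms(1)] tensor_rep_class[OF assms(2)]
  let ?a = "tensor_rep (tensor_class V W s)" and ?b = "tensor_rep (tensor_class V W t)"
  have "(?a + ?b) - (s + t) = (?a - s) + (?b - t)" by simp
  then have "(?a + ?b) - (s + t) \<in> tensor_null V W" using r by (metis tensor_null.intros(2))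
  moreover have "tkeys (?a + ?b)" "tkeys (s + t)"
    using r(1,3) assms keys_add[of ?a ?b] keys_add[of s t] by auto
  ultimately show ?thesis by (simp add: tensor_space_def tensor_class_eq_iff)
qed

lemma tensor_class_scale:
  assumes "tkeys s"
  shows "c \<odot>\<^bsub>tensor_space V W\<^esub> tensor_class V W s = tensor_class V W (pm_scale c s)"
proof -
  note r = tensor_rep_class[OF assms(1)]
  let ?a = "tensor_rep (tensor_class V W s)"
  have "pm_scale c ?a - pm_scale c s = pm_scale c (?a - s)"
    by (rule poly_mapping_eqI) (simp add: lookup_minus algebra_simps)
  then have "pm_scale c ?a - pm_scale c s \<in> tensor_null V W"
    using tensor_null.intros(3)[OF r(2)] by simp
  moreover have "tkeys (pm_scale c ?a)" "tkeys (pm_scale c s)"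
    using r(1) assms keys_pm_scale[of c ?a] keys_pm_scale[of c s] by auto
  ultimately show ?thesis by (simp add: tensor_space_def tensor_class_eq_iff)
qed

lemma carrier_tensor_space: "carrier (tensor_space V W) = tensor_class V W ` {s. tkeys s}"
  by (simp add: tensor_space_def)

lemma tkeys_add: "tkeys s \<Longrightarrow> tkeys t \<Longrightarrow> tkeys (s + t)"
  using keys_add[of s t] by blast

lemma tkeys_scale: "tkeys s \<Longrightarrow> tkeys (pm_scale c s)"
  using keys_pm_scale[of c s] by blast

lemma vect_tensor_space: "vect (tensor_space V W)"
proof -
  let ?X = "tensor_space V W"
  have zero: "\<zero>\<^bsub>?X\<^esub> = tensor_class V W 0" by (simp add: tensor_space_def)
  have neg: "\<exists>y\<in>carrier ?X. y \<oplus>\<^bsub>?X\<^esub> x = \<zero>\<^bsub>?X\<^esub>" if "x \<in> carrier ?X" for x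
  proof -
    from that obtain s where s: "x = tensor_class V W s" "tkeys s" by (auto simp: carrier_tensor_space)
    have "tensor_class V W (pm_scale (- 1) s) \<oplus>\<^bsub>?X\<^esub> x = \<zero>\<^bsub>?X\<^esub>"
      using s by (simp add: tensor_class_add tkeys_scale zero pm_scale_minus_one)
    then show ?thesis using s tkeys_scale[of s "- 1"] by (force simp: carrier_tensor_space)
  qed
  have "abelian_group ?X"
    by (rule abelian_groupI)
      (use neg in \<open>auto simp: carrier_tensor_space zero tensor_class_add tkeys_add add_ac\<close>)
  moreover have "vect_axioms ?X"
    by unfold_locales
      (auto simp: carrier_tensor_space tensor_class_add tensor_class_scale tkeys_add tkeys_scale
        pm_scale_add pm_scale_add_left)
  ultimately show ?thesis by (simp add: vect_def)
qed

lemma tensor_lift_class: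
  assumes U: "vect U" and f: "bilin V W U f" and s: "tkeys s"
  shows "tensor_lift U f (tensor_class V W s) = rec_lin U (\<lambda>p. f (fst p) (snd p)) s"
proof -
  interpret U: vect U by fact
  let ?g = "\<lambda>p. f (fst p) (snd p)" and ?a = "tensor_rep (tensor_class V W s)"
  note r = tensor_rep_class[OF s]
  have g: "?g \<in> Poly_Mapping.keys t \<rightarrow> carrier U" if "tkeys t" for t
    using f that unfolding bilin_def by fastforce
  have a: "?a = (?a - s) + s" by simp
  have "tensor_lift U f (tensor_class V W s) = rec_lin U ?g ((?a - s) + s)"
    by (simp add: tensor_lift_def rec_lin_def)
  also have "\<dots> = rec_lin U ?g (?a - s) \<oplus>\<^bsub>U\<^esub> rec_lin U ?g s"
    using g[OF s] g[OF keys_tensor_null[OF r(2)]] by (intro U.rec_lin_add) blast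
  also have "\<dots> = rec_lin U ?g s"
    using rec_lin_tensor_null[OF U f r(2)] U.rec_lin_closed[OF g[OF s]] by simp
  finally show ?thesis .
qed

end

section \<open>Linear maps out of free vector spaces\<close>

text \<open>Targets here are types in class \<open>ab_group_add\<close> with the scalar action
  passed as the argument \<open>s\<close>, unlike the record modules of the theorem. Computations in
  the free algebra can then use ordinary arithmetic; records return only under the projections
  \<open>pi\<close> and \<open>Pi\<close>.\<close>

definition lin_ext :: "('k::field \<Rightarrow> 'c \<Rightarrow> 'c::ab_group_add) \<Rightarrow> ('a \<Rightarrow> 'c) \<Rightarrow> ('a \<Rightarrow>\<^sub>0 'k) \<Rightarrow> 'c" where
  "lin_ext s g x = (\<Sum>k\<in>Poly_Mapping.keys x. s (Poly_Mapping.lookup x k) (g k))"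

definition linear_pm :: "('k::field \<Rightarrow> 'c \<Rightarrow> 'c::ab_group_add) \<Rightarrow> (('a \<Rightarrow>\<^sub>0 'k) \<Rightarrow> 'c) \<Rightarrow> bool" where
  "linear_pm s f \<longleftrightarrow> (\<forall>x y. f (x + y) = f x + f y) \<and> (\<forall>c x. f (pm_scale c x) = s c (f x))"

lemma module_mult: "Modules.module ((*) :: 'k::field \<Rightarrow> 'k \<Rightarrow> 'k)"
  by unfold_locales (auto simp: algebra_simps)

lemma module_pm_scale: "Modules.module (pm_scale :: 'k::field \<Rightarrow> ('a \<Rightarrow>\<^sub>0 'k) \<Rightarrow> ('a \<Rightarrow>\<^sub>0 'k))"
  by unfold_locales (auto simp: pm_scale_add pm_scale_add_left)

lemma poly_mapping_linear_induct [case_names zero single add]: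
  assumes "P 0" "\<And>k c. P (Poly_Mapping.single k c)" "\<And>x y. P x \<Longrightarrow> P y \<Longrightarrow> P (x + y)"
  shows "P x"
proof (induction x rule: Poly_Mapping.update_induct)
  case const then show ?case by (rule assms)
next
  case (update f a b)
  have "Poly_Mapping.update a b f = f + Poly_Mapping.single a b"
    by (rule poly_mapping_eqI)
      (use update(1) in \<open>auto simp: lookup_update lookup_add lookup_single when_def in_keys_iff\<close>)
  then show ?case using assms update by metis
qed

lemma linear_pm_add: "linear_pm s f \<Longrightarrow> f (x + y) = f x + f y"
  and linear_pm_scale: "linear_pm s f \<Longrightarrow> f (pm_scale c x) = s c (f x)"
  by (auto simp: linear_pm_def)

lemma linear_pm_single: "linear_pm s f \<Longrightarrow> f (Poly_Mapping.single k c) = s c (f (Poly_Mapping.single k 1))"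
  using linear_pm_scale[of s f c "Poly_Mapping.single k 1"] by simp

lemma linear_pm_0: "linear_pm s f \<Longrightarrow> f 0 = 0"
  using linear_pm_add[of s f 0 0] by simp

lemma linear_pm_diff: "linear_pm s f \<Longrightarrow> f (x - y) = f x - f y"
  using linear_pm_add[of s f "x - y" y] by simp

lemma linear_pm_sum: "linear_pm s f \<Longrightarrow> f (sum h A) = (\<Sum>a\<in>A. f (h a))"
  by (induction A rule: infinite_finite_induct) (auto simp: linear_pm_0 linear_pm_add)

lemma linear_pm_eqI:
  assumes "linear_pm s f" "linear_pm s h"
    and "\<And>k. f (Poly_Mapping.single k 1) = h (Poly_Mapping.single k 1)"
  shows "f x = h x"
proof (induction x rule: poly_mapping_linear_induct)
  case (single k c)
  show ?case
    using linear_pm_single[OF assms(1), of k c] linear_pm_single[OF assms(2), of k c] assms(3) by simp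
qed (use assms(1,2) in \<open>simp_all add: linear_pm_add linear_pm_0\<close>)

lemma lin_ext_superset:
  assumes "Modules.module s" "finite A" "Poly_Mapping.keys x \<subseteq> A"
  shows "lin_ext s g x = (\<Sum>k\<in>A. s (Poly_Mapping.lookup x k) (g k))"
  unfolding lin_ext_def
  by (rule sum.mono_neutral_left) (use assms in \<open>auto simp: in_keys_iff module.scale_zero_left\<close>)

lemma linear_lin_ext:
  fixes s :: "'k::field \<Rightarrow> 'c \<Rightarrow> 'c::ab_group_add" and g :: "'a \<Rightarrow> 'c"
  assumes "Modules.module s" shows "linear_pm s (lin_ext s g)"
  unfolding linear_pm_def
proof (intro conjI allI)
  interpret Modules.module s by fact
  fix x y :: "'a \<Rightarrow>\<^sub>0 'k"
  show "lin_ext s g (x + y) = lin_ext s g x + lin_ext s g y"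
    using keys_add[of x y] lin_ext_superset[OF assms, of "Poly_Mapping.keys x \<union> Poly_Mapping.keys y"]
    by (simp add: lookup_add scale_left_distrib sum.distrib)
next
  interpret Modules.module s by fact
  fix c and x :: "'a \<Rightarrow>\<^sub>0 'k"
  show "lin_ext s g (pm_scale c x) = s c (lin_ext s g x)"
    using keys_pm_scale[of c x] lin_ext_superset[OF assms, of "Poly_Mapping.keys x" _ g]
    by (simp add: scale_sum_right)
qed

lemma lin_ext_single:
  assumes "Modules.module s"
  shows "lin_ext s g (Poly_Mapping.single k c) = s c (g k)"
proof -
  interpret Modules.module s by fact
  show ?thesis by (simp add: lin_ext_def)
qed

lemma lin_ext_one: "Modules.module s \<Longrightarrow> lin_ext s g (Poly_Mapping.single k 1) = g k"
  by (simp add: lin_ext_single module.scale_one)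

text \<open>A tensor product of free spaces is free on pairs of basis elements, so finitely
  supported functions on pairs serve as the tensor square. \<open>bil_ext s g\<close> is the linear
  map induced by a bilinear \<open>g\<close>, and \<open>ext_prod a b\<close> below plays the role
  of a \<otimes> b.\<close>

definition bil_ext ::
  "('k::field \<Rightarrow> 'c \<Rightarrow> 'c::ab_group_add) \<Rightarrow> (('a \<Rightarrow>\<^sub>0 'k) \<Rightarrow> ('b \<Rightarrow>\<^sub>0 'k) \<Rightarrow> 'c) \<Rightarrow> (('a \<times> 'b) \<Rightarrow>\<^sub>0 'k) \<Rightarrow> 'c" where
  "bil_ext s g = lin_ext s (\<lambda>k. g (Poly_Mapping.single (fst k) 1) (Poly_Mapping.single (snd k) 1))"

definition ext_prod :: "('a \<Rightarrow>\<^sub>0 'k::field) \<Rightarrow> ('b \<Rightarrow>\<^sub>0 'k) \<Rightarrow> (('a \<times> 'b) \<Rightarrow>\<^sub>0 'k)" where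
  "ext_prod a b = lin_ext pm_scale (\<lambda>k. lin_ext pm_scale (\<lambda>l. Poly_Mapping.single (k, l) 1) b) a"

named_theorems lin_intro

lemma linear_ident [lin_intro]: "linear_pm pm_scale (\<lambda>x. x)"
  by (simp add: linear_pm_def)

lemma linear_comp: "linear_pm s f \<Longrightarrow> linear_pm pm_scale h \<Longrightarrow> linear_pm s (\<lambda>x. f (h x))"
  by (simp add: linear_pm_def)

lemma linear_lin_ext_comp [lin_intro]:
  "Modules.module s \<Longrightarrow> linear_pm pm_scale h \<Longrightarrow> linear_pm s (\<lambda>x. lin_ext s g (h x))"
  by (rule linear_comp[OF linear_lin_ext])

lemma linear_lin_ext_fun [lin_intro]:
  assumes "Modules.module s" "\<And>k. linear_pm s (\<lambda>x. g x k)"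
  shows "linear_pm s (\<lambda>x. lin_ext s (g x) X)"
proof -
  interpret Modules.module s by fact
  show ?thesis using assms(2)
    by (simp add: linear_pm_def lin_ext_def scale_right_distrib sum.distrib scale_sum_right scale_scale mult.commute)
qed

lemma linear_bil_ext_comp [lin_intro]:
  "Modules.module s \<Longrightarrow> linear_pm pm_scale h \<Longrightarrow> linear_pm s (\<lambda>x. bil_ext s g (h x))"
  unfolding bil_ext_def by (rule linear_lin_ext_comp)

lemma linear_bil_ext_fun [lin_intro]:
  assumes "Modules.module s" "\<And>u v. linear_pm s (\<lambda>x. g x u v)"
  shows "linear_pm s (\<lambda>x. bil_ext s (g x) X)"
  unfolding bil_ext_def by (rule linear_lin_ext_fun) (use assms in auto)

lemma linear_ext_prod_left [lin_intro]: "linear_pm pm_scale h \<Longrightarrow> linear_pm pm_scale (\<lambda>x. ext_prod (h x) b)"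
  and linear_ext_prod_right [lin_intro]: "linear_pm pm_scale h \<Longrightarrow> linear_pm pm_scale (\<lambda>x. ext_prod b (h x))"
  unfolding ext_prod_def by (intro lin_intro module_pm_scale; assumption)+

lemma linear_scale [lin_intro]: "linear_pm pm_scale f \<Longrightarrow> linear_pm pm_scale (\<lambda>x. pm_scale c (f x))"
  by (simp add: linear_pm_def pm_scale_add mult.commute)

lemma linear_scale_left [lin_intro]: "linear_pm (*) f \<Longrightarrow> linear_pm pm_scale (\<lambda>x. pm_scale (f x) y)"
  by (simp add: linear_pm_def pm_scale_add_left)

lemma linear_mult_const [lin_intro]: "linear_pm (*) f \<Longrightarrow> linear_pm (*) (\<lambda>x. f x * c)"
  and linear_const_mult [lin_intro]: "linear_pm (*) f \<Longrightarrow> linear_pm (*) (\<lambda>x. c * f x)"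
  by (simp_all add: linear_pm_def algebra_simps)

lemma pm_scale_conv_mult: "pm_scale c x = Poly_Mapping.single 0 c * x"
  by (rule mult_map_scale_conv_mult)

lemma pm_scale_mult_left: "pm_scale c x * y = pm_scale c (x * y)"
  by (simp add: pm_scale_conv_mult mult.assoc)

lemma single_0_commute: "(x :: 'a::monoid_add \<Rightarrow>\<^sub>0 'k::field) * Poly_Mapping.single 0 c = Poly_Mapping.single 0 c * x"
  by (induction x rule: poly_mapping_linear_induct) (auto simp: mult_single algebra_simps)

lemma pm_scale_mult_right: "(x :: 'a::monoid_add \<Rightarrow>\<^sub>0 'k::field) * pm_scale c y = pm_scale c (x * y)"
  by (metis mult.assoc pm_scale_conv_mult single_0_commute)

lemma linear_mult_left [lin_intro]:
    "linear_pm pm_scale f \<Longrightarrow> linear_pm pm_scale (\<lambda>x. (f x :: 'a::monoid_add \<Rightarrow>\<^sub>0 'k::field) * y)"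
  and linear_mult_right [lin_intro]:
    "linear_pm pm_scale f \<Longrightarrow> linear_pm pm_scale (\<lambda>x. (y :: 'a::monoid_add \<Rightarrow>\<^sub>0 'k::field) * f x)"
  by (simp_all add: linear_pm_def algebra_simps pm_scale_mult_left pm_scale_mult_right)

lemma ext_prod_single [simp]:
  "ext_prod (Poly_Mapping.single k a) (Poly_Mapping.single l b) = Poly_Mapping.single (k, l) (a * b)"
  by (simp add: ext_prod_def lin_ext_single module_pm_scale)

lemma bil_ext_single:
  "Modules.module s \<Longrightarrow> bil_ext s g (Poly_Mapping.single (k, l) c) =
     s c (g (Poly_Mapping.single k 1) (Poly_Mapping.single l 1))"
  by (simp add: bil_ext_def lin_ext_single)

lemma ext_prod_mult:
  "ext_prod (a :: 'a::monoid_add \<Rightarrow>\<^sub>0 'k::field) (b :: 'b::monoid_add \<Rightarrow>\<^sub>0 'k) * ext_prod a' b'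
    = ext_prod (a * a') (b * b')"
proof (rule linear_pm_eqI[where s = pm_scale and x = a])
  fix k
  show "ext_prod (Poly_Mapping.single k 1) b * ext_prod a' b' = ext_prod (Poly_Mapping.single k 1 * a') (b * b')"
  proof (rule linear_pm_eqI[where s = pm_scale and x = b])
    fix l
    show "ext_prod (Poly_Mapping.single k 1) (Poly_Mapping.single l 1) * ext_prod a' b'
        = ext_prod (Poly_Mapping.single k 1 * a') (Poly_Mapping.single l 1 * b')"
    proof (rule linear_pm_eqI[where s = pm_scale and x = a'])
      fix k'
      show "ext_prod (Poly_Mapping.single k 1) (Poly_Mapping.single l 1) * ext_prod (Poly_Mapping.single k' 1) b'
        = ext_prod (Poly_Mapping.single k 1 * Poly_Mapping.single k' 1) (Poly_Mapping.single l 1 * b')"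
        by (rule linear_pm_eqI[where s = pm_scale and x = b'])
          (auto intro!: lin_intro simp: mult_single)
    qed (intro lin_intro)+
  qed (intro lin_intro)+
qed (intro lin_intro)+

section \<open>The tensor square of a quotient of a free algebra\<close>

definition rec_linear :: "('k::field \<Rightarrow> 'c \<Rightarrow> 'c::ab_group_add) \<Rightarrow> ('k, 'u) module \<Rightarrow> ('c \<Rightarrow> 'u) \<Rightarrow> bool" where
  "rec_linear s U \<rho> \<longleftrightarrow> (\<forall>x. \<rho> x \<in> carrier U) \<and> (\<forall>x y. \<rho> (x + y) = \<rho> x \<oplus>\<^bsub>U\<^esub> \<rho> y) \<and>
     (\<forall>c x. \<rho> (s c x) = c \<odot>\<^bsub>U\<^esub> \<rho> x)"

lemma rec_linear_closed: "rec_linear s U \<rho> \<Longrightarrow> \<rho> x \<in> carrier U"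
  and rec_linear_add: "rec_linear s U \<rho> \<Longrightarrow> \<rho> (x + y) = \<rho> x \<oplus>\<^bsub>U\<^esub> \<rho> y"
  and rec_linear_scale: "rec_linear s U \<rho> \<Longrightarrow> \<rho> (s c x) = c \<odot>\<^bsub>U\<^esub> \<rho> x"
  by (auto simp: rec_linear_def)

lemma rec_linear_0:
  assumes "vect U" "rec_linear s U \<rho>" shows "\<rho> 0 = \<zero>\<^bsub>U\<^esub>"
proof -
  interpret vect U by fact
  show ?thesis using rec_linear_add[OF assms(2), of 0 0] rec_linear_closed[OF assms(2), of 0]
    by (metis add.r_cancel_one' add.right_neutral)
qed

text \<open>\<open>V\<close> is presented as a quotient of a free space. Elements of
  \<open>V\<close> and of its tensor square have lifts, so maps between such spaces are computed on
  lifts.\<close>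

locale presented = V: vect V for V :: "('k::field, 'u) module" +
  fixes \<pi> :: "('a \<Rightarrow>\<^sub>0 'k) \<Rightarrow> 'u"
  assumes lin: "rec_linear pm_scale V \<pi>" and onto: "carrier V = range \<pi>"
begin

sublocale vect2 V V ..

definition push :: "(('a \<times> 'a) \<Rightarrow>\<^sub>0 'k) \<Rightarrow> (('u \<times> 'u) \<Rightarrow>\<^sub>0 'k)" where
  "push = lin_ext pm_scale (\<lambda>k. Poly_Mapping.single
     (\<pi> (Poly_Mapping.single (fst k) 1), \<pi> (Poly_Mapping.single (snd k) 1)) 1)"

definition Pi2 :: "(('a \<times> 'a) \<Rightarrow>\<^sub>0 'k) \<Rightarrow> ('k, 'u, 'u) tensor" where
  "Pi2 X = tensor_class V V (push X)"

lemma pi_closed [simp]: "\<pi> x \<in> carrier V"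
  using onto by auto

lemma linear_push: "linear_pm pm_scale push"
  unfolding push_def by (rule linear_lin_ext) (rule module_pm_scale)

lemma push_single: "push (Poly_Mapping.single (k, l) c) = 
   Poly_Mapping.single (\<pi> (Poly_Mapping.single k 1), \<pi> (Poly_Mapping.single l 1)) c"
  by (simp add: push_def lin_ext_single module_pm_scale)

lemma tkeys_push: "tkeys (push X)"
proof (induction X rule: poly_mapping_linear_induct)
  case (single k c) then show ?case by (cases k) (auto simp: push_single)
qed (auto simp: linear_pm_0[OF linear_push] linear_pm_add[OF linear_push] tkeys_add)

lemma rec_linear_Pi2: "rec_linear pm_scale (tensor_space V V) Pi2"
  unfolding rec_linear_def Pi2_def
  using tkeys_push
  by (auto simp: carrier_tensor_space tensor_class_add tensor_class_scale
      linear_pm_add[OF linear_push] linear_pm_scale[OF linear_push])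

lemma bilin_pure_tensor: "bilin V V (tensor_space V V) (pure_tensor V V)"
proof -
  have tk: "tkeys (Poly_Mapping.single (x, y) c)" if "x \<in> carrier V" "y \<in> carrier V" for x y c
    using that by auto
  show ?thesis
    unfolding bilin_def pure_tensor_def
  proof (intro conjI ballI allI)
    fix x y assume xy: "x \<in> carrier V" "y \<in> carrier V"
    show "tensor_class V V (Poly_Mapping.single (x, y) 1) \<in> carrier (tensor_space V V)"
      unfolding carrier_tensor_space using tk[OF xy] by blast
    fix c
    show "tensor_class V V (Poly_Mapping.single (c \<odot>\<^bsub>V\<^esub> x, y) 1) =
      c \<odot>\<^bsub>tensor_space V V\<^esub> tensor_class V V (Poly_Mapping.single (x, y) 1)"
      using xy by (subst tensor_class_scale) (auto simp: tk tensor_class_eq_iff tensor_null.intros simp del: keys_single)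
    show "tensor_class V V (Poly_Mapping.single (x, c \<odot>\<^bsub>V\<^esub> y) 1) =
      c \<odot>\<^bsub>tensor_space V V\<^esub> tensor_class V V (Poly_Mapping.single (x, y) 1)"
      using xy by (subst tensor_class_scale) (auto simp: tk tensor_class_eq_iff tensor_null.intros simp del: keys_single)
  next
    fix x x' y assume "x \<in> carrier V" "x' \<in> carrier V" "y \<in> carrier V"
    then show "tensor_class V V (Poly_Mapping.single (x \<oplus>\<^bsub>V\<^esub> x', y) 1) =
      tensor_class V V (Poly_Mapping.single (x, y) 1) \<oplus>\<^bsub>tensor_space V V\<^esub>
      tensor_class V V (Poly_Mapping.single (x', y) 1)"
      using tensor_null.intros(4)[of x V x' y V]
      by (simp add: tk tensor_class_add tkeys_add tensor_class_eq_iff diff_diff_eq del: keys_single)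
  next
    fix x y y' assume "x \<in> carrier V" "y \<in> carrier V" "y' \<in> carrier V"
    then show "tensor_class V V (Poly_Mapping.single (x, y \<oplus>\<^bsub>V\<^esub> y') 1) =
      tensor_class V V (Poly_Mapping.single (x, y) 1) \<oplus>\<^bsub>tensor_space V V\<^esub>
      tensor_class V V (Poly_Mapping.single (x, y') 1)"
      using tensor_null.intros(5)[of x V y V y']
      by (simp add: tk tensor_class_add tkeys_add tensor_class_eq_iff diff_diff_eq del: keys_single)
  qed
qed

lemma Pi2_ext_prod: "Pi2 (ext_prod a b) = pure_tensor V V (\<pi> a) (\<pi> b)"
proof -
  interpret X: vect "tensor_space V V" by (rule vect_tensor_space)
  note B = bilin_pure_tensor[unfolded bilin_def]
  note Z = rec_linear_0[OF vect_tensor_space rec_linear_Pi2]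
  note L = rec_linear_add[OF rec_linear_Pi2] rec_linear_scale[OF rec_linear_Pi2]
  have smult0: "pure_tensor V V \<zero>\<^bsub>V\<^esub> y = \<zero>\<^bsub>tensor_space V V\<^esub>" "pure_tensor V V y \<zero>\<^bsub>V\<^esub> = \<zero>\<^bsub>tensor_space V V\<^esub>" 
    if "y \<in> carrier V" for y
    using that B V.smult_zero_left[of y] X.smult_zero_left by (metis)+
  note pi0 = rec_linear_0[OF V.vect_axioms lin]
  have sc: "Poly_Mapping.single k c = pm_scale c (Poly_Mapping.single k 1)" for k and c :: 'k by simp
  show ?thesis
  proof (induction a rule: poly_mapping_linear_induct)
    case zero
    have "ext_prod (0 :: 'a \<Rightarrow>\<^sub>0 'k) b = 0" by (rule linear_pm_0[where s = pm_scale]) (intro lin_intro)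
    then show ?case by (simp add: Z pi0 smult0)
  next
    case (add x y)
    have "ext_prod (x + y) b = ext_prod x b + ext_prod y b" by (rule linear_pm_add[where s = pm_scale]) (intro lin_intro)
    then show ?case using add B by (simp add: L rec_linear_add[OF lin])
  next
    case (single k c)
    show ?case
    proof (induction b rule: poly_mapping_linear_induct)
      case zero
      have "ext_prod (Poly_Mapping.single k c) (0 :: 'a \<Rightarrow>\<^sub>0 'k) = 0" by (rule linear_pm_0[where s = pm_scale]) (intro lin_intro)
      then show ?case by (simp add: Z pi0 smult0)
    next
      case (add x y)
      have "ext_prod (Poly_Mapping.single k c) (x + y) = ext_prod (Poly_Mapping.single k c) x + ext_prod (Poly_Mapping.single k c) y"
        by (rule linear_pm_add[where s = pm_scale]) (intro lin_intro)
      then show ?case using add B by (simp add: L rec_linear_add[OF lin])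
    next
      case (single l e)
      have "Pi2 (ext_prod (Poly_Mapping.single k c) (Poly_Mapping.single l e))
         = Pi2 (pm_scale (c * e) (Poly_Mapping.single (k, l) 1))" by simp
      also have "\<dots> = (c * e) \<odot>\<^bsub>tensor_space V V\<^esub> pure_tensor V V (\<pi> (Poly_Mapping.single k 1)) (\<pi> (Poly_Mapping.single l 1))"
        by (simp only: L) (simp add: Pi2_def push_single pure_tensor_def)
      also have "\<dots> = pure_tensor V V (\<pi> (Poly_Mapping.single k c)) (\<pi> (Poly_Mapping.single l e))"
        unfolding sc[of k c] sc[of l e] rec_linear_scale[OF lin]
        using B by (simp add: X.smult_assoc[symmetric] mult.commute)
      finally show ?case .
    qed
  qed
qed

lemma carrier_tensor_space_eq: "carrier (tensor_space V V) = range Pi2"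
proof -
  have "tkeys s \<longrightarrow> tensor_class V V s \<in> range Pi2" for s
  proof (induction s rule: Poly_Mapping.update_induct)
    case const
    have "tensor_class V V 0 = Pi2 0" by (simp add: Pi2_def linear_pm_0[OF linear_push])
    then show ?case by blast
  next
    case (update f k c)
    have eq: "Poly_Mapping.update k c f = f + pm_scale c (Poly_Mapping.single k 1)"
      by (rule poly_mapping_eqI)
        (use update(1) in \<open>auto simp: lookup_update lookup_add lookup_single when_def in_keys_iff\<close>)
    show ?case
    proof
      assume *: "tkeys (Poly_Mapping.update k c f)"
      then have f: "tkeys f" and k: "k \<in> carrier V \<times> carrier V"
        using update by (auto simp: keys_update)
      from k obtain a b where ab: "k = (\<pi> a, \<pi> b)" using onto by auto
      obtain X where X: "tensor_class V V f = Pi2 X" using update(3) f by blast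
      have sk: "tkeys (Poly_Mapping.single k 1)" using k by auto
      have "tensor_class V V (Poly_Mapping.update k c f) = Pi2 X \<oplus>\<^bsub>tensor_space V V\<^esub>
        c \<odot>\<^bsub>tensor_space V V\<^esub> tensor_class V V (Poly_Mapping.single k 1)"
        unfolding eq X[symmetric] by (simp only: tensor_class_add f tkeys_scale sk tensor_class_scale)
      also have "\<dots> = Pi2 (X + pm_scale c (ext_prod a b))"
        by (simp only: rec_linear_add[OF rec_linear_Pi2] rec_linear_scale[OF rec_linear_Pi2] Pi2_ext_prod)
          (simp add: pure_tensor_def ab)
      finally show "tensor_class V V (Poly_Mapping.update k c f) \<in> range Pi2" by blast
    qed
  qed
  then show ?thesis using rec_linear_closed[OF rec_linear_Pi2] by (auto simp: carrier_tensor_space)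
qed

text \<open>The transfer principle for Sweedler sums: if the bilinear \<open>g\<close> on the free
  space covers \<open>f\<close>, then the same holds for the induced linear maps. Bilinearity of
  \<open>f\<close> follows from that of \<open>g\<close>, as \<pi> is onto. Nested sums are handled
  by using the rule for the outer sum and again for its summand.\<close>

lemma tensor_lift_Pi2:
  assumes U: "vect U" and s: "Modules.module s" and \<rho>: "rec_linear s U \<rho>"
    and g: "\<And>y. linear_pm s (\<lambda>x. g x y)" "\<And>x. linear_pm s (\<lambda>y. g x y)"
    and f: "\<And>x y. f (\<pi> x) (\<pi> y) = \<rho> (g x y)"
  shows "tensor_lift U f (Pi2 X) = \<rho> (bil_ext s g X)"
proof -
  interpret U: vect U by fact
  note rl = rec_linear_add[OF \<rho>] rec_linear_scale[OF \<rho>] rec_linear_closed[OF \<rho>]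
  have cV: "x \<in> carrier V \<Longrightarrow> \<exists>x'. x = \<pi> x'" for x using onto by auto
  have fb: "bilin V V U f"
    unfolding bilin_def
    by (auto dest!: cV simp: f rl rec_linear_add[OF lin, symmetric] rec_linear_scale[OF lin, symmetric]
        linear_pm_add[OF g(1)] linear_pm_add[OF g(2)] linear_pm_scale[OF g(1)] linear_pm_scale[OF g(2)])
  have cl: "(\<lambda>p. f (fst p) (snd p)) \<in> Poly_Mapping.keys (push X) \<rightarrow> carrier U" for X
  proof
    fix p assume "p \<in> Poly_Mapping.keys (push X)"
    then have "p \<in> carrier V \<times> carrier V" using tkeys_push[of X] by blast
    then show "f (fst p) (snd p) \<in> carrier U" by (auto dest!: cV simp: f rl)
  qed
  have "rec_lin U (\<lambda>p. f (fst p) (snd p)) (push X) = \<rho> (bil_ext s g X)"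
  proof (induction X rule: poly_mapping_linear_induct)
    case zero
    have "bil_ext s g 0 = 0" by (rule linear_pm_0[where s = s]) (intro lin_intro s)
    then show ?case by (simp add: linear_pm_0[OF linear_push] rec_linear_0[OF U \<rho>])
  next
    case (single k c)
    show ?case
      by (cases k) (simp add: push_single U.rec_lin_single f rl bil_ext_single s)
  next
    case (add x y)
    have "bil_ext s g (x + y) = bil_ext s g x + bil_ext s g y" by (rule linear_pm_add[where s = s]) (intro lin_intro s)
    moreover have "rec_lin U (\<lambda>p. f (fst p) (snd p)) (push x + push y) = 
      rec_lin U (\<lambda>p. f (fst p) (snd p)) (push x) \<oplus>\<^bsub>U\<^esub> rec_lin U (\<lambda>p. f (fst p) (snd p)) (push y)"
      using cl[of x] cl[of y] by (intro U.rec_lin_add) blast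
    ultimately show ?case using add by (simp add: linear_pm_add[OF linear_push] rl)
  qed
  then show ?thesis
    unfolding Pi2_def by (subst tensor_lift_class[OF U fb tkeys_push])
qed

end

lemma vect_update [simp]: "vect (U\<lparr>mult := m\<rparr>) = vect U" "vect (U\<lparr>one := e\<rparr>) = vect U"
  by (simp_all add: vect_def vect_axioms_def abelian_group_def abelian_monoid_def abelian_group_axioms_def)

lemma rec_linear_update [simp]:
  "rec_linear s (U\<lparr>mult := m\<rparr>) = rec_linear s U" "rec_linear s (U\<lparr>one := e\<rparr>) = rec_linear s U"
  by (simp_all add: rec_linear_def fun_eq_iff)

locale presented_alg = presented V \<pi>
  for V :: "('k::field, 'u) module" and \<pi> :: "('a::monoid_add \<Rightarrow>\<^sub>0 'k) \<Rightarrow> 'u" +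
  assumes pi_mult: "\<pi> (x * y) = \<pi> x \<otimes>\<^bsub>V\<^esub> \<pi> y" and pi_one: "\<pi> 1 = \<one>\<^bsub>V\<^esub>"
begin

lemma vect_tensor_alg: "vect (tensor_alg V V)"
  using vect_tensor_space by (simp add: tensor_alg_def)

lemma rec_linear_Pi2_alg: "rec_linear pm_scale (tensor_alg V V) Pi2"
  using rec_linear_Pi2 by (simp add: tensor_alg_def)

lemma carrier_tensor_alg: "carrier (tensor_alg V V) = range Pi2"
  using carrier_tensor_space_eq by (simp add: tensor_alg_def)

lemma mult_eq_bil_ext:
  "X * Y = bil_ext pm_scale (\<lambda>a b. bil_ext pm_scale (\<lambda>a' b'. ext_prod (a * a') (b * b')) Y) X"
  for X Y :: "('a \<times> 'a) \<Rightarrow>\<^sub>0 'k"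
proof (rule linear_pm_eqI[where s = pm_scale and x = X])
  fix k :: "'a \<times> 'a"
  show "Poly_Mapping.single k 1 * Y = bil_ext pm_scale (\<lambda>a b. bil_ext pm_scale
    (\<lambda>a' b'. ext_prod (a * a') (b * b')) Y) (Poly_Mapping.single k 1)"
  proof (rule linear_pm_eqI[where s = pm_scale and x = Y])
    fix l :: "'a \<times> 'a"
    obtain k1 k2 l1 l2 where kl: "k = (k1, k2)" "l = (l1, l2)" by (cases k, cases l)
    show "Poly_Mapping.single k 1 * Poly_Mapping.single l 1 = bil_ext pm_scale (\<lambda>a b. bil_ext pm_scale
      (\<lambda>a' b'. ext_prod (a * a') (b * b')) (Poly_Mapping.single l 1)) (Poly_Mapping.single k (1::'k))"
      by (simp add: kl bil_ext_single[OF module_pm_scale] mult_single)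
  qed (intro lin_intro module_pm_scale)+
qed (intro lin_intro module_pm_scale)+

lemma Pi2_mult: "Pi2 (X * Y) = Pi2 X \<otimes>\<^bsub>tensor_alg V V\<^esub> Pi2 Y"
proof -
  have "Pi2 X \<otimes>\<^bsub>tensor_alg V V\<^esub> Pi2 Y = tensor_lift (tensor_space V V) (\<lambda>a b.
                tensor_lift (tensor_space V V) (\<lambda>a' b'.
                  pure_tensor V V (a \<otimes>\<^bsub>V\<^esub> a') (b \<otimes>\<^bsub>V\<^esub> b')) (Pi2 Y)) (Pi2 X)"
    by (simp add: tensor_alg_def)
  also have "\<dots> = Pi2 (bil_ext pm_scale (\<lambda>a b. bil_ext pm_scale (\<lambda>a' b'. ext_prod (a * a') (b * b')) Y) X)"
  proof (rule tensor_lift_Pi2[OF vect_tensor_space module_pm_scale rec_linear_Pi2])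
    show "tensor_lift (tensor_space V V) (\<lambda>a' b'. pure_tensor V V (\<pi> x \<otimes>\<^bsub>V\<^esub> a') (\<pi> y \<otimes>\<^bsub>V\<^esub> b')) (Pi2 Y)
      = Pi2 (bil_ext pm_scale (\<lambda>a' b'. ext_prod (x * a') (y * b')) Y)" for x y
      by (rule tensor_lift_Pi2[OF vect_tensor_space module_pm_scale rec_linear_Pi2])
        (auto intro!: lin_intro simp: Pi2_ext_prod pi_mult)
  qed (intro lin_intro module_pm_scale)+
  finally show ?thesis by (simp add: mult_eq_bil_ext)
qed

lemma Pi2_one: "Pi2 1 = \<one>\<^bsub>tensor_alg V V\<^esub>"
proof -
  have "(1 :: ('a \<times> 'a) \<Rightarrow>\<^sub>0 'k) = ext_prod 1 1"
    by (simp flip: single_one add: zero_prod_def)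
  then have "Pi2 1 = Pi2 (ext_prod 1 1)" by (rule arg_cong)
  also have "\<dots> = \<one>\<^bsub>tensor_alg V V\<^esub>"
    by (simp only: Pi2_ext_prod pi_one) (simp add: tensor_alg_def)
  finally show ?thesis .
qed

end

section \<open>The algebra \<open>Bt\<close> and its structure maps\<close>

lemma ring_free_ring: "ring (free_ring :: 'a free_algebra ring)"
proof -
  have "\<exists>y. y + x = 0" for x :: "'a free_algebra" by (rule exI[of _ "- x"]) simp
  then have "abelian_group (free_ring :: 'a free_algebra ring)"
    by (intro abelian_groupI) (auto simp: free_ring_def algebra_simps)
  then show ?thesis
    by (rule ringI) (auto simp: free_ring_def algebra_simps intro!: monoidI)
qed

lemma free_ring_simps [simp]:
  "carrier free_ring = UNIV" "x \<otimes>\<^bsub>free_ring\<^esub> y = x * y" "x \<oplus>\<^bsub>free_ring\<^esub> y = x + y"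
  "\<one>\<^bsub>free_ring\<^esub> = 1" "\<zero>\<^bsub>free_ring\<^esub> = 0"
  by (simp_all add: free_ring_def)

lemma a_minus_free_ring [simp]: "x \<ominus>\<^bsub>free_ring\<^esub> y = x - (y :: 'a free_algebra)"
proof -
  interpret ring "free_ring :: 'a free_algebra ring" by (rule ring_free_ring)
  have "\<ominus>\<^bsub>free_ring\<^esub> y = - y" by (rule minus_equality) auto
  then show ?thesis by (simp add: a_minus_def)
qed

lemma pm_scale_scalar: "pm_scale c x = scalar c * x"
  by (simp add: scalar_def pm_scale_conv_mult)

lemma ideal_bt_ideal: "ideal (bt_ideal C d) free_ring"
  unfolding bt_ideal_def by (rule ring.genideal_ideal[OF ring_free_ring]) simp

lemma bt_relators_in_ideal: "r \<in> bt_relators C d \<Longrightarrow> r \<in> bt_ideal C d"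
  unfolding bt_ideal_def using ring.genideal_self[OF ring_free_ring, of "bt_relators C d"] by auto

lemma bt_class_eq_iff: "bt_class C d x = bt_class C d y \<longleftrightarrow> x - y \<in> bt_ideal C d"
  unfolding bt_class_def
  using ring.quotient_eq_iff_same_a_r_cos[OF ring_free_ring ideal_bt_ideal, of x y C d] by simp

lemma presented_alg_Bt: "presented_alg (Bt C d) (bt_class C d)"
proof -
  interpret I: ideal "bt_ideal C d" free_ring by (rule ideal_bt_ideal)
  let ?Q = "free_ring Quot bt_ideal C d" and ?p = "bt_class C d"
  interpret Q: ring ?Q by (rule I.quotient_is_ring)
  have hom: "?p \<in> ring_hom free_ring ?Q"
    using I.rcos_ring_hom by (simp add: bt_class_def[abs_def])
  have carr: "carrier ?Q = range ?p"
    by (auto simp: FactRing_def A_RCOSETS_def' bt_class_def)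
  have add: "?p (x + y) = ?p x \<oplus>\<^bsub>?Q\<^esub> ?p y" and mult: "?p (x * y) = ?p x \<otimes>\<^bsub>?Q\<^esub> ?p y"
    and one: "?p 1 = \<one>\<^bsub>?Q\<^esub>" for x y
    using ring_hom_add[OF hom, of x y] ring_hom_mult[OF hom, of x y] ring_hom_one[OF hom] by auto
  have sm: "c \<odot>\<^bsub>Bt C d\<^esub> ?p x = ?p (pm_scale c x)" for c x
    by (simp add: Bt_def Let_def mult pm_scale_scalar)
  have ab: "abelian_group (Bt C d)"
    by (rule abelian_groupI)
      (use Q.l_neg in \<open>auto simp: Bt_def Let_def Q.a_ac intro!: bexI[of _ "\<ominus>\<^bsub>?Q\<^esub> x" for x]\<close>)
  have cB: "carrier (Bt C d) = range ?p" "\<And>x y. x \<oplus>\<^bsub>Bt C d\<^esub> y = x \<oplus>\<^bsub>?Q\<^esub> y"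
    "\<And>x y. x \<otimes>\<^bsub>Bt C d\<^esub> y = x \<otimes>\<^bsub>?Q\<^esub> y" "\<one>\<^bsub>Bt C d\<^esub> = \<one>\<^bsub>?Q\<^esub>"
    by (simp_all add: Bt_def Let_def carr)
  have "vect_axioms (Bt C d)"
    by unfold_locales (auto simp: cB(1) sm cB(2) pm_scale_add pm_scale_add_left simp flip: add)
  then have "vect (Bt C d)" using ab by (simp add: vect_def)
  then show ?thesis
    unfolding presented_alg_def presented_def presented_axioms_def presented_alg_axioms_def
    by (simp add: cB rec_linear_def sm add mult one)
qed

lemma vect_field_alg: "vect (field_alg :: ('k::field, 'k) module)"
proof -
  have "\<exists>y. y + x = 0" for x :: 'k by (rule exI[of _ "- x"]) simp
  then have "abelian_group (field_alg :: ('k, 'k) module)"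
    by (intro abelian_groupI) (auto simp: field_alg_def algebra_simps)
  moreover have "vect_axioms (field_alg :: ('k, 'k) module)"
    by unfold_locales (auto simp: field_alg_def algebra_simps)
  ultimately show ?thesis by (simp add: vect_def)
qed

lemma rec_linear_field_alg: "rec_linear (*) field_alg (\<lambda>x. x)"
  by (simp add: rec_linear_def field_alg_def)

section \<open>Coproducts of words\<close>

definition wd :: "'a list \<Rightarrow> 'a free_algebra" where "wd w = Poly_Mapping.single (Word w) 1"

lemma wd_append: "wd (u @ v) = wd u * wd v"
  and wd_Nil: "wd [] = 1"
  and letter_wd: "letter a = wd [a]"
  by (simp_all add: wd_def mult_single plus_word_def letter_def flip: single_one)
    (simp add: zero_word_def)

lemma wd_Cons: "wd (a # w) = wd [a] * wd w"
  by (simp flip: wd_append)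

lemma single_wd: "Poly_Mapping.single k 1 = wd (letters k)"
  by (simp add: wd_def)

lemma linear_wd_eqI:
  fixes f :: "'a free_algebra \<Rightarrow> 'c::ab_group_add"
  assumes "linear_pm s f" "linear_pm s h" "\<And>w. f (wd w) = h (wd w)"
  shows "f x = h x"
  by (rule linear_pm_eqI[OF assms(1,2)]) (simp add: single_wd assms(3))

text \<open>\<open>sw w g\<close> is the Sweedler sum of \<open>g w\<^sub>(\<^sub>1\<^sub>) w\<^sub>(\<^sub>2\<^sub>)\<close>. On words all coefficients of the coproduct
  are 1, so that no linearity of \<open>g\<close> is needed.\<close>

primrec sw :: "'i gen list \<Rightarrow> ('i gen list \<Rightarrow> 'i gen list \<Rightarrow> 'b::comm_monoid_add) \<Rightarrow> 'b" where
  "sw [] g = g [] []"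
| "sw (x # w) g = (case x of
      Theta i \<Rightarrow> sw w (\<lambda>u v. g (x # u) v) + sw w (\<lambda>u v. g (H i # u) (x # v))
    | _ \<Rightarrow> sw w (\<lambda>u v. g (x # u) (x # v)))"

lemma sw_additive:
  assumes "\<And>x y. f (x + y) = f x + f y"
  shows "f (sw w g) = sw w (\<lambda>u v. f (g u v))"
  by (induction w arbitrary: g) (auto simp: assms split: gen.split)

lemma sw_add: "sw w (\<lambda>u v. g u v + h u v) = sw w g + sw w h"
  by (induction w arbitrary: g h) (auto simp: add_ac split: gen.split)

lemma sw_0 [simp]: "sw w (\<lambda>u v. 0) = 0"
  by (induction w) (auto split: gen.split)

lemma sw_swap: "sw w (\<lambda>u v. sw w' (g u v)) = sw w' (\<lambda>u' v'. sw w (\<lambda>u v. g u v u' v'))"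
  by (induction w arbitrary: g) (auto simp: sw_add split: gen.split)

lemma sw_append: "sw (w @ w') g = sw w (\<lambda>u v. sw w' (\<lambda>u' v'. g (u @ u') (v @ v')))"
  by (induction w arbitrary: g) (auto split: gen.split)

text \<open>Coassociativity holds already in the free algebra: for \<theta>_i both sides consist of
  the three terms \<theta>_i \<otimes> 1 \<otimes> 1, h_i \<otimes> \<theta>_i \<otimes> 1 and h_i
  \<otimes> h_i \<otimes> \<theta>_i.\<close>

lemma sw_coassoc: "sw w (\<lambda>u v. sw u (\<lambda>x y. g x y v)) = sw w (\<lambda>u v. sw v (\<lambda>x y. g u x y))"
  by (induction w arbitrary: g) (auto simp: sw_add add_ac split: gen.split)

lemma sw_map: "sw (map (map_gen t) w) g = sw w (\<lambda>u v. g (map (map_gen t) u) (map (map_gen t) v))"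
  by (induction w arbitrary: g) (auto split: gen.split)

primrec splits :: "'i gen list \<Rightarrow> ('i gen list \<times> 'i gen list) set" where
  "splits [] = {([], [])}"
| "splits (x # w) = (case x of
      Theta i \<Rightarrow> (\<lambda>(u, v). (x # u, v)) ` splits w \<union> (\<lambda>(u, v). (H i # u, x # v)) ` splits w
    | _ \<Rightarrow> (\<lambda>(u, v). (x # u, x # v)) ` splits w)"

lemma sw_cong_splits: "(\<And>u v. (u, v) \<in> splits w \<Longrightarrow> g u v = h u v) \<Longrightarrow> sw w g = sw w h"
proof (induction w arbitrary: g h)
  case (Cons x w)
  show ?case
    by (cases x) (auto intro!: arg_cong2[where f = "(+)"] Cons.IH Cons.prems simp: image_iff, (force intro!: Cons.prems)+)
qed simp

lemma sw_eq_0: "(\<And>u v. (u, v) \<in> splits w \<Longrightarrow> g u v = 0) \<Longrightarrow> sw w g = 0"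
  using sw_cong_splits[of w g "\<lambda>_ _. 0"] by simp

lemma length_splits: "(u, v) \<in> splits w \<Longrightarrow> length u = length w \<and> length v \<le> length w"
  by (induction w arbitrary: u v) (force split: gen.splits)+

text \<open>The recursion of \<open>chi\<close> calls itself on the right factor of a coproduct. The
  bound on the length of that factor, supplied by this congruence rule, is what makes the
  termination goal provable.\<close>

lemma sw_cong [fundef_cong]:
  "w = w' \<Longrightarrow> (\<And>u v. length v \<le> length w' \<Longrightarrow> g u v = h u v) \<Longrightarrow> sw w g = sw w' h"
  using length_splits by (blast intro: sw_cong_splits)

definition cop :: "'i gen free_algebra \<Rightarrow> (('i gen word \<times> 'i gen word) \<Rightarrow>\<^sub>0 base)" where
  "cop x = lin_ext pm_scale (\<lambda>k. sw (letters k) (\<lambda>u v. Poly_Mapping.single (Word u, Word v) 1)) x"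

lemma linear_cop [lin_intro]: "linear_pm pm_scale h \<Longrightarrow> linear_pm pm_scale (\<lambda>x. cop (h x))"
  unfolding cop_def by (intro lin_intro module_pm_scale)

lemma cop_wd: "cop (wd w) = sw w (\<lambda>u v. ext_prod (wd u) (wd v))"
  by (simp add: cop_def wd_def lin_ext_one module_pm_scale)

lemma sw_linear: "linear_pm s f \<Longrightarrow> f (sw w g) = sw w (\<lambda>u v. f (g u v))"
  by (rule sw_additive) (rule linear_pm_add)

lemma bil_ext_cop_wd:
  assumes "Modules.module s"
  shows "bil_ext s g (cop (wd w)) = sw w (\<lambda>u v. g (wd u) (wd v))"
proof -
  have "bil_ext s g (ext_prod (wd u) (wd v)) = g (wd u) (wd v)" for u v
    using module.scale_one[OF assms] by (simp add: wd_def bil_ext_single assms)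
  moreover have "linear_pm s (bil_ext s g)" by (intro lin_intro assms)
  ultimately show ?thesis by (simp add: cop_wd sw_linear)
qed

lemma cop_Cons: "cop (wd (a # w)) = cop (wd [a]) * cop (wd w)"
proof -
  have m: "sw w (\<lambda>u v. x * g u v) = x * sw w g" for x and g :: "'a gen list \<Rightarrow> 'a gen list \<Rightarrow> (('a gen word \<times> 'a gen word) \<Rightarrow>\<^sub>0 base)"
    by (rule sw_additive[symmetric]) (simp add: algebra_simps)
  show ?thesis
    by (cases a) (auto simp: cop_wd algebra_simps ext_prod_mult sw_add simp flip: m wd_append)
qed

lemma sw_mult_left: "c * sw w g = sw w (\<lambda>u v. c * g u v)" for c :: "'a::comm_semiring_0"
  by (rule sw_additive[where f = "(*) c"]) (simp add: algebra_simps)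

lemma sw_mult_right: "sw w g * c = sw w (\<lambda>u v. g u v * c)" for c :: "'a::comm_semiring_0"
  by (rule sw_additive[where f = "\<lambda>x. x * c"]) (simp add: algebra_simps)

lemma sw_scale: "pm_scale c (sw w g) = sw w (\<lambda>u v. pm_scale c (g u v))"
  by (rule sw_additive[where f = "pm_scale c"]) (rule pm_scale_add)

section \<open>Iterated coproducts nested to the right\<close>

definition sw3 where "sw3 w g = sw w (\<lambda>a r. sw r (g a))"
definition sw4 where "sw4 w g = sw w (\<lambda>a r. sw3 r (g a))"
definition sw5 where "sw5 w g = sw w (\<lambda>a r. sw4 r (g a))"

lemmas sw_iter_defs = sw5_def sw4_def sw3_def

lemma sw_sw3: "sw w (\<lambda>u v. sw3 w' (g u v)) = sw3 w' (\<lambda>a b c. sw w (\<lambda>u v. g u v a b c))"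
  unfolding sw3_def by (subst sw_swap) (intro arg_cong[where f = "sw w'"] ext sw_swap)

lemma sw_sw4: "sw w (\<lambda>u v. sw4 w' (g u v)) = sw4 w' (\<lambda>a b c e. sw w (\<lambda>u v. g u v a b c e))"
  unfolding sw4_def by (subst sw_swap) (intro arg_cong[where f = "sw w'"] ext sw_sw3)

lemma sw3_sw: "sw3 w' (\<lambda>a b c. sw w (g a b c)) = sw w (\<lambda>u v. sw3 w' (\<lambda>a b c. g a b c u v))"
  by (rule sw_sw3[symmetric])

lemma sw3_sw3: "sw3 w (\<lambda>x y z. sw3 w' (g x y z)) = sw3 w' (\<lambda>a b c. sw3 w (\<lambda>x y z. g x y z a b c))"
  by (simp only: sw3_def[of w] sw_sw3)

lemma sw3_append: "sw3 (w @ w') g = sw3 w (\<lambda>a b c. sw3 w' (\<lambda>a' b' c'. g (a @ a') (b @ b') (c @ c')))"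
  unfolding sw3_def sw_append by (intro arg_cong[where f = "sw w"] ext sw_swap)

text \<open>The two sides of multiplicativity of \<xi> split words in different orders: the left one
  of two factors into four, the middle one of three, or the outer ones of three. Coassociativity
  brings all of them to the right-nested form.\<close>

lemma sw5_left: "sw w (\<lambda>r c. sw4 r (\<lambda>x y z t. g x y z t c)) = sw5 w g"
  by (simp only: sw_iter_defs sw_coassoc)

lemma sw3_mid: "sw3 w (\<lambda>a b c. sw b (\<lambda>x y. g a x y c)) = sw4 w g"
  by (simp only: sw_iter_defs sw_coassoc)

lemma sw3_outer: "sw3 w (\<lambda>a b c. sw c (\<lambda>x y. sw a (\<lambda>z t. g z t b x y))) = sw5 w g"
proof -
  have "sw3 w (\<lambda>a b c. sw c (\<lambda>x y. sw a (\<lambda>z t. g z t b x y)))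
    = sw3 w (\<lambda>a b c. sw a (\<lambda>z t. sw c (\<lambda>x y. g z t b x y)))"
    by (intro arg_cong[where f = "sw3 w"] ext sw_swap)
  also have "\<dots> = sw w (\<lambda>a r. sw a (\<lambda>z t. sw r (\<lambda>b c. sw c (\<lambda>x y. g z t b x y))))"
    unfolding sw3_def by (intro arg_cong[where f = "sw w"] ext sw_swap)
  also have "\<dots> = sw5 w g"
    by (simp only: sw_iter_defs sw_coassoc)
  finally show ?thesis .
qed

lemma sw_coassoc2:
  "sw u (\<lambda>u1 u2. sw w (\<lambda>w1 w2. sw u1 (\<lambda>a b. sw w1 (\<lambda>c e. g a b u2 c e w2)))) =
   sw u (\<lambda>u1 u2. sw w (\<lambda>w1 w2. sw u2 (\<lambda>a b. sw w2 (\<lambda>c e. g u1 a b w1 c e))))"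
proof -
  have "sw u (\<lambda>u1 u2. sw w (\<lambda>w1 w2. sw u1 (\<lambda>a b. sw w1 (\<lambda>c e. g a b u2 c e w2)))) =
     sw u (\<lambda>u1 u2. sw u1 (\<lambda>a b. sw w (\<lambda>w1 w2. sw w1 (\<lambda>c e. g a b u2 c e w2))))"
    by (intro arg_cong[where f = "sw u"] ext sw_swap)
  also have "\<dots> = sw u (\<lambda>u1 u2. sw u2 (\<lambda>a b. sw w (\<lambda>w1 w2. sw w2 (\<lambda>c e. g u1 a b w1 c e))))"
    by (simp only: sw_coassoc)
  also have "\<dots> = sw u (\<lambda>u1 u2. sw w (\<lambda>w1 w2. sw u2 (\<lambda>a b. sw w2 (\<lambda>c e. g u1 a b w1 c e))))"
    by (intro arg_cong[where f = "sw u"] ext sw_swap)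
  finally show ?thesis .
qed

text \<open>Keeping \<open>f\<close> general covers the total degree and, through indicator
  functions, the multiplicity of each \<theta>_k, so that one lemma yields all components of the
  grading by the root lattice.\<close>

fun wt :: "('i \<Rightarrow> nat) \<Rightarrow> 'i gen list \<Rightarrow> nat" where
  "wt f [] = 0"
| "wt f (Theta i # w) = f i + wt f w"
| "wt f (x # w) = wt f w"

abbreviation deg :: "'i gen list \<Rightarrow> nat" where "deg \<equiv> wt (\<lambda>_. Suc 0)"

lemma wt_append: "wt f (u @ v) = wt f u + wt f v"
  by (induction f u rule: wt.induct) auto

lemma wt_splits: "(u, v) \<in> splits w \<Longrightarrow> wt f u + wt f v = wt f w"
  by (induction w arbitrary: u v) (force split: gen.splits)+

lemma wt_map: "wt f (map (map_gen t) w) = wt (f \<circ> t) w"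
  by (induction w rule: wt.induct[of "\<lambda>_. _"]) auto

lemma deg_map [simp]: "deg (map (map_gen t) w) = deg w"
  by (simp add: wt_map comp_def)

lemma wt_eq_0: "deg w = 0 \<Longrightarrow> wt f w = 0"
  by (induction f w rule: wt.induct) auto

text \<open>The factor that the first letter contributes to \<open>chi\<close>. Of the coproduct of
  \<theta>_i only h_i \<otimes> \<theta>_i survives, since \<chi> \<theta>_i = 0, which leaves
  \<chi> h_i. The value 1 at the inverse k of h is forced by \<chi>(h k) = 1, because the pairing of
  \<tau> h with k is inverse to \<chi> h.\<close>

fun hcoef :: "('i \<Rightarrow> 'b::one) \<Rightarrow> 'i gen \<Rightarrow> 'b" where
  "hcoef c (Theta i) = c i" | "hcoef c (H i) = c i" | "hcoef c (Hinv i) = 1"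

text \<open>With \<open>c i = \<phi> h\<^bsub>\<tau> i\<^esub> h\<^sub>i\<close> this is forced by \<open>\<chi> 1 = 1\<close>, \<open>\<chi> \<theta>\<^sub>i = 0\<close>, \<open>\<chi> h\<^sub>i = c i\<close> and
  \<open>\<chi> (a b) = \<Sum> \<chi> a\<^sub>(\<^sub>1\<^sub>) \<phi> (\<tau> a\<^sub>(\<^sub>2\<^sub>)) b\<^sub>(\<^sub>1\<^sub>) \<chi> b\<^sub>(\<^sub>2\<^sub>)\<close>, with \<open>a\<close> a single letter.\<close>

function chi :: "('i \<Rightarrow> base) \<Rightarrow> ('i \<Rightarrow> 'i) \<Rightarrow> ('i gen list \<Rightarrow> 'i gen list \<Rightarrow> base) \<Rightarrow> 'i gen list \<Rightarrow> base" where
  "chi c t p [] = 1"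
| "chi c t p (x # w) = hcoef c x * sw w (\<lambda>u v. p [map_gen t x] u * chi c t p v)"
  by pat_completeness auto
termination by (relation "measure (\<lambda>(c, t, p, w). length w)") auto

declare chi.simps(2) [simp del]

locale hopf_data =
  fixes C :: "'i \<Rightarrow> 'i \<Rightarrow> int"
    and d :: "'i \<Rightarrow> nat"
    and \<tau> :: "'i \<Rightarrow> 'i"
    and \<Delta> :: "'i bt \<Rightarrow> (base, 'i bt, 'i bt) tensor"
    and \<epsilon> :: "'i bt \<Rightarrow> base"
    and \<phi> :: "'i bt \<Rightarrow> 'i bt \<Rightarrow> base"
    and T :: "'i bt \<Rightarrow> 'i bt"
  assumes GCM: "symmetrizable_GCM C d"
    and satake: "quasi_split_satake C d \<tau>"
    and comult: "is_comult C d \<Delta>"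
    and counit: "is_counit C d \<epsilon>"
    and pairing: "is_hopf_pairing C d \<Delta> \<epsilon> \<phi>"
    and action: "is_diagram_action C d \<tau> T"
begin

abbreviation pi :: "'i gen free_algebra \<Rightarrow> 'i bt" where "pi \<equiv> bt_class C d"
abbreviation BB :: "(base, (base, 'i bt, 'i bt) tensor) module" where "BB \<equiv> BtBt C d"

sublocale B: presented_alg "Bt C d" pi by (rule presented_alg_Bt)

lemmas pi_add = rec_linear_add[OF B.lin] and pi_scale = rec_linear_scale[OF B.lin]
lemmas Pi_add = rec_linear_add[OF B.rec_linear_Pi2_alg] and Pi_scale = rec_linear_scale[OF B.rec_linear_Pi2_alg]

abbreviation Pi :: "(('i gen word \<times> 'i gen word) \<Rightarrow>\<^sub>0 base) \<Rightarrow> (base, 'i bt, 'i bt) tensor" where "Pi \<equiv> B.Pi2"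

lemma pi_eq_iff: "pi x = pi y \<longleftrightarrow> x - y \<in> bt_ideal C d"
  by (rule bt_class_eq_iff)

lemma pi_H_Hinv: "pi (wd [H i] * wd [Hinv i]) = pi 1" "pi (wd [Hinv i] * wd [H i]) = pi 1"
  unfolding pi_eq_iff
  by (rule bt_relators_in_ideal; force simp: bt_relators_def letter_wd)+

lemma theta_wd: "theta C d i = pi (wd [Theta i])" and hh_wd: "hh C d i = pi (wd [H i])"
  by (simp_all add: theta_def hh_def letter_wd)

text \<open>The structure maps are known through their values on generators, their lifts on all
  words. Comparing letters suffices, because \<open>step\<close> asks \<open>h\<close> to be
  multiplicative only after projecting by \<rho>, one letter at a time.\<close>

lemma ring_hom_wd_eqI:
  assumes f: "f \<in> alg_hom (Bt C d) U" and U: "vect U" 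
    and \<rho>: "rec_linear s U \<rho>" and h: "linear_pm s h"
    and one: "\<rho> (h 1) = \<one>\<^bsub>U\<^esub>"
    and step: "\<And>a w. \<rho> (h (wd (a # w))) = \<rho> (h (wd [a])) \<otimes>\<^bsub>U\<^esub> \<rho> (h (wd w))"
    and gen: "\<And>a. f (pi (wd [a])) = \<rho> (h (wd [a]))"
  shows "f (pi x) = \<rho> (h x)"
proof -
  interpret U: vect U by fact
  have hom: "f \<in> ring_hom (Bt C d) U" and sc: "\<And>c x. f (c \<odot>\<^bsub>Bt C d\<^esub> pi x) = c \<odot>\<^bsub>U\<^esub> f (pi x)"
    using f by (auto simp: alg_hom_def)
  have word: "f (pi (wd w)) = \<rho> (h (wd w))" for w
  proof (induction w)
    case Nil
    show ?case using ring_hom_one[OF hom] by (simp add: wd_Nil one B.pi_one)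
  next
    case (Cons a w)
    have "f (pi (wd (a # w))) = f (pi (wd [a])) \<otimes>\<^bsub>U\<^esub> f (pi (wd w))"
      by (subst wd_Cons) (simp add: B.pi_mult ring_hom_mult[OF hom])
    then show ?case by (simp only: gen Cons.IH step[of a w])
  qed
  show ?thesis
  proof (induction x rule: poly_mapping_linear_induct)
    case zero
    have "f (pi 0) = \<zero>\<^bsub>U\<^esub>"
      using sc[of 0 0] U.smult_zero_left[of "f (pi 0)"] ring_hom_closed[OF hom] pi_scale[of 0 0] by simp
    then show ?case by (simp add: linear_pm_0[OF h] rec_linear_0[OF U \<rho>])
  next
    case (single k c)
    have "f (pi (Poly_Mapping.single k c)) = f (pi (pm_scale c (wd (letters k))))" by (simp add: wd_def)
    also have "\<dots> = \<rho> (h (pm_scale c (wd (letters k))))"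
      by (simp only: pi_scale sc word linear_pm_scale[OF h] rec_linear_scale[OF \<rho>])
    finally show ?case by (simp add: wd_def)
  next
    case (add x y)
    then show ?case
      by (simp add: pi_add ring_hom_add[OF hom] linear_pm_add[OF h] rec_linear_add[OF \<rho>])
  qed
qed

lemma Delta_pi: "\<Delta> (pi x) = Pi (cop x)"
proof (rule ring_hom_wd_eqI[where s = pm_scale and U = BB and \<rho> = Pi and h = cop])
  have gens: "\<Delta> (pi (wd [Theta i])) = Pi (cop (wd [Theta i]))" "\<Delta> (pi (wd [H i])) = Pi (cop (wd [H i]))" for i
    using comult by (simp_all add: is_comult_def cop_wd Pi_add B.Pi2_ext_prod theta_wd hh_wd wd_Nil B.pi_one)
  show hom: "\<Delta> \<in> alg_hom (Bt C d) BB" using comult by (simp add: is_comult_def)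
  show Cons: "Pi (cop (wd (a # w))) = Pi (cop (wd [a])) \<otimes>\<^bsub>BB\<^esub> Pi (cop (wd w))" for a w
    by (subst cop_Cons) (rule B.Pi2_mult)
  show one: "Pi (cop 1) = \<one>\<^bsub>BB\<^esub>"
    by (simp add: cop_wd wd_Nil[symmetric] B.Pi2_one[symmetric]) (simp add: wd_def zero_prod_def zero_word_def flip: single_one)
  show "\<Delta> (pi (wd [a])) = Pi (cop (wd [a]))" for a
  proof (cases a)
    case (Hinv i)
    let ?h = "ext_prod (wd [H i]) (wd [H i])" and ?k = "ext_prod (wd [Hinv i]) (wd [Hinv i])"
    have hom': "\<Delta> \<in> ring_hom (Bt C d) BB" using hom by (simp add: alg_hom_def)
    then obtain X where X: "\<Delta> (pi (wd [Hinv i])) = Pi X"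
      using ring_hom_closed[OF hom', of "pi (wd [Hinv i])"] B.carrier_tensor_alg by auto
    have "Pi (?h * ?k) = Pi (ext_prod 1 1)"
      unfolding ext_prod_mult B.Pi2_ext_prod pi_H_Hinv ..
    also have ext1: "ext_prod 1 1 = (1 :: ('i gen word \<times> 'i gen word) \<Rightarrow>\<^sub>0 base)"
      by (simp flip: single_one add: zero_prod_def)
    finally have hk: "Pi (?h * ?k) = Pi 1" .
    have "Pi X \<otimes>\<^bsub>BB\<^esub> Pi ?h = \<Delta> (pi (wd [Hinv i]) \<otimes>\<^bsub>Bt C d\<^esub> pi (wd [H i]))"
      by (simp add: ring_hom_mult[OF hom'] X gens) (simp add: cop_wd)
    also have "\<dots> = Pi 1"
      using ring_hom_one[OF hom'] by (simp add: pi_H_Hinv B.Pi2_one B.pi_one flip: B.pi_mult)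
    finally have Xh: "Pi X \<otimes>\<^bsub>BB\<^esub> Pi ?h = Pi 1" .
    \<comment> \<open>The value on an inverse letter is not prescribed. \<open>Pi X\<close> is a
      left inverse of h \<otimes> h and \<open>?k\<close> represents a right inverse, so the two
      agree.\<close>
    have "Pi X = Pi X \<otimes>\<^bsub>BB\<^esub> Pi (?h * ?k)"
      unfolding hk by (simp flip: B.Pi2_mult)
    also have "\<dots> = (Pi X \<otimes>\<^bsub>BB\<^esub> Pi ?h) \<otimes>\<^bsub>BB\<^esub> Pi ?k"
      by (simp add: mult.assoc flip: B.Pi2_mult)
    also have "\<dots> = Pi ?k" unfolding Xh by (simp flip: B.Pi2_mult)
    finally show ?thesis by (simp add: Hinv X cop_wd)
  qed (simp_all add: gens)
qed (intro lin_intro B.vect_tensor_alg B.rec_linear_Pi2_alg)+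

definition tauF :: "'i gen free_algebra \<Rightarrow> 'i gen free_algebra" where
  "tauF = lin_ext pm_scale (\<lambda>k. wd (map (map_gen \<tau>) (letters k)))"

lemma tauF_wd: "tauF (wd w) = wd (map (map_gen \<tau>) w)"
  by (simp add: tauF_def wd_def lin_ext_one module_pm_scale)

lemma linear_tauF [lin_intro]: "linear_pm pm_scale h \<Longrightarrow> linear_pm pm_scale (\<lambda>x. tauF (h x))"
  unfolding tauF_def by (intro lin_intro module_pm_scale)

lemma T_pi: "T (pi x) = pi (tauF x)"
proof (rule ring_hom_wd_eqI[where s = pm_scale and U = "Bt C d" and \<rho> = pi and h = tauF])
  have gens: "T (pi (wd [Theta i])) = pi (tauF (wd [Theta i]))" "T (pi (wd [H i])) = pi (tauF (wd [H i]))" for i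
    using action by (simp_all add: is_diagram_action_def tauF_wd theta_wd hh_wd)
  show hom: "T \<in> alg_hom (Bt C d) (Bt C d)" using action by (simp add: is_diagram_action_def)
  show Cons: "pi (tauF (wd (a # w))) = pi (tauF (wd [a])) \<otimes>\<^bsub>Bt C d\<^esub> pi (tauF (wd w))" for a w
    by (simp add: tauF_wd flip: B.pi_mult wd_append)
  show one: "pi (tauF 1) = \<one>\<^bsub>Bt C d\<^esub>"
    by (simp add: tauF_wd flip: wd_Nil) (simp add: wd_Nil B.pi_one)
  show "T (pi (wd [a])) = pi (tauF (wd [a]))" for a
  proof (cases a)
    case (Hinv i)
    have hom': "T \<in> ring_hom (Bt C d) (Bt C d)" using hom by (simp add: alg_hom_def)
    then obtain x where X: "T (pi (wd [Hinv i])) = pi x"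
      using ring_hom_closed[OF hom', of "pi (wd [Hinv i])"] B.onto by auto
    have "pi x \<otimes>\<^bsub>Bt C d\<^esub> pi (wd [H (\<tau> i)]) = T (pi (wd [Hinv i]) \<otimes>\<^bsub>Bt C d\<^esub> pi (wd [H i]))"
      by (simp add: ring_hom_mult[OF hom'] X gens) (simp add: tauF_wd)
    also have "\<dots> = pi 1"
      using ring_hom_one[OF hom'] by (simp add: pi_H_Hinv B.pi_one flip: B.pi_mult)
    finally have Xh: "pi x \<otimes>\<^bsub>Bt C d\<^esub> pi (wd [H (\<tau> i)]) = pi 1" .
    have "pi x = pi x \<otimes>\<^bsub>Bt C d\<^esub> pi (wd [H (\<tau> i)] * wd [Hinv (\<tau> i)])"
      unfolding pi_H_Hinv by (simp flip: B.pi_mult)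
    also have "\<dots> = (pi x \<otimes>\<^bsub>Bt C d\<^esub> pi (wd [H (\<tau> i)])) \<otimes>\<^bsub>Bt C d\<^esub> pi (wd [Hinv (\<tau> i)])"
      by (simp add: mult.assoc flip: B.pi_mult)
    also have "\<dots> = pi (wd [Hinv (\<tau> i)])" unfolding Xh by (simp flip: B.pi_mult)
    finally show ?thesis by (simp add: Hinv X tauF_wd)
  qed (simp_all add: gens)
qed (intro lin_intro B.V.vect_axioms B.lin)+

definition epsF :: "'i gen free_algebra \<Rightarrow> base" where
  "epsF = lin_ext (*) (\<lambda>k. if deg (letters k) = 0 then 1 else 0)"

lemma epsF_wd: "epsF (wd w) = (if deg w = 0 then 1 else 0)"
  by (simp add: epsF_def wd_def lin_ext_one module_mult)

lemma linear_epsF [lin_intro]: "linear_pm pm_scale h \<Longrightarrow> linear_pm (*) (\<lambda>x. epsF (h x))"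
  unfolding epsF_def by (intro lin_intro module_mult)

lemma eps_pi: "\<epsilon> (pi x) = epsF x"
proof (rule ring_hom_wd_eqI[where s = "(*)" and U = field_alg and \<rho> = "\<lambda>x. x" and h = epsF])
  show hom: "\<epsilon> \<in> alg_hom (Bt C d) field_alg" using counit by (simp add: is_counit_def)
  have hom': "\<epsilon> \<in> ring_hom (Bt C d) field_alg" using hom by (simp add: alg_hom_def)
  show "\<epsilon> (pi (wd [a])) = epsF (wd [a])" for a
  proof (cases a)
    case (Hinv i)
    have "\<epsilon> (pi (wd [Hinv i])) * \<epsilon> (pi (wd [H i])) = \<epsilon> (pi (wd [Hinv i]) \<otimes>\<^bsub>Bt C d\<^esub> pi (wd [H i]))"
      using ring_hom_mult[OF hom', of "pi (wd [Hinv i])" "pi (wd [H i])"] by (simp add: field_alg_def)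
    also have "\<dots> = 1"
      using ring_hom_one[OF hom'] by (simp add: pi_H_Hinv B.pi_one field_alg_def flip: B.pi_mult)
    finally show ?thesis using counit by (simp add: is_counit_def hh_wd Hinv epsF_wd)
  qed (use counit in \<open>simp_all add: is_counit_def theta_wd hh_wd epsF_wd\<close>)
  show "epsF 1 = \<one>\<^bsub>field_alg\<^esub>" by (simp add: field_alg_def epsF_wd flip: wd_Nil)
  show "epsF (wd (a # w)) = epsF (wd [a]) \<otimes>\<^bsub>field_alg\<^esub> epsF (wd w)" for a w
    by (cases a) (simp_all add: field_alg_def epsF_wd)
qed (intro lin_intro vect_field_alg rec_linear_field_alg)+


section \<open>The pairing, the functional \<open>\<chi>\<close> and the deformed products\<close>

abbreviation tw :: "'i gen list \<Rightarrow> 'i gen list" where "tw \<equiv> map (map_gen \<tau>)"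

definition P :: "'i gen free_algebra \<Rightarrow> 'i gen free_algebra \<Rightarrow> base" where
  "P x y = \<phi> (pi x) (pi y)"

definition p :: "'i gen list \<Rightarrow> 'i gen list \<Rightarrow> base" where "p u v = P (wd u) (wd v)"

lemma linear_P_left [lin_intro]: "linear_pm pm_scale h \<Longrightarrow> linear_pm (*) (\<lambda>x. P (h x) y)"
  and linear_P_right [lin_intro]: "linear_pm pm_scale h \<Longrightarrow> linear_pm (*) (\<lambda>x. P y (h x))"
  using pairing
  by (simp_all add: linear_pm_def P_def is_hopf_pairing_def bilinear_form_def pi_add pi_scale)

lemmas lift_field = B.tensor_lift_Pi2[OF vect_field_alg module_mult rec_linear_field_alg]
lemmas lift_B = B.tensor_lift_Pi2[OF B.V.vect_axioms module_pm_scale B.lin]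
lemmas lift_BB = B.tensor_lift_Pi2[OF B.vect_tensor_alg module_pm_scale B.rec_linear_Pi2_alg]

lemma P_mult_right: "P x (y * z) = bil_ext (*) (\<lambda>a b. P a y * P b z) (cop x)"
proof -
  have "P x (y * z) = tensor_lift field_alg (\<lambda>a b. \<phi> a (pi y) * \<phi> b (pi z)) (Pi (cop x))"
    using pairing by (simp add: P_def is_hopf_pairing_def B.pi_mult Delta_pi)
  also have "\<dots> = bil_ext (*) (\<lambda>a b. P a y * P b z) (cop x)"
    by (rule lift_field) (intro lin_intro | simp add: P_def)+
  finally show ?thesis .
qed

lemma P_mult_left: "P (y * z) x = bil_ext (*) (\<lambda>a b. P y a * P z b) (cop x)"
proof -
  have "P (y * z) x = tensor_lift field_alg (\<lambda>a b. \<phi> (pi y) a * \<phi> (pi z) b) (Pi (cop x))"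
    using pairing by (simp add: P_def is_hopf_pairing_def B.pi_mult Delta_pi)
  also have "\<dots> = bil_ext (*) (\<lambda>a b. P y a * P z b) (cop x)"
    by (rule lift_field) (intro lin_intro | simp add: P_def)+
  finally show ?thesis .
qed

lemma p_append_right: "p u (v @ w) = sw u (\<lambda>a b. p a v * p b w)"
  and p_append_left: "p (v @ w) u = sw u (\<lambda>a b. p v a * p w b)"
  by (simp_all add: p_def wd_append P_mult_left P_mult_right bil_ext_cop_wd module_mult)

lemma p_Nil_right: "p u [] = (if deg u = 0 then 1 else 0)"
  and p_Nil_left: "p [] u = (if deg u = 0 then 1 else 0)"
  using pairing eps_pi[of "wd u"]
  by (simp_all add: p_def P_def is_hopf_pairing_def wd_Nil B.pi_one epsF_wd)

lemma sw_counit_left: "sw w (\<lambda>u v. if deg u = 0 then g v else 0) = g w"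
  by (induction w arbitrary: g) (auto split: gen.split)

abbreviation kap :: "'i \<Rightarrow> base" where "kap \<equiv> (\<lambda>i. p [H (\<tau> i)] [H i])"
abbreviation chiw :: "'i gen list \<Rightarrow> base" where "chiw \<equiv> chi kap \<tau> p"

lemma chi_Cons: "chiw (x # w) = hcoef kap x * sw w (\<lambda>u v. p [map_gen \<tau> x] u * chiw v)"
  by (rule chi.simps)

text \<open>Removing the first letter of \<open>u\<close> leaves \<chi> on the right coproduct
  factor of the remaining word, and the hypothesis is applied there; hence induction on length
  rather than on the list. Coassociativity in both words then moves the splittings to the left
  factors, where the rules of a Hopf pairing for products regroup them.\<close>

lemma chi_append: "chiw (u @ w) = sw u (\<lambda>a b. sw w (\<lambda>c e. chiw a * p (tw b) c * chiw e))"
proof (induction u arbitrary: w rule: length_induct)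
  case (1 u)
  show ?case
  proof (cases u)
    case Nil
    have "sw w (\<lambda>c e. p [] c * chiw e) = sw w (\<lambda>c e. if deg c = 0 then chiw e else 0)"
      by (rule sw_cong_splits) (simp add: p_Nil_left)
    then show ?thesis by (simp add: Nil sw_counit_left)
  next
    case (Cons x v)
    let ?y = "map_gen \<tau> x" and ?k = "hcoef kap x"
    have "chiw (u @ w) = sw v (\<lambda>a b. sw w (\<lambda>c e. ?k * p [?y] (a @ c) * chiw (b @ e)))"
      by (simp add: Cons chi_Cons sw_append sw_mult_left mult.assoc)
    also have "\<dots> = sw v (\<lambda>a b. sw w (\<lambda>c e. ?k * p [?y] (a @ c) *
        sw b (\<lambda>a' b'. sw e (\<lambda>c' e'. chiw a' * p (tw b') c' * chiw e'))))"
    proof (rule sw_cong_splits)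
      fix a b assume ab: "(a, b) \<in> splits v"
      have "chiw (b @ e) = sw b (\<lambda>a' b'. sw e (\<lambda>c' e'. chiw a' * p (tw b') c' * chiw e'))" for e
        using 1 length_splits[OF ab] Cons by simp
      then show "sw w (\<lambda>c e. ?k * p [?y] (a @ c) * chiw (b @ e)) = sw w (\<lambda>c e. ?k * p [?y] (a @ c) *
        sw b (\<lambda>a' b'. sw e (\<lambda>c' e'. chiw a' * p (tw b') c' * chiw e')))" by simp
    qed
    also have "\<dots> = sw v (\<lambda>a b. sw w (\<lambda>c e. sw b (\<lambda>a' b'. sw e (\<lambda>c' e'.
        ?k * p [?y] (a @ c) * (chiw a' * p (tw b') c' * chiw e')))))"
      by (simp only: sw_mult_left)
    also have "\<dots> = sw v (\<lambda>a b. sw w (\<lambda>c e. sw a (\<lambda>a' b'. sw c (\<lambda>c' e'.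
        ?k * p [?y] (a' @ c') * (chiw b' * p (tw b) e' * chiw e)))))"
      by (rule sw_coassoc2[symmetric])
    finally have L: "chiw (u @ w) = \<dots>" .
    \<comment> \<open>\<open>split\<close> merges the pairings of a letter and of a remaining word
      into one pairing with \<open>c\<close>. For x = \<theta>_i the pairing with
      \<open>a @ c\<close> has two summands: \<open>counit\<close> treats the one where
      \<open>c\<close> meets the empty word, \<open>split\<close> the one where it meets \<theta>.
      They match the two summands in the coproduct of \<open>x # v\<close>.\<close>
    have split: "sw a (\<lambda>a' b'. sw c (\<lambda>c' e'. k * (p [y] a' * p [z] c') * (chiw b' * p t e' * r)))
        = (k * sw a (\<lambda>a' b'. p [y] a' * chiw b')) * p (z # t) c * r" for a c k y z t r
      using p_append_left[of "[z]" t c]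
      by (simp add: sw_mult_left sw_mult_right mult_ac)
    have counit: "sw a (\<lambda>a' b'. sw c (\<lambda>c' e'. k * (p [y] a' * p [] c') * (chiw b' * p t e' * r)))
        = (k * sw a (\<lambda>a' b'. p [y] a' * chiw b')) * p t c * r" for a c k y t r
    proof -
      have "sw c (\<lambda>c' e'. k * (p [y] a' * p [] c') * (chiw b' * p t e' * r)) =
         sw c (\<lambda>c' e'. if deg c' = 0 then k * p [y] a' * (chiw b' * p t e' * r) else 0)" for a' b'
        by (rule sw_cong_splits) (simp add: p_Nil_left)
      then show ?thesis by (simp add: sw_counit_left sw_mult_left sw_mult_right mult_ac)
    qed
    show ?thesis
    proof (cases x)
      case (Theta i)
      show ?thesis
        unfolding L by (simp add: Cons Theta p_append_right sw_add ring_distribs split counit chi_Cons)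
    next
      case (H i)
      show ?thesis
        unfolding L by (simp add: Cons H p_append_right split chi_Cons)
    next
      case (Hinv i)
      show ?thesis
        unfolding L using split[where k = 1] by (simp add: Cons Hinv p_append_right chi_Cons)
    qed
  qed
qed

text \<open>Lifts of the products of \<open>Bt_iota\<close> and \<open>BtBt_iota\<close> to the free algebra and its tensor square.\<close>

definition iota_mult :: "'i gen free_algebra \<Rightarrow> 'i gen free_algebra \<Rightarrow> 'i gen free_algebra" where
  "iota_mult x y = bil_ext pm_scale (\<lambda>x1 x2. bil_ext pm_scale (\<lambda>y1 y2.
      pm_scale (P (tauF y2) x1) (x2 * y1)) (cop y)) (cop x)"

definition iota_mult2 where
  "iota_mult2 X Y = bil_ext pm_scale (\<lambda>a b. bil_ext pm_scale (\<lambda>c e. bil_ext pm_scale (\<lambda>a1 a2.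
     bil_ext pm_scale (\<lambda>b1 b2. bil_ext pm_scale (\<lambda>c1 c2. bil_ext pm_scale (\<lambda>e1 e2.
       pm_scale (P a1 e2 * P c2 b1) (ext_prod (a2 * c1) (b2 * e1)))
       (cop e)) (cop c)) (cop b)) (cop a)) Y) X"

lemma Bt_iota_mult: "pi x \<otimes>\<^bsub>Bt_iota C d \<Delta> \<phi> T\<^esub> pi y = pi (iota_mult x y)"
proof -
  have "tensor_lift (Bt C d) (\<lambda>a1 a2. tensor_lift (Bt C d) (\<lambda>b1 b2.
         \<phi> (T b2) a1 \<odot>\<^bsub>Bt C d\<^esub> (a2 \<otimes>\<^bsub>Bt C d\<^esub> b1)) (\<Delta> (pi y))) (\<Delta> (pi x)) = pi (iota_mult x y)"
    unfolding iota_mult_def Delta_pi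
    apply (rule lift_B; (intro lin_intro module_pm_scale)?)
    apply (rule lift_B; (intro lin_intro module_pm_scale)?)
    by (simp add: T_pi P_def pi_scale B.pi_mult)
  then show ?thesis by (simp add: Bt_iota_def)
qed

lemma BtBt_iota_mult: "Pi X \<otimes>\<^bsub>BtBt_iota C d \<Delta> \<phi>\<^esub> Pi Y = Pi (iota_mult2 X Y)"
proof -
  have "tensor_lift BB (\<lambda>a b. tensor_lift BB (\<lambda>c e.
       tensor_lift BB (\<lambda>a1 a2. tensor_lift BB (\<lambda>b1 b2.
       tensor_lift BB (\<lambda>c1 c2. tensor_lift BB (\<lambda>e1 e2.
         (\<phi> a1 e2 * \<phi> c2 b1) \<odot>\<^bsub>BB\<^esub>
           bt_tensor C d (a2 \<otimes>\<^bsub>Bt C d\<^esub> c1) (b2 \<otimes>\<^bsub>Bt C d\<^esub> e1))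
       (\<Delta> e)) (\<Delta> c)) (\<Delta> b)) (\<Delta> a)) (Pi Y)) (Pi X) = Pi (iota_mult2 X Y)"
    unfolding iota_mult2_def
    apply (rule lift_BB; (intro lin_intro module_pm_scale)?)
    apply (rule lift_BB; (intro lin_intro module_pm_scale)?)
    unfolding Delta_pi
    apply (rule lift_BB; (intro lin_intro module_pm_scale)?)
    apply (rule lift_BB; (intro lin_intro module_pm_scale)?)
    apply (rule lift_BB; (intro lin_intro module_pm_scale)?)
    apply (rule lift_BB; (intro lin_intro module_pm_scale)?)
    by (simp add: P_def Pi_scale B.pi_mult B.Pi2_ext_prod)
  then show ?thesis by (simp add: BtBt_iota_def)
qed

lemma linear_iota_mult [lin_intro]:
  "linear_pm pm_scale h \<Longrightarrow> linear_pm pm_scale (\<lambda>x. iota_mult (h x) y)"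
  "linear_pm pm_scale h \<Longrightarrow> linear_pm pm_scale (\<lambda>x. iota_mult y (h x))"
  unfolding iota_mult_def by (intro lin_intro module_pm_scale; assumption)+

lemma linear_iota_mult2 [lin_intro]:
  "linear_pm pm_scale h \<Longrightarrow> linear_pm pm_scale (\<lambda>x. iota_mult2 (h x) y)"
  "linear_pm pm_scale h \<Longrightarrow> linear_pm pm_scale (\<lambda>x. iota_mult2 y (h x))"
  unfolding iota_mult2_def by (intro lin_intro module_pm_scale; assumption)+

lemma iota_mult_wd: "iota_mult (wd w) (wd w') = sw w (\<lambda>a b. sw w' (\<lambda>c e. pm_scale (p (tw e) a) (wd (b @ c))))"
  by (simp add: iota_mult_def bil_ext_cop_wd module_pm_scale tauF_wd p_def wd_append)

lemma iota_mult2_wd: "iota_mult2 (ext_prod (wd a) (wd b)) (ext_prod (wd c) (wd e)) =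
   sw a (\<lambda>a1 a2. sw b (\<lambda>b1 b2. sw c (\<lambda>c1 c2. sw e (\<lambda>e1 e2.
     pm_scale (p a1 e2 * p c2 b1) (ext_prod (wd (a2 @ c1)) (wd (b2 @ e1)))))))"
proof -
  have one: "bil_ext pm_scale g (ext_prod (wd u) (wd v)) = g (wd u) (wd v)" for g :: "_ \<Rightarrow> _ \<Rightarrow> (('i gen word \<times> 'i gen word) \<Rightarrow>\<^sub>0 base)" and u v
    by (simp add: wd_def bil_ext_single module_pm_scale)
  show ?thesis
    unfolding iota_mult2_def one by (simp add: bil_ext_cop_wd module_pm_scale p_def wd_append)
qed

definition chiF :: "'i gen free_algebra \<Rightarrow> base" where
  "chiF = lin_ext (*) (\<lambda>k. chiw (letters k))"

lemma chiF_wd: "chiF (wd w) = chiw w"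
  by (simp add: chiF_def wd_def lin_ext_one module_mult)

lemma linear_chiF [lin_intro]: "linear_pm pm_scale h \<Longrightarrow> linear_pm (*) (\<lambda>x. chiF (h x))"
  unfolding chiF_def by (intro lin_intro module_mult)

definition xiF :: "'i gen free_algebra \<Rightarrow> (('i gen word \<times> 'i gen word) \<Rightarrow>\<^sub>0 base)" where
  "xiF x = bil_ext pm_scale (\<lambda>x1 x'. bil_ext pm_scale (\<lambda>x2 x3.
     pm_scale (chiF x2) (ext_prod (tauF x3) x1)) (cop x')) (cop x)"

lemma linear_xiF [lin_intro]: "linear_pm pm_scale h \<Longrightarrow> linear_pm pm_scale (\<lambda>x. xiF (h x))"
  unfolding xiF_def by (intro lin_intro module_pm_scale)

lemma xiF_wd: "xiF (wd w) = sw3 w (\<lambda>a b c. pm_scale (chiw b) (ext_prod (wd (tw c)) (wd a)))"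
  by (simp add: xiF_def bil_ext_cop_wd module_pm_scale tauF_wd sw3_def chiF_wd)

lemma xiF_wd_append: "xiF (wd (u @ v)) = sw4 u (\<lambda>a x y b. sw4 v (\<lambda>a' x' y' b'.
    pm_scale (chiw x * p (tw y) x' * chiw y') (ext_prod (wd (tw (b @ b'))) (wd (a @ a')))))"
proof -
  have sc: "pm_scale (sw w g) X = sw w (\<lambda>u v. pm_scale (g u v) X)" for w g and X :: "('i gen word \<times> 'i gen word) \<Rightarrow>\<^sub>0 base"
    by (rule sw_additive[where f = "\<lambda>c. pm_scale c X"]) (rule pm_scale_add_left)
  have "xiF (wd (u @ v)) = sw3 u (\<lambda>a m b. sw3 v (\<lambda>a' m' b'. sw m (\<lambda>x y. sw m' (\<lambda>x' y'.
    pm_scale (chiw x * p (tw y) x' * chiw y') (ext_prod (wd (tw (b @ b'))) (wd (a @ a')))))))"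
    unfolding xiF_wd sw3_append chi_append sc ..
  also have "\<dots> = sw3 u (\<lambda>a m b. sw m (\<lambda>x y. sw3 v (\<lambda>a' m' b'. sw m' (\<lambda>x' y'.
    pm_scale (chiw x * p (tw y) x' * chiw y') (ext_prod (wd (tw (b @ b'))) (wd (a @ a')))))))"
    by (intro arg_cong[where f = "sw3 u"] ext sw3_sw)
  also have "\<dots> = sw4 u (\<lambda>a x y b. sw4 v (\<lambda>a' x' y' b'.
    pm_scale (chiw x * p (tw y) x' * chiw y') (ext_prod (wd (tw (b @ b'))) (wd (a @ a')))))"
    unfolding sw3_mid ..
  finally show ?thesis .
qed

text \<open>Both sides become the same sum over fivefold coproducts of \<open>w\<close> and
  \<open>w'\<close>. Of the two pairings in \<open>iota_mult2\<close>, the one between the first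
  part of \<open>w\<close> and the last part of \<open>w'\<close> is the pairing of
  \<open>iota_mult\<close>, while the one between the fourth part of \<open>w\<close> and the second
  part of \<open>w'\<close> is produced by \<chi> of a product.\<close>

lemma xiF_iota_mult_wd: "xiF (iota_mult (wd w) (wd w')) = iota_mult2 (xiF (wd w)) (xiF (wd w'))"
proof -
  let ?G = "\<lambda>a0 a1 x y a3 b1 x' y' b3 b4. pm_scale (p (tw b4) a0 * (chiw x * p (tw y) x' * chiw y'))
     (ext_prod (wd (tw (a3 @ b3))) (wd (a1 @ b1)))"
  have lx: "linear_pm pm_scale (\<lambda>x. xiF x)" by (intro lin_intro)
  have lm: "linear_pm pm_scale (\<lambda>x. iota_mult2 x y)" "linear_pm pm_scale (\<lambda>x. iota_mult2 y x)" for y by (intro lin_intro)+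
  have s3: "pm_scale c (sw3 w g) = sw3 w (\<lambda>x y z. pm_scale c (g x y z))"
    and s4: "pm_scale c (sw4 w h) = sw4 w (\<lambda>x y z t. pm_scale c (h x y z t))"
    for c w and g :: "_ \<Rightarrow> _ \<Rightarrow> _ \<Rightarrow> (('i gen word \<times> 'i gen word) \<Rightarrow>\<^sub>0 base)" and h
    by (simp_all add: sw_iter_defs sw_scale)
  have "xiF (iota_mult (wd w) (wd w')) = sw w (\<lambda>a0 r. sw w' (\<lambda>s b4. sw4 r (\<lambda>a1 x y a3. sw4 s (\<lambda>b1 x' y' b3.
     ?G a0 a1 x y a3 b1 x' y' b3 b4))))"
    unfolding iota_mult_wd by (simp add: sw_linear[OF lx] linear_pm_scale[OF lx] xiF_wd_append s4)
  also have "\<dots> = sw w (\<lambda>a0 r. sw4 r (\<lambda>a1 x y a3. sw w' (\<lambda>s b4. sw4 s (\<lambda>b1 x' y' b3.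
     ?G a0 a1 x y a3 b1 x' y' b3 b4))))"
    by (intro arg_cong[where f = "sw w"] ext sw_sw4)
  also have "\<dots> = sw5 w (\<lambda>a0 a1 x y a3. sw5 w' (\<lambda>b1 x' y' b3 b4. ?G a0 a1 x y a3 b1 x' y' b3 b4))"
    unfolding sw5_left by (simp only: sw5_def[of w])
  finally have L: "xiF (iota_mult (wd w) (wd w')) = \<dots>" .
  have l3: "f (sw3 w g) = sw3 w (\<lambda>a b c. f (g a b c))" if "linear_pm pm_scale f"
    for w g and f :: "(('i gen word \<times> 'i gen word) \<Rightarrow>\<^sub>0 base) \<Rightarrow> (('i gen word \<times> 'i gen word) \<Rightarrow>\<^sub>0 base)"
    unfolding sw3_def by (simp add: sw_linear[OF that])
  have "iota_mult2 (xiF (wd w)) (xiF (wd w')) = sw3 w (\<lambda>w1 w2 w3. sw3 w' (\<lambda>v1 v2 v3.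
      pm_scale (chiw w2 * chiw v2) (iota_mult2 (ext_prod (wd (tw w3)) (wd w1)) (ext_prod (wd (tw v3)) (wd v1)))))"
    unfolding xiF_wd by (simp add: l3[OF lm(1)] l3[OF lm(2)] linear_pm_scale[OF lm(1)] linear_pm_scale[OF lm(2)] s3)
      (subst sw3_sw3, simp add: mult.commute)
  also have "\<dots> = sw3 w (\<lambda>w1 w2 w3. sw3 w' (\<lambda>v1 v2 v3.
      sw w3 (\<lambda>y a3. sw w1 (\<lambda>a0 a1. sw v3 (\<lambda>b3 b4. sw v1 (\<lambda>b1 x'.
        ?G a0 a1 w2 y a3 b1 x' v2 b3 b4))))))"
    unfolding iota_mult2_wd sw_map by (simp add: sw_scale mult_ac)
  also have "\<dots> = sw3 w (\<lambda>w1 w2 w3. sw w3 (\<lambda>y a3. sw w1 (\<lambda>a0 a1. sw3 w' (\<lambda>v1 v2 v3.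
      sw v3 (\<lambda>b3 b4. sw v1 (\<lambda>b1 x'. ?G a0 a1 w2 y a3 b1 x' v2 b3 b4))))))"
    unfolding sw3_sw[of w'] ..
  also have "\<dots> = sw5 w (\<lambda>a0 a1 x y a3. sw5 w' (\<lambda>b1 x' y' b3 b4. ?G a0 a1 x y a3 b1 x' y' b3 b4))"
    unfolding sw3_outer ..
  finally show ?thesis unfolding L by simp
qed

lemma xiF_iota_mult: "xiF (iota_mult x y) = iota_mult2 (xiF x) (xiF y)"
proof (rule linear_wd_eqI[where x = x and s = pm_scale])
  fix w
  show "xiF (iota_mult (wd w) y) = iota_mult2 (xiF (wd w)) (xiF y)"
    by (rule linear_wd_eqI[where x = y and s = pm_scale]) (intro lin_intro xiF_iota_mult_wd)+
qed (intro lin_intro)+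

end

section \<open>Weights of the pairing\<close>

lemma v_base_neq_0: "v_base \<noteq> 0"
proof -
  have "v_half \<noteq> 0" by (simp add: v_half_def eq_fract Zero_fract_def)
  then show ?thesis by (simp add: v_base_def)
qed

lemma Fract_power: "Fract a 1 ^ n = Fract (a ^ n) 1"
  by (induction n) (auto simp: One_fract_def)

lemma v_base_power_neq_1: "n > 0 \<Longrightarrow> v_base ^ n \<noteq> 1"
proof
  assume n: "n > 0" and "v_base ^ n = 1"
  then have "Fract ([:0, 1:] ^ (2 * n)) 1 = Fract (1 :: rat poly) 1"
    by (simp add: v_base_def v_half_def Fract_power One_fract_def flip: power_mult)
  then have "([:0, 1:] :: rat poly) ^ (2 * n) = 1" by (simp add: eq_fract)
  then have "degree (([:0, 1:] :: rat poly) ^ (2 * n)) = 0" by simp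
  then show False using n by (simp add: degree_power_eq)
qed

context hopf_data
begin

lemma vi_neq_0: "vi d i \<noteq> 0"
  by (simp add: vi_def v_base_neq_0)

lemma vi_square_neq_1: "vi d i ^ 2 \<noteq> 1"
  using GCM v_base_power_neq_1[of "d i * 2"]
  by (simp add: vi_def symmetrizable_GCM_def flip: power_mult)

lemma p_H_H: "p [H i] [H j] = vi d i powi C i j"
  and p_Theta_Theta: "p [Theta i] [Theta j] = (if i = j then vi d i - inverse (vi d i) else 0)"
  and p_Theta_H [simp]: "p [Theta i] [H j] = 0"
  using pairing by (simp_all add: is_hopf_pairing_def p_def P_def theta_wd hh_wd)

lemma p_H_H_neq_0 [simp]: "p [H i] [H j] \<noteq> 0"
  by (simp add: p_H_H vi_neq_0)

lemma p_cong_left: "pi (wd u) = pi (wd u') \<Longrightarrow> p u v = p u' v"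
  and p_cong_right: "pi (wd u) = pi (wd u') \<Longrightarrow> p v u = p v u'"
  by (simp_all add: p_def P_def)

lemma pi_wd_H_Hinv: "pi (wd [H i, Hinv i]) = pi (wd [])"
  using pi_H_Hinv(1) by (simp add: wd_Nil flip: wd_append)

lemma pi_wd_Hinv_H: "pi (wd [Hinv i, H i]) = pi (wd [])"
  using pi_H_Hinv(2) by (simp add: wd_Nil flip: wd_append)

lemma pi_wd_H_H: "pi (wd [H i, H j]) = pi (wd [H j, H i])"
proof -
  have "wd [H i] * wd [H j] - wd [H j] * wd [H i] \<in> bt_relators C d"
    by (force simp: bt_relators_def letter_wd)
  then show ?thesis
    by (simp add: pi_eq_iff bt_relators_in_ideal flip: wd_append)
qed

lemma pi_wd_H_Theta: "pi (wd [H i, Theta j]) = pi (pm_scale (vi d i powi C i j) (wd [Theta j, H i]))"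
proof -
  have "wd [H i] * wd [Theta j] - scalar (vi d i powi C i j) * (wd [Theta j] * wd [H i]) \<in> bt_relators C d"
    by (force simp: bt_relators_def letter_wd)
  then show ?thesis
    by (simp add: pi_eq_iff bt_relators_in_ideal pm_scale_scalar flip: wd_append)
qed

text \<open>The conditions on \<phi> prescribe the opposite order of arguments. Pairing the
  group-like h_i with both sides of h_j \<theta>_j = v_j^2 \<theta>_j h_j gives (v_j^2 - 1)
  \<phi>(h_i, h_j) \<phi>(h_i, \<theta>_j) = 0, and v_j^2 is not 1.\<close>

lemma p_H_Theta [simp]: "p [H i] [Theta j] = 0"
proof -
  have "C j j = 2" using GCM by (simp add: symmetrizable_GCM_def)
  then have "pi (wd [H j, Theta j]) = pi (pm_scale (vi d j ^ 2) (wd [Theta j, H j]))"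
    using pi_wd_H_Theta[of j j] by simp
  then have "P (wd [H i]) (wd [H j, Theta j]) = P (wd [H i]) (pm_scale (vi d j ^ 2) (wd [Theta j, H j]))"
    by (simp add: P_def)
  also have "\<dots> = vi d j ^ 2 * P (wd [H i]) (wd [Theta j, H j])"
    by (rule linear_pm_scale[where f = "P (wd [H i])"]) (intro lin_intro)
  finally have "p [H i] ([H j] @ [Theta j]) = vi d j ^ 2 * p [H i] ([Theta j] @ [H j])"
    by (simp add: p_def)
  then have "(vi d j ^ 2 - 1) * p [H i] [H j] * p [H i] [Theta j] = 0"
    unfolding p_append_right by (simp add: algebra_simps)
  then show ?thesis using vi_square_neq_1[of j] by simp
qed

lemma p_H_Hinv: "p [H i] [H j] * p [H i] [Hinv j] = 1"
  using p_append_right[of "[H i]" "[H j]" "[Hinv j]"] p_cong_right[OF pi_wd_H_Hinv, of "[H i]" j]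
  by (simp add: p_Nil_right)

lemma p_Hinv_H: "p [H i] [H j] * p [Hinv i] [H j] = 1"
  using p_append_left[of "[H i]" "[Hinv i]" "[H j]"] p_cong_left[OF pi_wd_H_Hinv, of i "[H j]"]
  by (simp add: p_Nil_left)

lemma p_Hinv_Hinv: "p [H i] [Hinv j] * p [Hinv i] [Hinv j] = 1"
  using p_append_left[of "[H i]" "[Hinv i]" "[Hinv j]"] p_cong_left[OF pi_wd_H_Hinv, of i "[Hinv j]"]
  by (simp add: p_Nil_left)

lemma p_Hinv_Theta [simp]: "p [Hinv i] [Theta j] = 0"
  using p_append_left[of "[H i]" "[Hinv i]" "[Theta j]"] p_cong_left[OF pi_wd_H_Hinv, of i "[Theta j]"]
  by (simp add: p_Nil_left p_Nil_right)

lemma p_Theta_Hinv [simp]: "p [Theta i] [Hinv j] = 0"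
  using p_append_right[of "[Theta i]" "[H j]" "[Hinv j]"] p_cong_right[OF pi_wd_H_Hinv, of "[Theta i]" j]
  by (simp add: p_Nil_left p_Nil_right)

lemma p_letters_neq_0: "deg [x] = 0 \<Longrightarrow> deg [y] = 0 \<Longrightarrow> p [x] [y] \<noteq> 0"
  using p_H_Hinv p_Hinv_H p_Hinv_Hinv
  by (cases x; cases y) (auto, (metis mult_zero_right zero_neq_one)+)

text \<open>In each term of the iterated coproduct of \<theta>_i at most one factor is \<theta>_i,
  with h_i before it and 1 after it. A nonzero pairing therefore needs exactly one \<theta> in
  \<open>v\<close>, with index i, since group-like letters and letters \<theta> pair to
  zero.\<close>

lemma p_letter_wt: "p [x] v \<noteq> 0 \<Longrightarrow> wt f v = wt f [x]"
proof (induction v)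
  case Nil
  then show ?case by (cases x) (auto simp: p_Nil_right)
next
  case (Cons y v)
  have "p [x] (y # v) = sw [x] (\<lambda>a b. p a [y] * p b v)"
    using p_append_right[of "[x]" "[y]" v] by simp
  with Cons show ?case
    by (cases x; cases y) (auto simp: p_Theta_Theta p_Nil_left wt_eq_0 split: if_splits)
qed

lemma p_wt: "p u v \<noteq> 0 \<Longrightarrow> wt f u = wt f v"
proof (induction u arbitrary: v)
  case Nil
  then show ?case by (auto simp: p_Nil_left wt_eq_0 split: if_splits)
next
  case (Cons x u)
  have "p (x # u) v = sw v (\<lambda>a b. p [x] a * p u b)"
    using p_append_left[of "[x]" u v] by simp
  with Cons.prems obtain a b where ab: "(a, b) \<in> splits v" "p [x] a \<noteq> 0" "p u b \<noteq> 0"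
    using sw_eq_0[of v "\<lambda>a b. p [x] a * p u b"] by fastforce
  then show ?case
    using Cons.IH[OF ab(3)] p_letter_wt[OF ab(2), of f] wt_splits[OF ab(1), of f] wt_append[of f "[x]" u] by simp
qed

end

text \<open>The coproduct of a word \<open>w\<close> contains exactly one term \<open>g \<otimes> w\<close> and one term \<open>w \<otimes> h\<close> with \<open>g\<close>, \<open>h\<close>
  group-like; these are \<open>gl w\<close> and \<open>hp w\<close>.\<close>

fun gl :: "'i gen list \<Rightarrow> 'i gen list" where
  "gl [] = []" | "gl (Theta i # w) = H i # gl w" | "gl (x # w) = x # gl w"

fun hp :: "'i gen list \<Rightarrow> 'i gen list" where
  "hp [] = []" | "hp (Theta i # w) = hp w" | "hp (x # w) = x # hp w"

lemma gl_append: "gl (u @ v) = gl u @ gl v" by (induction u rule: gl.induct) auto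
lemma hp_append: "hp (u @ v) = hp u @ hp v" by (induction u rule: hp.induct) auto
lemma deg_hp: "deg (hp w) = 0" by (induction w rule: hp.induct) auto

lemma sw_left_deg_0: "(\<And>u v. (u, v) \<in> splits w \<Longrightarrow> deg u \<noteq> 0 \<Longrightarrow> g u v = 0) \<Longrightarrow> sw w g = g (gl w) w"
proof (induction w arbitrary: g rule: gl.induct)
  case (2 i w)
  have "sw w (\<lambda>u v. g (Theta i # u) v) = 0"
    by (rule sw_eq_0) (rule 2(2), force+)
  moreover have "sw w (\<lambda>u v. g (H i # u) (Theta i # v)) = g (H i # gl w) (Theta i # w)"
    by (rule 2(1)) (rule 2(2), force+)
  ultimately show ?case by simp
next
  case ("3_1" i w)
  have "sw w (\<lambda>u v. g (H i # u) (H i # v)) = g (H i # gl w) (H i # w)"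
    by (rule "3_1"(1)) (rule "3_1"(2), force+)
  then show ?case by simp
next
  case ("3_2" i w)
  have "sw w (\<lambda>u v. g (Hinv i # u) (Hinv i # v)) = g (Hinv i # gl w) (Hinv i # w)"
    by (rule "3_2"(1)) (rule "3_2"(2), force+)
  then show ?case by simp
qed simp

lemma sw_right_deg_0: "(\<And>u v. (u, v) \<in> splits w \<Longrightarrow> deg v \<noteq> 0 \<Longrightarrow> g u v = 0) \<Longrightarrow> sw w g = g w (hp w)"
proof (induction w arbitrary: g rule: gl.induct)
  case (2 i w)
  have "sw w (\<lambda>u v. g (H i # u) (Theta i # v)) = 0"
    by (rule sw_eq_0) (rule 2(2), force+)
  moreover have "sw w (\<lambda>u v. g (Theta i # u) v) = g (Theta i # w) (hp w)"
    by (rule 2(1)) (rule 2(2), force+)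
  ultimately show ?case by simp
next
  case ("3_1" i w)
  have "sw w (\<lambda>u v. g (H i # u) (H i # v)) = g (H i # w) (H i # hp w)"
    by (rule "3_1"(1)) (rule "3_1"(2), force+)
  then show ?case by simp
next
  case ("3_2" i w)
  have "sw w (\<lambda>u v. g (Hinv i # u) (Hinv i # v)) = g (Hinv i # w) (Hinv i # hp w)"
    by (rule "3_2"(1)) (rule "3_2"(2), force+)
  then show ?case by simp
qed simp

lemma keys_linear_cong:
  fixes f :: "'a free_algebra \<Rightarrow> 'c::ab_group_add"
  assumes "linear_pm s f" "linear_pm s h"
    and "\<And>w. Word w \<in> Poly_Mapping.keys x \<Longrightarrow> f (wd w) = h (wd w)"
  shows "f x = h x"
proof -
  have x: "x = (\<Sum>k\<in>Poly_Mapping.keys x. Poly_Mapping.single k (Poly_Mapping.lookup x k))"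
    by (rule poly_mapping_eqI) (auto simp: lookup_sum lookup_single when_def in_keys_iff sum.delta)
  have "f (Poly_Mapping.single k c) = h (Poly_Mapping.single k c)" if "k \<in> Poly_Mapping.keys x" for k c
    using linear_pm_single[OF assms(1), of k c] linear_pm_single[OF assms(2), of k c] assms(3)[of "letters k"] that
    by (simp add: wd_def)
  then show ?thesis
    by (subst (1 2) x) (simp add: linear_pm_sum[OF assms(1)] linear_pm_sum[OF assms(2)])
qed

text \<open>The conditions make \<open>K\<close> a subspace, such as the kernel of a functional. The
  elements all of whose translates by words lie in \<open>K\<close> form a two-sided ideal inside
  \<open>K\<close>, and this ideal contains the relators.\<close>

lemma bt_ideal_subset:
  assumes add: "\<And>x y. x \<in> K \<Longrightarrow> y \<in> K \<Longrightarrow> x + y \<in> K" and scale: "\<And>c x. x \<in> K \<Longrightarrow> pm_scale c x \<in> K"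
    and zero: "0 \<in> K" and rel: "\<And>r u v. r \<in> bt_relators C d \<Longrightarrow> wd u * r * wd v \<in> K"
  shows "bt_ideal C d \<subseteq> K"
proof -
  define Z where "Z = {x. \<forall>u v. wd u * x * wd v \<in> K}"
  have Z_add: "x + y \<in> Z" if "x \<in> Z" "y \<in> Z" for x y
    using that by (auto simp: Z_def algebra_simps add)
  have Z_scale: "pm_scale c x \<in> Z" if "x \<in> Z" for c x
    using that by (auto simp: Z_def pm_scale_mult_left pm_scale_mult_right scale)
  have Z_0: "0 \<in> Z" using zero by (simp add: Z_def)
  have single: "Poly_Mapping.single k c = pm_scale c (wd (letters k))" for k c by (simp add: wd_def)
  have Z_wd: "wd w * x \<in> Z" "x * wd w \<in> Z" if "x \<in> Z" for w x
  proof -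
    have "wd u * (wd w * x) * wd v \<in> K" for u v
      using that[unfolded Z_def, simplified, rule_format, of "u @ w" v] by (simp add: wd_append mult.assoc)
    then show "wd w * x \<in> Z" by (simp add: Z_def)
    have "wd u * (x * wd w) * wd v \<in> K" for u v
      using that[unfolded Z_def, simplified, rule_format, of u "w @ v"] by (simp add: wd_append mult.assoc)
    then show "x * wd w \<in> Z" by (simp add: Z_def)
  qed
  have left: "y * x \<in> Z" and right: "x * y \<in> Z" if x: "x \<in> Z" for x y
    by (induction y rule: poly_mapping_linear_induct)
      (auto simp: Z_0 Z_add Z_scale algebra_simps single pm_scale_mult_left pm_scale_mult_right Z_wd x)
  have "ideal Z free_ring"
  proof (rule idealI[OF ring_free_ring])
    show "subgroup Z (add_monoid free_ring)"
    proof (rule group.subgroupI)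
      show "group (add_monoid (free_ring :: 'a gen free_algebra ring))"
        using ring.is_abelian_group[OF ring_free_ring] abelian_group.a_group by blast
      fix a assume "a \<in> Z"
      then have "- a \<in> Z" using Z_scale[of a "- 1"] by (simp add: pm_scale_minus_one)
      moreover have "inv\<^bsub>add_monoid free_ring\<^esub> a = - a"
        using a_minus_free_ring[of 0 a] by (simp add: a_minus_def a_inv_def)
      ultimately show "inv\<^bsub>add_monoid free_ring\<^esub> a \<in> Z" by simp
    qed (use Z_0 Z_add in auto)
  qed (auto simp: left right)
  moreover have "bt_relators C d \<subseteq> Z" by (auto simp: Z_def rel)
  ultimately have "bt_ideal C d \<subseteq> Z"
    unfolding bt_ideal_def by (rule ring.genideal_minimal[OF ring_free_ring])
  moreover have "x \<in> K" if "x \<in> Z" for x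
    using that[unfolded Z_def, simplified, rule_format, of "[]" "[]"] by (simp add: wd_Nil)
  ultimately show ?thesis by blast
qed

context hopf_data
begin

section \<open>\<open>\<chi>\<close> vanishes on the defining ideal\<close>

lemma tau_tau: "\<tau> (\<tau> i) = i"
  using satake by (metis quasi_split_satake_def comp_apply id_apply)

text \<open>The symmetrizer makes d_i c_{ij} symmetric, and \<tau> preserves it. This symmetry is
  what \<chi>(h_i h_j) = \<chi>(h_j h_i) amounts to.\<close>

lemma p_H_tau_commute: "p [H (\<tau> i)] [H j] = p [H (\<tau> j)] [H i]"
proof -
  have q: "vi d k powi C k l = v_base powi (int (d k) * C k l)" for k l
    by (simp add: vi_def power_int_mult)
  have "int (d (\<tau> i)) * C (\<tau> i) j = int (d (\<tau> j)) * C (\<tau> j) i"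
    using GCM satake tau_tau unfolding symmetrizable_GCM_def quasi_split_satake_def by metis
  then show ?thesis by (simp add: p_H_H q)
qed

text \<open>The letters \<open>\<theta>\<close> of a word on which \<open>\<chi>\<close> does not vanish can be grouped into pairs \<open>\<theta>\<^sub>k\<close>, \<open>\<theta>\<^bsub>\<tau> k\<^esub>\<close>.\<close>

lemma chi_wt: "chiw w \<noteq> 0 \<Longrightarrow> \<exists>m. \<forall>f. wt f w = wt f m + wt (f \<circ> \<tau>) m"
proof (induction w rule: length_induct)
  case (1 w)
  show ?case
  proof (cases w)
    case Nil
    then show ?thesis by (intro exI[of _ "[]"]) simp
  next
    case (Cons x w')
    with 1(2) have "sw w' (\<lambda>u v. p [map_gen \<tau> x] u * chiw v) \<noteq> 0"
      by (simp add: chi_Cons)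
    then obtain u v where uv: "(u, v) \<in> splits w'" "p [map_gen \<tau> x] u \<noteq> 0" "chiw v \<noteq> 0"
      using sw_eq_0[of w' "\<lambda>u v. p [map_gen \<tau> x] u * chiw v"] by fastforce
    have "length v < length w" using length_splits[OF uv(1)] Cons by simp
    with 1(1) uv(3) obtain m where m: "\<And>f. wt f v = wt f m + wt (f \<circ> \<tau>) m" by blast
    have *: "wt f w = wt f [x] + wt f [map_gen \<tau> x] + (wt f m + wt (f \<circ> \<tau>) m)" for f
      using wt_splits[OF uv(1), of f] p_wt[OF uv(2), of f] wt_append[of f "[x]" w'] m[of f] Cons by simp
    have "wt f w = wt f (x # m) + wt (f \<circ> \<tau>) (x # m)" for f
      unfolding * by (cases x) auto
    then show ?thesis by blast
  qed
qed

lemma wt_replicate_Theta: "wt f (replicate n (Theta i)) = n * f i"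
  by (induction n) auto

text \<open>The word contains one \<theta>_j and r + s letters \<theta>_i. By \<open>chi_wt\<close>
  the letters of index j and of index \<tau> j are equally many, hence one each; j is not fixed by
  \<tau>, as it would then occur an even number of times. So \<tau> j can only be i, and i occurs
  once.\<close>

lemma chi_serre_word:
  assumes ij: "i \<noteq> j" and nz: "chiw (replicate r (Theta i) @ [Theta j] @ replicate s (Theta i)) \<noteq> 0"
  shows "\<tau> j = i \<and> r + s = 1"
proof -
  let ?w = "replicate r (Theta i) @ [Theta j] @ replicate s (Theta i)"
  let ?\<delta> = "\<lambda>k l. if l = k then 1 else 0 :: nat"
  from chi_wt[OF nz] obtain m where m: "wt f ?w = wt f m + wt (f \<circ> \<tau>) m" for f by blast
  have t: "?\<delta> k \<circ> \<tau> = ?\<delta> (\<tau> k)" for k using tau_tau by (auto simp: fun_eq_iff)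
  have w: "wt (?\<delta> k) ?w = (r + s) * ?\<delta> k i + ?\<delta> k j" for k
    by (simp add: wt_append wt_replicate_Theta algebra_simps)
  have 1: "wt (?\<delta> j) m + wt (?\<delta> (\<tau> j)) m = 1"
    using m[of "?\<delta> j"] w[of j] ij by (simp add: t)
  have 2: "(r + s) * ?\<delta> (\<tau> j) i + ?\<delta> (\<tau> j) j = 1"
    using m[of "?\<delta> (\<tau> j)"] w[of "\<tau> j"] 1 by (simp add: t tau_tau add.commute)
  have "\<tau> j \<noteq> j"
  proof
    assume "\<tau> j = j"
    with 1 have "wt (?\<delta> j) m + wt (?\<delta> j) m = 1" by (simp only:)
    then show False by presburger
  qed
  with 2 show ?thesis by (auto split: if_splits)
qed

lemma wd_replicate: "letter a ^ n = wd (replicate n a)"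
  by (induction n) (simp_all add: wd_Nil letter_wd flip: wd_append)

lemma serre_wd: "serre C d i j = (\<Sum>r = 0..nat (1 - C i j). pm_scale
   ((- 1) ^ r * qbinom (vi d i) (nat (1 - C i j)) r)
   (wd (replicate r (Theta i) @ [Theta j] @ replicate (nat (1 - C i j) - r) (Theta i))))"
  unfolding serre_def Let_def wd_replicate by (simp only: letter_wd pm_scale_scalar wd_append mult.assoc)

lemma kap_eq_1: assumes "C i (\<tau> i) = 0" shows "kap i = 1"
proof -
  have "C (\<tau> i) i = 0" using assms GCM by (metis symmetrizable_GCM_def)
  then show ?thesis by (simp add: p_H_H)
qed

lemma chi_simps: "chiw [H i] = kap i" "chiw [Hinv i] = 1" "chiw [Theta i] = 0"
  "chiw [H i, H j] = kap i * p [H (\<tau> i)] [H j] * kap j"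
  "chiw [H i, Theta j] = 0" "chiw [Theta j, H i] = 0"
  "chiw [Theta i, Theta j] = kap i * p [Theta (\<tau> i)] [Theta j]"
  "chiw [H i, Hinv i] = 1" "chiw [Hinv i, H i] = 1"
  using p_H_Hinv[of "\<tau> i" i] p_Hinv_H[of "\<tau> i" i]
  by (simp_all add: chi_Cons p_Nil_right mult_ac)

lemma chi_serre: assumes "i \<noteq> j" shows "chiF (serre C d i j) = 0"
proof -
  let ?m = "nat (1 - C i j)" and ?q = "vi d i"
  let ?w = "\<lambda>r. replicate r (Theta i) @ [Theta j] @ replicate (?m - r) (Theta i)"
  have l: "linear_pm (*) (\<lambda>x. chiF x)" by (intro lin_intro)
  have S: "chiF (serre C d i j) = (\<Sum>r = 0..?m. (- 1) ^ r * qbinom ?q ?m r * chiw (?w r))"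
    unfolding serre_wd by (simp add: linear_pm_sum[OF l] linear_pm_scale[OF l] chiF_wd)
  show ?thesis
  proof (cases "\<tau> j = i \<and> ?m = 1")
    case False
    then have "chiw (?w r) = 0" if "r \<le> ?m" for r
      using chi_serre_word[OF assms, of r "?m - r"] that by auto
    then show ?thesis unfolding S by (intro sum.neutral) auto
  next
    case True
    \<comment> \<open>Here C i j = 0, and the relator is the difference of \<theta>_j \<theta>_i and
      \<theta>_i \<theta>_j. Both have \<chi>-value v_i - v_i^-1, as d is \<tau>-invariant and the
      coefficients \<open>kap\<close> are 1.\<close>
    then have ti: "\<tau> i = j" using tau_tau by auto
    have c: "C i j = 0" "C j i = 0" using True GCM assms by (auto simp: symmetrizable_GCM_def)
    have k: "kap i = 1" "kap j = 1"
      by (rule kap_eq_1, simp only: ti conjunct1[OF True] c)+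
    have dd: "vi d i = vi d j" using satake ti by (metis quasi_split_satake_def vi_def)
    have "?q - inverse ?q \<noteq> 0"
      using vi_square_neq_1[of i] vi_neq_0[of i] by (simp add: power2_eq_square field_simps)
    then have "qbinom ?q 1 0 = 1" "qbinom ?q 1 1 = 1"
      by (simp_all add: qbinom_def qfact_def qint_def)
    then have "chiF (serre C d i j) = chiw [Theta j, Theta i] - chiw [Theta i, Theta j]"
      unfolding S using True by simp
    also have "\<dots> = 0"
      using k by (simp add: chi_simps ti conjunct1[OF True] p_Theta_Theta dd)
    finally show ?thesis .
  qed
qed

lemma pi_wd_cong_append: "pi (wd u) = pi (wd u') \<Longrightarrow> pi (wd v) = pi (wd v') \<Longrightarrow> pi (wd (u @ v)) = pi (wd (u' @ v'))"
  by (simp add: wd_append B.pi_mult)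

lemma pi_wd_H_replicate: "pi (wd ([H j] @ replicate n (H i))) = pi (wd (replicate n (H i) @ [H j]))"
proof (induction n)
  case (Suc n)
  have "pi (wd ([H j, H i] @ replicate n (H i))) = pi (wd ([H i, H j] @ replicate n (H i)))"
    by (intro pi_wd_cong_append pi_wd_H_H refl)
  also have "\<dots> = pi (wd ([H i] @ ([H j] @ replicate n (H i))))" by simp
  also have "\<dots> = pi (wd ([H i] @ (replicate n (H i) @ [H j])))"
    by (intro pi_wd_cong_append Suc refl)
  finally show ?case by simp
qed simp

lemma gl_replicate: "gl (replicate n (Theta i)) = replicate n (H i)" by (induction n) auto
lemma hp_replicate: "hp (replicate n (Theta i)) = []" by (induction n) auto

lemma pi_wd_gl_serre: "pi (wd (gl (replicate r (Theta i) @ [Theta j] @ replicate s (Theta i))))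
   = pi (wd (replicate (r + s) (H i) @ [H j]))"
proof -
  have "pi (wd (replicate r (H i) @ ([H j] @ replicate s (H i)))) = pi (wd (replicate r (H i) @ (replicate s (H i) @ [H j])))"
    by (intro pi_wd_cong_append pi_wd_H_replicate refl)
  then show ?thesis by (simp add: gl_append gl_replicate replicate_add)
qed

text \<open>The group-like parts agree only in the quotient: exchanging letters h_i or cancelling h
  h^-1 changes the word. This is enough, since the pairing factors through the quotient.\<close>

lemma relator_homogeneous:
  assumes "r \<in> bt_relators C d"
  shows "\<exists>n g h. \<forall>w. Word w \<in> Poly_Mapping.keys r \<longrightarrow> deg w = n \<and> pi (wd (gl w)) = g \<and> pi (wd (hp w)) = h"
proof -
  have two: ?thesis if "r = wd a - pm_scale c (wd b)" "deg a = deg b" "pi (wd (gl a)) = pi (wd (gl b))"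
    "pi (wd (hp a)) = pi (wd (hp b))" for a b c
  proof -
    have "w = a \<or> w = b" if "Word w \<in> Poly_Mapping.keys r" for w
      using that \<open>r = _\<close> by (auto simp: in_keys_iff lookup_minus wd_def lookup_single when_def split: if_splits)
    then show ?thesis using that by metis
  qed
  from assms consider i where "r = letter (H i) * letter (Hinv i) - 1"
    | i where "r = letter (Hinv i) * letter (H i) - 1"
    | i j where "r = letter (H i) * letter (H j) - letter (H j) * letter (H i)"
    | i j where "r = letter (H i) * letter (Theta j) - scalar (vi d i powi C i j) * (letter (Theta j) * letter (H i))"
    | i j where "i \<noteq> j" "r = serre C d i j"
    unfolding bt_relators_def by blast
  then show ?thesis
  proof cases
    case (1 i)
    show ?thesis
      by (rule two[of "[H i, Hinv i]" 1 "[]"]) (simp_all add: 1 letter_wd wd_Nil pi_wd_H_Hinv flip: wd_append)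
  next
    case (2 i)
    show ?thesis
      by (rule two[of "[Hinv i, H i]" 1 "[]"]) (simp_all add: 2 letter_wd wd_Nil pi_wd_Hinv_H flip: wd_append)
  next
    case (3 i j)
    show ?thesis
      by (rule two[of "[H i, H j]" 1 "[H j, H i]"]) (simp_all add: 3 letter_wd pi_wd_H_H[of i j] flip: wd_append)
  next
    case (4 i j)
    show ?thesis
      by (rule two[of "[H i, Theta j]" "vi d i powi C i j" "[Theta j, H i]"])
        (simp_all add: 4 letter_wd pi_wd_H_H[of i j] pm_scale_scalar flip: wd_append)
  next
    case (5 i j)
    let ?m = "nat (1 - C i j)"
    let ?w = "\<lambda>r. replicate r (Theta i) @ [Theta j] @ replicate (?m - r) (Theta i)"
    have "\<exists>s\<le>?m. w = ?w s" if w: "Word w \<in> Poly_Mapping.keys r" for w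
    proof -
      from w obtain s where "s \<in> {0..?m}" "Poly_Mapping.lookup (pm_scale ((- 1) ^ s * qbinom (vi d i) ?m s) (wd (?w s))) (Word w) \<noteq> 0"
        unfolding 5 serre_wd in_keys_iff lookup_sum by (meson sum.neutral)
      then show ?thesis by (auto simp: wd_def lookup_single when_def split: if_splits)
    qed
    moreover have "deg (?w s) = Suc ?m \<and> pi (wd (gl (?w s))) = pi (wd (replicate ?m (H i) @ [H j])) \<and> pi (wd (hp (?w s))) = pi (wd [])"
      if "s \<le> ?m" for s
      unfolding pi_wd_gl_serre using that by (simp add: wt_append wt_replicate_Theta hp_append hp_replicate)
    ultimately show ?thesis by metis
  qed
qed

lemma chi_relator: assumes "r \<in> bt_relators C d" shows "chiF r = 0"
proof -
  have l: "linear_pm (*) (\<lambda>x. chiF x)" by (intro lin_intro)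
  have two: "chiF (wd a - pm_scale c (wd b)) = chiw a - c * chiw b" for a b c
    by (simp add: linear_pm_diff[OF l] linear_pm_scale[OF l] chiF_wd)
  from assms consider i where "r = letter (H i) * letter (Hinv i) - 1"
    | i where "r = letter (Hinv i) * letter (H i) - 1"
    | i j where "r = letter (H i) * letter (H j) - letter (H j) * letter (H i)"
    | i j where "r = letter (H i) * letter (Theta j) - scalar (vi d i powi C i j) * (letter (Theta j) * letter (H i))"
    | i j where "i \<noteq> j" "r = serre C d i j"
    unfolding bt_relators_def by blast
  then show ?thesis
  proof cases
    case (1 i)
    show ?thesis using two[of "[H i, Hinv i]" 1 "[]"] by (simp add: 1 letter_wd wd_Nil chi_simps flip: wd_append)
  next
    case (2 i)
    show ?thesis using two[of "[Hinv i, H i]" 1 "[]"] by (simp add: 2 letter_wd wd_Nil chi_simps flip: wd_append)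
  next
    case (3 i j)
    show ?thesis using two[of "[H i, H j]" 1 "[H j, H i]"] p_H_tau_commute[of i j]
      by (simp add: 3 letter_wd chi_simps mult_ac flip: wd_append)
  next
    case (4 i j)
    show ?thesis using two[of "[H i, Theta j]" "vi d i powi C i j" "[Theta j, H i]"]
      by (simp add: 4 letter_wd chi_simps pm_scale_scalar flip: wd_append)
  next
    case 5
    then show ?thesis by (simp add: chi_serre)
  qed
qed

section \<open>Descent of \<chi> to the quotient algebra\<close>

definition actL :: "'i gen free_algebra \<Rightarrow> 'i gen free_algebra \<Rightarrow> 'i gen free_algebra" where
  "actL a x = bil_ext pm_scale (\<lambda>x1 x2. pm_scale (P a x1) x2) (cop x)"

definition actR :: "'i gen free_algebra \<Rightarrow> 'i gen free_algebra \<Rightarrow> 'i gen free_algebra" where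
  "actR a x = bil_ext pm_scale (\<lambda>x1 x2. pm_scale (P (tauF x2) a) x1) (cop x)"

lemma linear_act [lin_intro]:
  "linear_pm pm_scale h \<Longrightarrow> linear_pm pm_scale (\<lambda>x. actL a (h x))"
  "linear_pm pm_scale h \<Longrightarrow> linear_pm pm_scale (\<lambda>x. actR a (h x))"
  unfolding actL_def actR_def by (intro lin_intro module_pm_scale; assumption)+

lemma in_bt_ideal_iff: "x \<in> bt_ideal C d \<longleftrightarrow> pi x = pi 0"
  by (simp add: pi_eq_iff)

text \<open>The ideal is stable because the comultiplication and the pairing are defined on the quotient.\<close>

lemma act_ideal:
  assumes "x \<in> bt_ideal C d"
  shows "actL a x \<in> bt_ideal C d" "actR a x \<in> bt_ideal C d"
proof -
  have L: "pi (actL a x) = tensor_lift (Bt C d) (\<lambda>x1 x2. \<phi> (pi a) x1 \<odot>\<^bsub>Bt C d\<^esub> x2) (\<Delta> (pi x))" for x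
    unfolding actL_def Delta_pi
    by (rule lift_B[symmetric]) (intro lin_intro | simp add: P_def pi_scale)+
  have R: "pi (actR a x) = tensor_lift (Bt C d) (\<lambda>x1 x2. \<phi> (T x2) (pi a) \<odot>\<^bsub>Bt C d\<^esub> x1) (\<Delta> (pi x))" for x
    unfolding actR_def Delta_pi
    by (rule lift_B[symmetric]) (intro lin_intro | simp add: P_def pi_scale T_pi)+
  have "actL a 0 = 0" "actR a 0 = 0"
    by (rule linear_pm_0[where s = pm_scale], intro lin_intro)+
  then show "actL a x \<in> bt_ideal C d" "actR a x \<in> bt_ideal C d"
    using assms L[of x] L[of 0] R[of x] R[of 0] by (simp_all add: in_bt_ideal_iff)
qed

lemma actL_wd: "actL (wd u) (wd w) = sw w (\<lambda>a b. pm_scale (p u a) (wd b))"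
  and actR_wd: "actR (wd u) (wd w) = sw w (\<lambda>a b. pm_scale (p (tw b) u) (wd a))"
  by (simp_all add: actL_def actR_def bil_ext_cop_wd module_pm_scale p_def tauF_wd)

text \<open>This is \<open>chi_append\<close> extended linearly in the second word. It shows that
  \<chi> sees the factor \<open>y\<close> of a product only through \<open>actL\<close>, which maps
  the ideal to itself and never raises the degree.\<close>

lemma chiF_mult_left: "chiF (wd u * y) = sw u (\<lambda>a b. chiw a * chiF (actL (wd (tw b)) y))"
proof (rule linear_wd_eqI[where s = "(*)"])
  show "linear_pm (*) (\<lambda>y. sw u (\<lambda>a b. chiw a * chiF (actL (wd (tw b)) y)))"
    using linear_chiF[OF linear_act(1)[OF linear_ident]]
    by (simp add: linear_pm_def sw_add[symmetric] sw_mult_left algebra_simps)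
  have l: "linear_pm (*) (\<lambda>x. chiF x)" by (intro lin_intro)
  show "chiF (wd u * wd w) = sw u (\<lambda>a b. chiw a * chiF (actL (wd (tw b)) (wd w)))" for w
    by (simp add: actL_wd sw_linear[OF l] linear_pm_scale[OF l] chiF_wd chi_append sw_mult_left mult_ac flip: wd_append)
qed (intro lin_intro)

lemma chiF_mult_right: "chiF (y * wd v) = sw v (\<lambda>c e. chiF (actR (wd c) y) * chiw e)"
proof (rule linear_wd_eqI[where s = "(*)"])
  show "linear_pm (*) (\<lambda>y. sw v (\<lambda>c e. chiF (actR (wd c) y) * chiw e))"
    using linear_chiF[OF linear_act(2)[OF linear_ident]]
    by (simp add: linear_pm_def sw_add[symmetric] sw_mult_left algebra_simps)
  have l: "linear_pm (*) (\<lambda>x. chiF x)" by (intro lin_intro)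
  fix w
  have "chiF (wd w * wd v) = sw w (\<lambda>a b. sw v (\<lambda>c e. chiw a * p (tw b) c * chiw e))"
    by (simp add: chiF_wd chi_append flip: wd_append)
  also have "\<dots> = sw v (\<lambda>c e. sw w (\<lambda>a b. chiw a * p (tw b) c * chiw e))"
    by (rule sw_swap)
  also have "\<dots> = sw v (\<lambda>c e. chiF (actR (wd c) (wd w)) * chiw e)"
    by (simp add: actR_wd sw_linear[OF l] linear_pm_scale[OF l] chiF_wd sw_mult_left mult_ac)
  finally show "chiF (wd w * wd v) = sw v (\<lambda>c e. chiF (actR (wd c) (wd w)) * chiw e)" .
qed (intro lin_intro)

text \<open>The component of \<chi> in degree n. Elements of the ideal need not be homogeneous, so
  the induction on the degree is carried out for these components.\<close>

definition chin :: "nat \<Rightarrow> 'i gen free_algebra \<Rightarrow> base" where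
  "chin n = lin_ext (*) (\<lambda>k. if deg (letters k) = n then chiw (letters k) else 0)"

lemma chin_wd: "chin n (wd w) = (if deg w = n then chiw w else 0)"
  by (simp add: chin_def wd_def lin_ext_one module_mult)

lemma linear_chin [lin_intro]: "linear_pm pm_scale h \<Longrightarrow> linear_pm (*) (\<lambda>x. chin n (h x))"
  unfolding chin_def by (intro lin_intro module_mult)

text \<open>The pairing preserves degree, so acting by \<open>b\<close> lowers the degree by exactly
  \<open>deg b\<close>. Where the subtraction is truncated all pairings vanish, and both sides are
  0.\<close>

lemma chi_act_homogeneous:
  assumes "\<And>w. Word w \<in> Poly_Mapping.keys r \<Longrightarrow> deg w = n"
  shows "chiF (actL (wd b) (wd u * r * wd v)) = chin (deg u + n + deg v - deg b) (actL (wd b) (wd u * r * wd v))"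
    "chiF (actR (wd b) (wd u * r * wd v)) = chin (deg u + n + deg v - deg b) (actR (wd b) (wd u * r * wd v))"
proof -
  have l: "linear_pm (*) (\<lambda>x. chiF x)" "linear_pm (*) (\<lambda>x. chin k x)" for k by (intro lin_intro)+
  have nz: "p u v * (if e = k then x else 0) = p u v * x" if "p u v \<noteq> 0 \<Longrightarrow> e = k" for u v x and e k :: nat
    using that by auto
  have L: "chiF (actL (wd b) (wd w)) = chin (deg w - deg b) (actL (wd b) (wd w))" for w
    unfolding actL_wd sw_linear[OF l(1)] sw_linear[OF l(2)] linear_pm_scale[OF l(1)] linear_pm_scale[OF l(2)] chiF_wd chin_wd
  proof (rule sw_cong_splits)
    fix x y assume "(x, y) \<in> splits w"
    then show "p b x * chiw y = p b x * (if deg y = deg w - deg b then chiw y else 0)"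
      using wt_splits[of x y w "\<lambda>_. Suc 0"] p_wt[of b x "\<lambda>_. Suc 0"] by (subst nz) auto
  qed
  have R: "chiF (actR (wd b) (wd w)) = chin (deg w - deg b) (actR (wd b) (wd w))" for w
    unfolding actR_wd sw_linear[OF l(1)] sw_linear[OF l(2)] linear_pm_scale[OF l(1)] linear_pm_scale[OF l(2)] chiF_wd chin_wd
  proof (rule sw_cong_splits)
    fix x y assume "(x, y) \<in> splits w"
    then show "p (tw y) b * chiw x = p (tw y) b * (if deg x = deg w - deg b then chiw x else 0)"
      using wt_splits[of x y w "\<lambda>_. Suc 0"] p_wt[of "tw y" b "\<lambda>_. Suc 0"] by (subst nz) auto
  qed
  show "chiF (actL (wd b) (wd u * r * wd v)) = chin (deg u + n + deg v - deg b) (actL (wd b) (wd u * r * wd v))"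
    by (rule keys_linear_cong[where s = "(*)" and x = r])
      ((intro lin_intro)+, use assms in \<open>auto simp: L wt_append add.assoc simp flip: wd_append\<close>)
  show "chiF (actR (wd b) (wd u * r * wd v)) = chin (deg u + n + deg v - deg b) (actR (wd b) (wd u * r * wd v))"
    by (rule keys_linear_cong[where s = "(*)" and x = r])
      ((intro lin_intro)+, use assms in \<open>auto simp: R wt_append add.assoc simp flip: wd_append\<close>)
qed

text \<open>Words of degree 0 have only coproduct factors of degree 0, and pairing with these picks
  the extreme term in the coproduct of each word of \<open>r\<close>. By
  \<open>relator_homogeneous\<close> the resulting scalar is the same for all words of
  \<open>r\<close>, so each action multiplies \<chi> by a constant. The factor \<open>v\<close> is
  removed before \<open>u\<close>.\<close>

lemma chi_group_like_relator:
  assumes r: "r \<in> bt_relators C d" and uv: "deg u = 0" "deg v = 0"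
  shows "chiF (wd u * r * wd v) = 0"
proof -
  have l: "linear_pm (*) (\<lambda>x. chiF x)" by (intro lin_intro)
  obtain n g h where gh: "\<And>w. Word w \<in> Poly_Mapping.keys r \<Longrightarrow> pi (wd (gl w)) = g \<and> pi (wd (hp w)) = h"
    using relator_homogeneous[OF r] by metis
  have d0: "deg x = 0 \<and> deg y = 0" if "(x, y) \<in> splits u \<or> (x, y) \<in> splits v" for x y
    using that wt_splits[of x y _ "\<lambda>_. Suc 0"] uv by fastforce
  have right: "chiF (r * wd v) = 0"
  proof -
    have "chiF (actR (wd c) r) = \<phi> (T h) (pi (wd c)) * chiF r" if c: "deg c = 0" for c
    proof (rule keys_linear_cong[where s = "(*)" and x = r])
      fix w assume w: "Word w \<in> Poly_Mapping.keys r"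
      have "chiF (actR (wd c) (wd w)) = sw w (\<lambda>a b. p (tw b) c * chiw a)"
        by (simp add: actR_wd sw_linear[OF l] linear_pm_scale[OF l] chiF_wd)
      also have "\<dots> = p (tw (hp w)) c * chiw w"
        by (rule sw_right_deg_0) (use p_wt[of _ c "\<lambda>_. Suc 0"] c in force)
      also have "p (tw (hp w)) c = \<phi> (T h) (pi (wd c))"
        using gh[OF w] by (simp add: p_def P_def T_pi tauF_wd flip: tauF_wd)
          (metis T_pi tauF_wd)
      finally show "chiF (actR (wd c) (wd w)) = \<phi> (T h) (pi (wd c)) * chiF (wd w)" by (simp add: chiF_wd)
    qed (intro lin_intro)+
    then have R0: "chiF (actR (wd c) r) = 0" if "deg c = 0" for c
      using that by (simp add: chi_relator[OF r])
    show ?thesis unfolding chiF_mult_right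
    proof (rule sw_eq_0)
      fix a b assume "(a, b) \<in> splits v"
      then have "deg a = 0" using d0 by blast
      then show "chiF (actR (wd a) r) * chiw b = 0"
        by (simp only: R0 mult_zero_left)
    qed
  qed
  have "chiF (actL (wd b) (r * wd v)) = \<phi> (pi (wd b)) (g \<otimes>\<^bsub>Bt C d\<^esub> pi (wd (gl v))) * chiF (r * wd v)"
    if b: "deg b = 0" for b
  proof (rule keys_linear_cong[where s = "(*)" and x = r])
    fix w assume w: "Word w \<in> Poly_Mapping.keys r"
    have "chiF (actL (wd b) (wd (w @ v))) = sw (w @ v) (\<lambda>a e. p b a * chiw e)"
      by (simp only: actL_wd sw_linear[OF l] linear_pm_scale[OF l] chiF_wd)
    also have "\<dots> = p b (gl (w @ v)) * chiw (w @ v)"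
      by (rule sw_left_deg_0) (use p_wt[of b _ "\<lambda>_. Suc 0"] b in force)
    also have "p b (gl (w @ v)) = \<phi> (pi (wd b)) (g \<otimes>\<^bsub>Bt C d\<^esub> pi (wd (gl v)))"
      using gh[OF w] by (simp add: p_def P_def gl_append wd_append B.pi_mult)
    finally show "chiF (actL (wd b) (wd w * wd v)) = \<phi> (pi (wd b)) (g \<otimes>\<^bsub>Bt C d\<^esub> pi (wd (gl v))) * chiF (wd w * wd v)"
      by (simp add: chiF_wd flip: wd_append)
  qed (intro lin_intro)+
  then have L0: "chiF (actL (wd b) (r * wd v)) = 0" if "deg b = 0" for b
    using that right by simp
  show ?thesis unfolding mult.assoc chiF_mult_left
  proof (intro sw_eq_0)
    fix a b assume "(a, b) \<in> splits u"
    then have "deg b = 0" using d0 by blast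
    then have "deg (tw b) = 0" by simp
    then show "chiw a * chiF (actL (wd (tw b)) (r * wd v)) = 0"
      by (simp only: L0 mult_zero_right)
  qed
qed

text \<open>If \<open>u\<close> or \<open>v\<close> contains some \<open>\<theta>\<close>, splitting it off expresses \<open>\<chi> (u r v)\<close> by values of \<open>\<chi>\<close> on elements of
  the ideal of smaller degree; otherwise \<open>\<chi> (u r v)\<close> is a multiple of \<open>\<chi> r\<close>.\<close>

lemma chin_ideal: "x \<in> bt_ideal C d \<Longrightarrow> chin n x = 0"
proof (induction n arbitrary: x rule: less_induct)
  case (less n)
  have lc: "linear_pm (*) (\<lambda>x. chiF x)" and ln: "linear_pm (*) (\<lambda>x. chin n x)" by (intro lin_intro)+
  have "chin n (wd u * r * wd v) = 0" if r: "r \<in> bt_relators C d" for r u v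
  proof -
    obtain e where e: "\<And>w. Word w \<in> Poly_Mapping.keys r \<Longrightarrow> deg w = e"
      using relator_homogeneous[OF r] by metis
    have I: "wd u * r * wd v \<in> bt_ideal C d" for u v
      using ideal.I_l_closed[OF ideal_bt_ideal] ideal.I_r_closed[OF ideal_bt_ideal] bt_relators_in_ideal[OF r]
      by force
    have z: "chin n (wd u * r * wd v) = (if deg u + e + deg v = n then chiF (wd u * r * wd v) else 0)"
      by (rule keys_linear_cong[where s = "(*)" and x = r])
        ((intro lin_intro)+, auto simp: linear_pm_def algebra_simps,
          auto simp: linear_pm_add[OF lc] linear_pm_scale[OF lc] pm_scale_mult_left pm_scale_mult_right,
          use e in \<open>auto simp: chin_wd chiF_wd wt_append simp flip: wd_append mult.assoc\<close>)
    note hom = chi_act_homogeneous[where r = r and n = e]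
    show ?thesis
    proof (cases "deg u + e + deg v = n")
      case True
      have "chiF (wd u * r * wd v) = 0"
      proof (cases "deg u = 0 \<and> deg v = 0")
        case True
        then show ?thesis using chi_group_like_relator[OF r] by blast
      next
        case False
        then consider "deg u > 0" | "deg v > 0" by blast
        then show ?thesis
        proof cases
          case 1
          have "chiF (actL (wd b) (wd [] * r * wd v)) = 0" for b
            by (subst hom, erule e, rule less.IH) (use True 1 in \<open>auto intro!: act_ideal I\<close>)
          then show ?thesis unfolding mult.assoc chiF_mult_left by (simp add: wd_Nil)
        next
          case 2
          have "chiF (actR (wd b) (wd u * r * wd [])) = 0" for b
            by (subst hom, erule e, rule less.IH) (use True 2 in \<open>auto intro!: act_ideal I\<close>)
          then show ?thesis unfolding chiF_mult_right by (simp add: wd_Nil)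
        qed
      qed
      then show ?thesis using z by simp
    qed (simp add: z)
  qed
  then have "bt_ideal C d \<subseteq> {x. chin n x = 0}"
    by (intro bt_ideal_subset) (auto simp: linear_pm_add[OF ln] linear_pm_scale[OF ln] linear_pm_0[OF ln])
  with less.prems show ?case by blast
qed

lemma chiF_ideal: assumes "x \<in> bt_ideal C d" shows "chiF x = 0"
proof -
  have "chiF x = (\<Sum>n\<in>(\<lambda>k. deg (letters k)) ` Poly_Mapping.keys x. chin n x)"
  proof (rule keys_linear_cong[where s = "(*)" and x = x and f = chiF and
        h = "\<lambda>y. \<Sum>n\<in>(\<lambda>k. deg (letters k)) ` Poly_Mapping.keys x. chin n y"])
    show "linear_pm (*) (\<lambda>y. \<Sum>n\<in>(\<lambda>k. deg (letters k)) ` Poly_Mapping.keys x. chin n y)"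
      using linear_chin[OF linear_ident] by (simp add: linear_pm_def sum.distrib sum_distrib_left)
    fix w assume "Word w \<in> Poly_Mapping.keys x"
    then have "deg w \<in> (\<lambda>k. deg (letters k)) ` Poly_Mapping.keys x" by (metis imageI word.sel)
    then show "chiF (wd w) = (\<Sum>n\<in>(\<lambda>k. deg (letters k)) ` Poly_Mapping.keys x. chin n (wd w))"
      by (simp add: chin_wd chiF_wd)
  qed (intro lin_intro)
  then show ?thesis by (simp add: chin_ideal[OF assms])
qed

end

section \<open>The embedding\<close>

lemma keys_linear_closed:
  fixes f :: "'a free_algebra \<Rightarrow> 'c::ab_group_add"
  assumes f: "linear_pm s f" and zero: "0 \<in> M" and add: "\<And>x y. x \<in> M \<Longrightarrow> y \<in> M \<Longrightarrow> x + y \<in> M"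
    and scale: "\<And>c x. x \<in> M \<Longrightarrow> s c x \<in> M" and M: "\<And>w. Word w \<in> Poly_Mapping.keys x \<Longrightarrow> f (wd w) \<in> M"
  shows "f x \<in> M"
proof -
  have x: "x = (\<Sum>k\<in>Poly_Mapping.keys x. Poly_Mapping.single k (Poly_Mapping.lookup x k))"
    by (rule poly_mapping_eqI) (auto simp: lookup_sum lookup_single when_def in_keys_iff sum.delta)
  have "f (Poly_Mapping.single k c) \<in> M" if "k \<in> Poly_Mapping.keys x" for k c
    using linear_pm_single[OF f, of k c] scale[OF M[of "letters k"]] that by (simp add: wd_def)
  moreover have "(\<Sum>k\<in>A. h k) \<in> M" if "\<And>k. k \<in> A \<Longrightarrow> h k \<in> M" for A and h :: "'a word \<Rightarrow> 'c"
    using that by (induction A rule: infinite_finite_induct) (auto simp: zero add)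
  ultimately show ?thesis
    by (subst x) (simp add: linear_pm_sum[OF f])
qed

lemma sw_closed:
  assumes "\<And>x y. x \<in> M \<Longrightarrow> y \<in> M \<Longrightarrow> x + y \<in> M" "\<And>u v. (u, v) \<in> splits w \<Longrightarrow> g u v \<in> M"
  shows "sw w g \<in> M"
  using assms(2)
proof (induction w arbitrary: g)
  case (Cons x w)
  show ?case
  proof (cases x)
    case (Theta i)
    have "sw w (\<lambda>u v. g (x # u) v) \<in> M" "sw w (\<lambda>u v. g (H i # u) (x # v)) \<in> M"
      by (rule Cons.IH; rule Cons.prems; force simp: Theta)+
    then show ?thesis using assms(1) Theta by simp
  next
    case (H i)
    have "sw w (\<lambda>u v. g (x # u) (x # v)) \<in> M"
      by (rule Cons.IH; rule Cons.prems; force simp: H)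
    then show ?thesis using H by simp
  next
    case (Hinv i)
    have "sw w (\<lambda>u v. g (x # u) (x # v)) \<in> M"
      by (rule Cons.IH; rule Cons.prems; force simp: Hinv)
    then show ?thesis using Hinv by simp
  qed
qed simp

text \<open>\<open>Bhat\<close> is spanned by the images of these words. The coproduct of a word can
  introduce letters h but no new inverses, which is why \<xi> carries \<open>Bhat\<close> into
  \<open>BhatBhat\<close>.\<close>

definition hinv_free :: "'i gen list \<Rightarrow> bool" where
  "hinv_free w \<longleftrightarrow> (\<forall>i. Hinv i \<notin> set w)"

lemma hinv_free_simps [simp]: "hinv_free []" "hinv_free (x # w) \<longleftrightarrow> (\<forall>i. x \<noteq> Hinv i) \<and> hinv_free w"
  by (auto simp: hinv_free_def)

lemma hinv_free_splits: "(u, v) \<in> splits w \<Longrightarrow> hinv_free w \<Longrightarrow> hinv_free u \<and> hinv_free v"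
  by (induction w arbitrary: u v) (force split: gen.splits)+

lemma hinv_free_map: "hinv_free (map (map_gen t) w) \<longleftrightarrow> hinv_free w"
proof -
  have "map_gen t x = Hinv i \<longleftrightarrow> (\<exists>j. x = Hinv j \<and> t j = i)" for x i by (cases x) auto
  then show ?thesis unfolding hinv_free_def by (auto simp: image_iff) metis+
qed

context hopf_data
begin

definition chiB :: "'i bt \<Rightarrow> base" where "chiB a = chiF (SOME x. pi x = a)"

lemma chiB_pi: "chiB (pi x) = chiF x"
proof -
  have "pi (SOME y. pi y = pi x) = pi x" by (rule someI) simp
  then have "chiF ((SOME y. pi y = pi x) - x) = 0" by (intro chiF_ideal) (simp add: pi_eq_iff)
  then show ?thesis
    by (simp add: chiB_def linear_pm_diff[OF linear_chiF[OF linear_ident]])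
qed

text \<open>Defining \<xi> on the quotient by its Sweedler formula makes independence of lifts
  automatic; the vanishing of \<chi> on the ideal enters through \<open>chiB\<close>, and
  \<open>xi_pi\<close> recovers the lift \<open>xiF\<close>.\<close>

definition xi :: "'i bt \<Rightarrow> (base, 'i bt, 'i bt) tensor" where
  "xi a = tensor_lift BB (\<lambda>a1 a'. tensor_lift BB (\<lambda>a2 a3.
     chiB a2 \<odot>\<^bsub>BB\<^esub> bt_tensor C d (T a3) a1) (\<Delta> a')) (\<Delta> a)"

lemma xi_pi: "xi (pi x) = Pi (xiF x)"
  unfolding xi_def xiF_def Delta_pi
  apply (rule lift_BB; (intro lin_intro module_pm_scale)?)
  unfolding Delta_pi
  apply (rule lift_BB; (intro lin_intro module_pm_scale)?)
  by (simp add: chiB_pi T_pi Pi_scale B.Pi2_ext_prod)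

section \<open>Injectivity by leading terms\<close>

definition eps_xi :: "'i gen free_algebra \<Rightarrow> 'i gen free_algebra" where
  "eps_xi x = bil_ext pm_scale (\<lambda>u v. pm_scale (epsF u) v) (xiF x)"

lemma linear_eps_xi [lin_intro]: "linear_pm pm_scale h \<Longrightarrow> linear_pm pm_scale (\<lambda>x. eps_xi (h x))"
  unfolding eps_xi_def by (intro lin_intro module_pm_scale)

lemma pi_eps_xi: "pi (eps_xi x) = tensor_lift (Bt C d) (\<lambda>u v. \<epsilon> u \<odot>\<^bsub>Bt C d\<^esub> v) (xi (pi x))"
  unfolding eps_xi_def xi_pi
  by (rule lift_B[symmetric]) (intro lin_intro | simp add: eps_pi pi_scale)+

lemma sw_counit_right: "sw w (\<lambda>u v. if deg v = 0 then g u else 0) = g w"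
  using sw_right_deg_0[of w "\<lambda>u v. if deg v = 0 then g u else 0"] by (simp add: deg_hp)

text \<open>The counit removes the third coproduct factor. In the remaining sum the term with
  \<open>a\<close> of highest degree is the one with \<open>a = w\<close>, and its coefficient is
  \<chi> of \<open>hp w\<close>.\<close>

lemma eps_xi_wd: "eps_xi (wd w) = sw w (\<lambda>a b. pm_scale (chiw b) (wd a))"
proof -
  have l: "linear_pm pm_scale (bil_ext pm_scale (\<lambda>u v. pm_scale (epsF u) v))" by (intro lin_intro module_pm_scale)
  have one: "bil_ext pm_scale (\<lambda>u v. pm_scale (epsF u) v) (ext_prod (wd u) (wd v)) = (if deg u = 0 then wd v else 0)"
    for u v :: "'i gen list"
    by (simp add: wd_def bil_ext_single module_pm_scale, simp add: epsF_wd flip: wd_def)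
  have "eps_xi (wd w) = sw w (\<lambda>a r. sw r (\<lambda>b c. if deg c = 0 then pm_scale (chiw b) (wd a) else 0))"
    unfolding eps_xi_def xiF_wd sw3_def sw_linear[OF l] linear_pm_scale[OF l] one
    by (intro arg_cong[where f = "sw _"] ext) simp
  then show ?thesis by (simp only: sw_counit_right)
qed

lemma sw_deg_0: "deg w = 0 \<Longrightarrow> sw w g = g w w"
proof -
  assume w: "deg w = 0"
  then have "gl w = w" by (induction w rule: gl.induct) auto
  then show ?thesis using w wt_splits[of _ _ w "\<lambda>_. Suc 0"] sw_left_deg_0[of w g] by fastforce
qed

lemma p_deg_0: "deg u = 0 \<Longrightarrow> deg v = 0 \<Longrightarrow> p u v \<noteq> 0"
proof (induction u arbitrary: v)
  case (Cons x u)
  then have x: "deg [x] = 0" "deg u = 0" by (cases x; simp)+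
  have "p [x] v \<noteq> 0" using Cons.prems(2)
  proof (induction v)
    case (Cons y v)
    then have y: "deg [y] = 0" "deg v = 0" by (cases y; simp)+
    have "p [x] (y # v) = p [x] [y] * p [x] v"
      using p_append_right[of "[x]" "[y]" v] sw_deg_0[OF x(1)] by simp
    then show ?case using Cons y p_letters_neq_0 x by simp
  qed (use x in \<open>simp add: p_Nil_right\<close>)
  moreover have "p (x # u) v = p [x] v * p u v"
    using p_append_left[of "[x]" u v] sw_deg_0[OF Cons.prems(2)] by simp
  ultimately show ?case using Cons x by simp
qed (simp add: p_Nil_left)

text \<open>On such words \<chi> is a product of values of \<open>kap\<close> and of pairings of
  letters h and h^-1, all nonzero. This makes the leading coefficients of \<open>eps_xi\<close>
  invertible.\<close>

lemma chiw_deg_0: "deg w = 0 \<Longrightarrow> chiw w \<noteq> 0"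
proof (induction w)
  case (Cons x w)
  then have w: "deg w = 0" and x: "deg [map_gen \<tau> x] = 0" by (cases x; simp)+
  have "hcoef kap x \<noteq> 0" by (cases x) auto
  then show ?case using Cons.IH[OF w] p_deg_0[OF x w] by (simp add: chi_Cons sw_deg_0[OF w])
qed simp

text \<open>A left inverse of the leading term of \<open>eps_xi\<close> in degree \<open>N\<close>, see \<open>top_part_eps_xi\<close>.\<close>

definition top_part :: "nat \<Rightarrow> 'i gen free_algebra \<Rightarrow> 'i gen free_algebra" where
  "top_part N = lin_ext pm_scale (\<lambda>k. if deg (letters k) = N
     then pm_scale (inverse (chiw (hp (letters k)))) (wd (letters k)) else 0)"

lemma linear_top_part [lin_intro]: "linear_pm pm_scale h \<Longrightarrow> linear_pm pm_scale (\<lambda>x. top_part N (h x))"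
  unfolding top_part_def by (intro lin_intro module_pm_scale)

lemma top_part_wd: "top_part N (wd w) = (if deg w = N then pm_scale (inverse (chiw (hp w))) (wd w) else 0)"
  by (simp add: top_part_def wd_def lin_ext_one module_pm_scale)

text \<open>The rescaling depends on the word, so it has to be constant along u r v. The value of
  \<chi> on \<open>hp (u @ w @ v)\<close> depends only on the class in the quotient, and
  \<open>hp w\<close> has the same class for all words w of \<open>r\<close>. Hence
  \<open>top_part\<close> multiplies u r v by a scalar, which is 0 in the wrong degree.\<close>

lemma top_part_ideal: "x \<in> bt_ideal C d \<Longrightarrow> top_part N x \<in> bt_ideal C d"
proof -
  assume x: "x \<in> bt_ideal C d"
  have l: "linear_pm pm_scale (\<lambda>x. top_part N x)" by (intro lin_intro)
  have I: "x + y \<in> bt_ideal C d" "pm_scale c x \<in> bt_ideal C d" if "x \<in> bt_ideal C d" "y \<in> bt_ideal C d" for x y c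
    using that by (simp_all add: in_bt_ideal_iff pi_add pi_scale flip: pi_add[of 0 0, simplified])
      (metis mult_zero_right pi_scale pm_scale_simps(4))
  have I0: "0 \<in> bt_ideal C d" by (simp add: in_bt_ideal_iff)
  have "bt_ideal C d \<subseteq> {x. top_part N x \<in> bt_ideal C d}"
  proof (rule bt_ideal_subset)
    fix r u v assume r: "r \<in> bt_relators C d"
    obtain n g h where gh: "\<And>w. Word w \<in> Poly_Mapping.keys r \<Longrightarrow> deg w = n \<and> pi (wd (hp w)) = h"
      using relator_homogeneous[OF r] by metis
    have Ir: "wd u * r * wd v \<in> bt_ideal C d"
      using ideal.I_l_closed[OF ideal_bt_ideal] ideal.I_r_closed[OF ideal_bt_ideal] bt_relators_in_ideal[OF r]
      by force
    let ?c = "if deg u + n + deg v = N then inverse (chiB (pi (wd (hp u)) \<otimes>\<^bsub>Bt C d\<^esub> h \<otimes>\<^bsub>Bt C d\<^esub> pi (wd (hp v)))) else 0"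
    have "top_part N (wd u * r * wd v) = pm_scale ?c (wd u * r * wd v)"
    proof (rule keys_linear_cong[where s = pm_scale and x = r])
      fix w assume "Word w \<in> Poly_Mapping.keys r"
      note w = gh[OF this]
      have "chiw (hp (u @ w @ v)) = chiB (pi (wd (hp u)) \<otimes>\<^bsub>Bt C d\<^esub> h \<otimes>\<^bsub>Bt C d\<^esub> pi (wd (hp v)))"
        using w by (simp only: hp_append wd_append mult.assoc[symmetric] B.pi_mult chiB_pi chiF_wd flip: chiF_wd chiB_pi)
      then show "top_part N (wd u * wd w * wd v) = pm_scale ?c (wd u * wd w * wd v)"
        using w by (simp add: mult.assoc add.assoc top_part_wd wt_append flip: wd_append)
    qed (intro lin_intro)+
    then show "wd u * r * wd v \<in> {x. top_part N x \<in> bt_ideal C d}" using I(2)[OF Ir Ir] by simp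
  qed (use I I0 in \<open>auto simp: linear_pm_add[OF l] linear_pm_scale[OF l] linear_pm_0[OF l]\<close>)
  with x show ?thesis by blast
qed

lemma top_part_eps_xi:
  assumes "deg w \<le> N"
  shows "top_part N (eps_xi (wd w)) = (if deg w = N then wd w else 0)"
proof -
  have l: "linear_pm pm_scale (\<lambda>x. top_part N x)" by (intro lin_intro)
  let ?g = "\<lambda>a b. pm_scale (chiw b) (if deg a = N then pm_scale (inverse (chiw (hp a))) (wd a) else 0)"
  have "top_part N (eps_xi (wd w)) = sw w ?g"
    by (simp only: eps_xi_wd sw_linear[OF l] linear_pm_scale[OF l] top_part_wd)
  also have "\<dots> = ?g w (hp w)"
  proof (rule sw_right_deg_0)
    fix u v assume "(u, v) \<in> splits w" "deg v \<noteq> 0"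
    then have "deg u \<noteq> N" using wt_splits[of u v w "\<lambda>_. Suc 0"] assms by linarith
    then show "?g u v = 0" by simp
  qed
  also have "\<dots> = (if deg w = N then wd w else 0)"
    using chiw_deg_0[OF deg_hp] by simp
  finally show ?thesis .
qed

lemma eps_xi_ideal: "x \<in> bt_ideal C d \<Longrightarrow> eps_xi x \<in> bt_ideal C d"
  unfolding in_bt_ideal_iff pi_eps_xi[of x]
  using pi_eps_xi[of 0] linear_pm_0[OF linear_eps_xi[OF linear_ident]] by simp

text \<open>Descent on the degree bound: y = \<open>top_part N (eps_xi x)\<close> lies in the ideal
  and is precisely the component of \<open>x\<close> of degree N. Then x - y satisfies the
  hypotheses with a smaller bound, because \<open>eps_xi\<close> maps y into the ideal. For bound 0
  no word is left.\<close>

lemma ideal_of_eps_xi: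
  assumes "\<And>w. Word w \<in> Poly_Mapping.keys x \<Longrightarrow> deg w < N" "eps_xi x \<in> bt_ideal C d"
  shows "x \<in> bt_ideal C d"
  using assms
proof (induction N arbitrary: x)
  case 0
  then have "k \<notin> Poly_Mapping.keys x" for k by (metis less_nat_zero_code word.exhaust)
  then have "x = 0" by (intro poly_mapping_eqI) (simp add: in_keys_iff)
  then show ?case by (simp add: in_bt_ideal_iff)
next
  case (Suc N)
  define y where "y = top_part N (eps_xi x)"
  have y: "y \<in> bt_ideal C d" unfolding y_def by (intro top_part_ideal Suc.prems)
  have lk: "Poly_Mapping.lookup y (Word w) = (if deg w = N then Poly_Mapping.lookup x (Word w) else 0)" for w
    unfolding y_def
  proof (rule keys_linear_cong[where s = "(*)" and x = x])
    show "linear_pm (*) (\<lambda>x. Poly_Mapping.lookup (top_part N (eps_xi x)) (Word w))"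
      using linear_top_part[OF linear_eps_xi[OF linear_ident]] by (simp add: linear_pm_def lookup_add)
    show "linear_pm (*) (\<lambda>x. if deg w = N then Poly_Mapping.lookup x (Word w) else 0)"
      by (simp add: linear_pm_def lookup_add)
    fix w' assume "Word w' \<in> Poly_Mapping.keys x"
    then have "deg w' \<le> N" using Suc.prems(1) by fastforce
    then show "Poly_Mapping.lookup (top_part N (eps_xi (wd w'))) (Word w) = (if deg w = N then Poly_Mapping.lookup (wd w') (Word w) else 0)"
      by (simp add: top_part_eps_xi) (simp add: wd_def lookup_single when_def)
  qed
  have "deg w < N" if "Word w \<in> Poly_Mapping.keys (x - y)" for w
    using that Suc.prems(1)[of w] lk[of w] by (auto simp: in_keys_iff lookup_minus split: if_splits)
  moreover have "pi (eps_xi x) = pi (eps_xi y)"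
    using Suc.prems(2) eps_xi_ideal[OF y] by (simp add: in_bt_ideal_iff)
  then have "eps_xi (x - y) \<in> bt_ideal C d"
    by (simp add: linear_pm_diff[OF linear_eps_xi[OF linear_ident]] pi_eq_iff)
  ultimately have "x - y \<in> bt_ideal C d" by (rule Suc.IH)
  then have "pi x = pi y" by (simp add: pi_eq_iff)
  then show ?case using y by (simp add: in_bt_ideal_iff)
qed

lemma inj_xi: assumes "xi (pi x) = xi (pi y)" shows "pi x = pi y"
proof -
  have "pi (eps_xi x) = pi (eps_xi y)" by (simp add: pi_eps_xi assms)
  then have "eps_xi (x - y) \<in> bt_ideal C d"
    by (simp add: linear_pm_diff[OF linear_eps_xi[OF linear_ident]] pi_eq_iff)
  moreover have "deg w < Suc (\<Sum>k\<in>Poly_Mapping.keys (x - y). deg (letters k))"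
    if "Word w \<in> Poly_Mapping.keys (x - y)" for w
    using member_le_sum[OF that, of "\<lambda>k. deg (letters k)"] by simp
  ultimately have "x - y \<in> bt_ideal C d" by (rule ideal_of_eps_xi[rotated])
  then show ?thesis by (simp add: pi_eq_iff)
qed

section \<open>The subalgebra \<open>Bhat\<close> and its image\<close>

lemma Bhat_subset: "Bhat C d \<subseteq> pi ` {x. \<forall>w. Word w \<in> Poly_Mapping.keys x \<longrightarrow> hinv_free w}"
proof -
  let ?K = "{x :: 'i gen free_algebra. \<forall>w. Word w \<in> Poly_Mapping.keys x \<longrightarrow> hinv_free w}"
  have add: "x + y \<in> ?K" if "x \<in> ?K" "y \<in> ?K" for x y
    using that keys_add[of x y] by blast
  have scale: "pm_scale c x \<in> ?K" if "x \<in> ?K" for x c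
    using that keys_pm_scale[of c x] by blast
  have mult: "x * y \<in> ?K" if "x \<in> ?K" "y \<in> ?K" for x y
  proof -
    have "hinv_free w" if w: "Word w \<in> Poly_Mapping.keys (x * y)" for w
    proof -
      obtain a b where "Word w = a + b" "a \<in> Poly_Mapping.keys x" "b \<in> Poly_Mapping.keys y"
        using keys_mult[of x y] w by blast
      moreover have "hinv_free (letters a)" "hinv_free (letters b)"
        using calculation \<open>x \<in> ?K\<close> \<open>y \<in> ?K\<close> by (metis (mono_tags, lifting) mem_Collect_eq word.collapse)+
      ultimately show ?thesis by (auto simp: plus_word_def hinv_free_def)
    qed
    then show ?thesis by simp
  qed
  have one: "1 \<in> ?K" by (simp add: hinv_free_def flip: single_one) (simp add: zero_word_def)
  have "subring (pi ` ?K) (Bt C d)"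
  proof
    fix a assume "a \<in> pi ` ?K"
    then obtain x where x: "x \<in> ?K" "a = pi x" by blast
    have "pi (pm_scale (- 1) x) \<oplus>\<^bsub>Bt C d\<^esub> pi x = pi 0"
      by (simp add: pm_scale_minus_one flip: pi_add)
    then have "\<ominus>\<^bsub>Bt C d\<^esub> pi x = pi (pm_scale (- 1) x)"
      using rec_linear_0[OF B.V.vect_axioms B.lin] by (intro B.V.minus_equality) auto
    then show "inv\<^bsub>add_monoid (Bt C d)\<^esub> a \<in> pi ` ?K"
      using x scale by (auto simp: a_inv_def)
  next
    show "\<one>\<^bsub>add_monoid (Bt C d)\<^esub> \<in> pi ` ?K"
      using rec_linear_0[OF B.V.vect_axioms B.lin] by (auto intro!: image_eqI[of _ _ 0])
    show "\<one>\<^bsub>Bt C d\<^esub> \<in> pi ` ?K"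
      using one by (auto simp flip: B.pi_one)
  next
    fix a b assume "a \<in> pi ` ?K" "b \<in> pi ` ?K"
    then obtain x y where "x \<in> ?K" "a = pi x" "y \<in> ?K" "b = pi y" by blast
    then show "a \<otimes>\<^bsub>add_monoid (Bt C d)\<^esub> b \<in> pi ` ?K" "a \<otimes>\<^bsub>Bt C d\<^esub> b \<in> pi ` ?K"
      using add[of x y] mult[of x y] by (simp_all add: imageI flip: pi_add B.pi_mult del: mem_Collect_eq)
  qed (auto simp: B.onto)
  moreover have "c \<odot>\<^bsub>Bt C d\<^esub> a \<in> pi ` ?K" if "a \<in> pi ` ?K" for c a
    using that scale by (auto simp flip: pi_scale)
  moreover have "range (theta C d) \<union> range (hh C d) \<subseteq> pi ` ?K"
    by (auto simp: theta_wd hh_wd wd_def hinv_free_def)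
  ultimately show ?thesis unfolding Bhat_def gen_subalgebra_def by blast
qed

lemma wd_in_Bhat: "hinv_free w \<Longrightarrow> pi (wd w) \<in> Bhat C d"
proof (induction w)
  case Nil
  show ?case
    unfolding Bhat_def gen_subalgebra_def
    by (auto simp: wd_Nil B.pi_one subring_def submonoid.one_closed)
next
  case (Cons x w)
  then have w: "pi (wd w) \<in> Bhat C d" and x: "\<And>i. x \<noteq> Hinv i" by (auto simp: hinv_free_def)
  have "pi (wd [x]) \<in> range (theta C d) \<union> range (hh C d)"
    using x by (cases x) (auto simp: theta_wd hh_wd)
  then have "pi (wd [x]) \<otimes>\<^bsub>Bt C d\<^esub> pi (wd w) \<in> Bhat C d"
    using w unfolding Bhat_def gen_subalgebra_def
    by (auto simp: subring_def intro!: submonoid.m_closed)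
  then show ?case by (subst wd_Cons) (simp add: B.pi_mult)
qed

text \<open>Membership in \<open>BhatBhat\<close> asks for a representative supported on
  \<open>Bhat\<close> times \<open>Bhat\<close>. For \<open>x\<close> free of inverse letters
  \<open>push (xiF x)\<close> is such a representative, hence the condition on \<open>push\<close>
  in \<open>?M\<close>.\<close>

lemma xi_Bhat: "xi ` Bhat C d \<subseteq> BhatBhat C d"
proof -
  let ?M = "{X. Poly_Mapping.keys (B.push X) \<subseteq> Bhat C d \<times> Bhat C d}"
  note lp = B.linear_push
  have M0: "0 \<in> ?M" by (simp add: linear_pm_0[OF lp])
  have Madd: "X + Y \<in> ?M" if "X \<in> ?M" "Y \<in> ?M" for X Y
    using that keys_add[of "B.push X" "B.push Y"] by (auto simp: linear_pm_add[OF lp])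
  have Mscale: "pm_scale c X \<in> ?M" if "X \<in> ?M" for X c
    using that keys_pm_scale[of c "B.push X"] by (auto simp: linear_pm_scale[OF lp])
  have Mwd: "ext_prod (wd u) (wd v) \<in> ?M" if "hinv_free u" "hinv_free v" for u v
    using that wd_in_Bhat by (simp add: wd_def B.push_single)
  have "xi (pi x) \<in> BhatBhat C d" if x: "\<And>w. Word w \<in> Poly_Mapping.keys x \<Longrightarrow> hinv_free w" for x
  proof -
    have "xiF x \<in> ?M"
    proof (rule keys_linear_closed[where s = pm_scale and x = x, OF linear_xiF[OF linear_ident] M0 Madd Mscale])
      fix w assume "Word w \<in> Poly_Mapping.keys x"
      then have w: "hinv_free w" by (rule x)
      show "xiF (wd w) \<in> ?M"
        unfolding xiF_wd sw3_def
      proof (intro sw_closed Madd Mscale Mwd)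
        fix a r b c assume "(a, r) \<in> splits w" "(b, c) \<in> splits r"
        then show "hinv_free (tw c)" "hinv_free a"
          using hinv_free_splits w unfolding hinv_free_map by blast+
      qed
    qed
    then show ?thesis
      unfolding xi_pi B.Pi2_def BhatBhat_def tensor_subspace_def by blast
  qed
  then show ?thesis using Bhat_subset by auto
qed

text \<open>In the threefold coproduct \<theta> \<otimes> 1 \<otimes> 1 + h \<otimes> \<theta>
  \<otimes> 1 + h \<otimes> h \<otimes> \<theta> the middle term dies by \<chi> \<theta>_i = 0. The
  last one gives \<open>kap i\<close> times \<theta>_{\<tau> i} \<otimes> h_i, and the deformed
  product of \<theta>_{\<tau> i} \<otimes> 1 with 1 \<otimes> h_i carries the same factor.\<close>

lemma xi_theta: "xi (theta C d i) = bt_tensor C d \<one>\<^bsub>Bt C d\<^esub> (theta C d i) \<oplus>\<^bsub>BtBt_iota C d \<Delta> \<phi>\<^esub>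
         (bt_tensor C d (theta C d (\<tau> i)) \<one>\<^bsub>Bt C d\<^esub> \<otimes>\<^bsub>BtBt_iota C d \<Delta> \<phi>\<^esub>
          bt_tensor C d \<one>\<^bsub>Bt C d\<^esub> (hh C d i))"
proof -
  have "xi (theta C d i) = Pi (ext_prod (wd []) (wd [Theta i]) + iota_mult2 (ext_prod (wd [Theta (\<tau> i)]) (wd [])) (ext_prod (wd []) (wd [H i])))"
    unfolding theta_wd xi_pi by (simp add: xiF_wd sw3_def iota_mult2_wd chi_simps p_Nil_left)
  then show ?thesis
    by (simp add: Pi_add theta_wd hh_wd B.Pi2_ext_prod wd_Nil B.pi_one flip: BtBt_iota_mult)
      (simp add: BtBt_iota_def)
qed

lemma xi_hh: "xi (hh C d i) = bt_tensor C d (hh C d (\<tau> i)) \<one>\<^bsub>Bt C d\<^esub> \<otimes>\<^bsub>BtBt_iota C d \<Delta> \<phi>\<^esub>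
         bt_tensor C d \<one>\<^bsub>Bt C d\<^esub> (hh C d i)"
proof -
  have "xi (hh C d i) = Pi (iota_mult2 (ext_prod (wd [H (\<tau> i)]) (wd [])) (ext_prod (wd []) (wd [H i])))"
    unfolding hh_wd xi_pi by (simp add: xiF_wd sw3_def iota_mult2_wd chi_simps p_Nil_left)
  then show ?thesis
    by (simp add: hh_wd B.Pi2_ext_prod wd_Nil B.pi_one flip: BtBt_iota_mult)
qed

lemma carrier_Bt_iota: "carrier (Bt_iota C d \<Delta> \<phi> T) = range pi"
  by (simp add: Bt_iota_def B.onto)

lemma xi_alg_hom: "xi \<in> alg_hom (Bt_iota C d \<Delta> \<phi> T) (BtBt_iota C d \<Delta> \<phi>)"
proof -
  have "xiF 1 = ext_prod 1 1"
    by (simp add: xiF_wd sw3_def flip: wd_Nil)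
  then have one: "xi \<one>\<^bsub>Bt C d\<^esub> = \<one>\<^bsub>BB\<^esub>"
    using xi_pi[of 1] by (simp only: B.pi_one B.Pi2_ext_prod) (simp add: tensor_alg_def)
  have "xi \<in> ring_hom (Bt_iota C d \<Delta> \<phi> T) (BtBt_iota C d \<Delta> \<phi>)"
  proof (rule ring_hom_memI)
    fix a b assume "a \<in> carrier (Bt_iota C d \<Delta> \<phi> T)" "b \<in> carrier (Bt_iota C d \<Delta> \<phi> T)"
    then obtain x y where xy: "a = pi x" "b = pi y" by (auto simp: carrier_Bt_iota)
    show "xi a \<in> carrier (BtBt_iota C d \<Delta> \<phi>)"
      by (simp add: xy xi_pi BtBt_iota_def B.carrier_tensor_alg)
    show "xi (a \<otimes>\<^bsub>Bt_iota C d \<Delta> \<phi> T\<^esub> b) = xi a \<otimes>\<^bsub>BtBt_iota C d \<Delta> \<phi>\<^esub> xi b"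
      by (simp add: xy Bt_iota_mult BtBt_iota_mult xi_pi xiF_iota_mult)
    show "xi (a \<oplus>\<^bsub>Bt_iota C d \<Delta> \<phi> T\<^esub> b) = xi a \<oplus>\<^bsub>BtBt_iota C d \<Delta> \<phi>\<^esub> xi b"
      by (simp add: xy Bt_iota_def BtBt_iota_def xi_pi linear_pm_add[OF linear_xiF[OF linear_ident]] Pi_add flip: pi_add)
  qed (simp add: Bt_iota_def BtBt_iota_def one)
  moreover have "xi (c \<odot>\<^bsub>Bt_iota C d \<Delta> \<phi> T\<^esub> pi x) = c \<odot>\<^bsub>BtBt_iota C d \<Delta> \<phi>\<^esub> xi (pi x)" for c x
    by (simp add: Bt_iota_def BtBt_iota_def xi_pi linear_pm_scale[OF linear_xiF[OF linear_ident]] Pi_scale flip: pi_scale)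
  ultimately show ?thesis by (auto simp: alg_hom_def carrier_Bt_iota)
qed

end

theorem lemma4p3:
  fixes C :: "'i::finite \<Rightarrow> 'i \<Rightarrow> int"
    and d :: "'i \<Rightarrow> nat"
    and \<tau> :: "'i \<Rightarrow> 'i"
    and \<Delta> :: "'i bt \<Rightarrow> (base, 'i bt, 'i bt) tensor"
    and \<epsilon> :: "'i bt \<Rightarrow> base"
    and \<phi> :: "'i bt \<Rightarrow> 'i bt \<Rightarrow> base"
    and T :: "'i bt \<Rightarrow> 'i bt"
  assumes "symmetrizable_GCM C d"
    and "quasi_split_satake C d \<tau>"
    and "is_comult C d \<Delta>"
    and "is_counit C d \<epsilon>"
    and "is_hopf_pairing C d \<Delta> \<epsilon> \<phi>"
    and "is_diagram_action C d \<tau> T"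
  shows "\<exists>\<xi> \<in> alg_hom (Bt_iota C d \<Delta> \<phi> T) (BtBt_iota C d \<Delta> \<phi>).
      inj_on \<xi> (carrier (Bt_iota C d \<Delta> \<phi> T)) \<and>
      (\<forall>i. \<xi> (theta C d i) =
         bt_tensor C d \<one>\<^bsub>Bt C d\<^esub> (theta C d i) \<oplus>\<^bsub>BtBt_iota C d \<Delta> \<phi>\<^esub>
         (bt_tensor C d (theta C d (\<tau> i)) \<one>\<^bsub>Bt C d\<^esub> \<otimes>\<^bsub>BtBt_iota C d \<Delta> \<phi>\<^esub>
          bt_tensor C d \<one>\<^bsub>Bt C d\<^esub> (hh C d i))) \<and>
      (\<forall>i. \<xi> (hh C d i) =
         bt_tensor C d (hh C d (\<tau> i)) \<one>\<^bsub>Bt C d\<^esub> \<otimes>\<^bsub>BtBt_iota C d \<Delta> \<phi>\<^esub>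
         bt_tensor C d \<one>\<^bsub>Bt C d\<^esub> (hh C d i)) \<and>
      \<xi> ` Bhat C d \<subseteq> BhatBhat C d"
proof -
  interpret hopf_data C d \<tau> \<Delta> \<epsilon> \<phi> T using assms by unfold_locales
  have "inj_on xi (carrier (Bt_iota C d \<Delta> \<phi> T))"
    using inj_xi by (auto simp: inj_on_def carrier_Bt_iota)
  then show ?thesis
    using xi_alg_hom xi_theta xi_hh xi_Bhat by blast
qed

end
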